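(* For any fixed natural number $k$, the set $X_\infty^{\leq k} \subseteq A_\infty$ is the common zero set of finitely many $G_\infty$-orbits of polynomials in $T_\infty$.
   Context: Let $K$ be an infinite field, $n \geq 1$ a fixed natural number, $V=K^n$, and $x_0 \in V^*$ a fixed nonzero linear function. For $p \in \mathbb{N}$ let $\pi_p : V^{\otimes (p+1)} \to V^{\otimes p}$ be the contraction determined by $v_1 \otimes \cdots \otimes v_{p+1} \mapsto x_0(v_{p+1})\, v_1 \otimes \cdots \otimes v_p$. Let $A_\infty = \varprojlim_p V^{\otimes p}$ be the projective limit along the $\pi_p$; its elements are sequences $\omega=(\omega_p)_p$ with $\omega_p \in V^{\otimes p}$ and $\pi_p(\omega_{p+1})=\omega_p$. Let $T_p = S((V^* )^{\otimes p})$ be the coordinate ring of $V^{\otimes p}$, embedded into $T_{p+1}$ by the algebra homomorphism extending $\xi \mapsto \xi \otimes x_0$, and let $T_\infty=\bigcup_p T_p$. An element $f \in T_p$ is a function on $A_\infty$ via $f(\omega)=f(\omega_p)$. The group $S_p$ acts on $V^{\otimes p}$ by permuting tensor factors and $\mathrm{GL}(V)^p$ acts by $(g_1,\ldots,g_p)(v_1 \otimes \cdots \otimes v_p)=g_1v_1 \otimes \cdots \otimes g_pv_p$; together these give an action of $G_p = S_p \ltimes \mathrm{GL}(V)^p$. Embed $G_p$ into $G_{p+1}$ by letting permutations fix $p+1$ and by $(g_1,\ldots,g_p) \mapsto (g_1,\ldots,g_p,1)$, and let $G_\infty=\bigcup_p G_p$. It acts on $A_\infty$ by $(g\omega)_q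 = g\,\omega_q$ for $g \in G_p$, $q \geq p$, and on $T_\infty$ by algebra automorphisms, $(gf)(\omega)=f(g^{-1}\omega)$. The rank of a tensor in $V^{\otimes p}$ is the minimal number of terms in an expression of it as a sum of pure tensors $v_1 \otimes \cdots \otimes v_p$. Let $X_p^{\leq k} \subseteq V^{\otimes p}$ be the set of tensors of border rank at most $k$, i.e. the Zariski closure of the set of tensors of rank at most $k$. Then $\pi_p$ maps $X_{p+1}^{\leq k}$ into $X_p^{\leq k}$, and $X_\infty^{\leq k} \subseteq A_\infty$ is the projective limit of the $X_p^{\leq k}$, i.e. the set of $\omega$ with $\omega_p \in X_p^{\leq k}$ for all $p$. *)

theory Defs
  imports
    "HOL-Analysis.Cartesian_Space"
    "HOL-Library.Poly_Mapping"
    "HOL-Library.FuncSet"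
    "HOL-Computational_Algebra.Polynomial"
    "HOL-Combinatorics.Permutations"
    "HOL-Algebra.Group_Action"
begin

section \<open>Tensor powers of \<open>V = K\<^sup>n\<close>\<close>

text \<open>
  \<open>V\<close> is \<open>'k ^ 'n\<close>. A tensor in the \<open>p\<close>-th tensor power of \<open>V\<close> is given by its coordinates with
  respect to the basis of tensor products of standard basis vectors; the multi-indices are the lists
  of length \<open>p\<close> over \<open>'n\<close>, and coordinates at all other lists are set to 0.
  Tensor positions are numbered from 0.
\<close>

type_synonym ('k, 'n) tensor = "'n list \<Rightarrow> 'k"

definition tensors :: "nat \<Rightarrow> ('k::field, 'n::finite) tensor set" where
  "tensors p = {t. \<forall>l. length l \<noteq> p \<longrightarrow> t l = 0}"

definition tprod :: "nat \<Rightarrow> (nat \<Rightarrow> 'k ^ 'n) \<Rightarrow> ('k::field, 'n::finite) tensor" where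
  "tprod p v = (\<lambda>l. if length l = p then \<Prod>i<p. v i $ (l ! i) else 0)"

text \<open>The scalar factor matters only for \<open>p = 0\<close>, where it makes every element of the ground field
  (the zeroth tensor power) pure; for \<open>p > 0\<close> it can be absorbed into one of the vectors.\<close>

definition pure_tensors :: "nat \<Rightarrow> ('k::field, 'n::finite) tensor set" where
  "pure_tensors p = {t. \<exists>c v. t = (\<lambda>l. c * tprod p v l)}"

definition tensor_rank :: "nat \<Rightarrow> ('k::field, 'n::finite) tensor \<Rightarrow> nat" where
  "tensor_rank p t =
    (LEAST r. \<exists>s. (\<forall>i<r. s i \<in> pure_tensors p) \<and> t = (\<lambda>l. \<Sum>i<r. s i l))"

text \<open>The contraction \<open>\<pi>\<^sub>p\<close>, for every \<open>p\<close> at once; see \<open>contract_tprod\<close> below.\<close>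

definition contract ::
  "('k ^ 'n \<Rightarrow> 'k) \<Rightarrow> ('k::field, 'n::finite) tensor \<Rightarrow> ('k, 'n) tensor" where
  "contract x0 t = (\<lambda>l. \<Sum>j\<in>UNIV. x0 (axis j 1) * t (l @ [j]))"

definition A_inf :: "('k ^ 'n \<Rightarrow> 'k) \<Rightarrow> (nat \<Rightarrow> ('k::field, 'n::finite) tensor) set" where
  "A_inf x0 = {\<omega>. \<forall>p. \<omega> p \<in> tensors p \<and> contract x0 (\<omega> (Suc p)) = \<omega> p}"


section \<open>Polynomials on tensor powers\<close>

text \<open>The symmetric algebra \<open>T\<^sub>p\<close> is the polynomial ring in the coordinates on the \<open>p\<close>-th tensor
  power: a polynomial maps monomials (finitely supported exponent functions) to coefficients.\<close>

type_synonym ('k, 'n) tpoly = "('n list \<Rightarrow>\<^sub>0 nat) \<Rightarrow>\<^sub>0 'k"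

definition T_fin :: "nat \<Rightarrow> ('k::field, 'n::finite) tpoly set" where
  "T_fin p = {f. \<forall>m\<in>Poly_Mapping.keys f. \<forall>l\<in>Poly_Mapping.keys m. length l = p}"

definition tpoly_val :: "('k::field, 'n::finite) tpoly \<Rightarrow> ('k, 'n) tensor \<Rightarrow> 'k" where
  "tpoly_val f t = (\<Sum>m\<in>Poly_Mapping.keys f. Poly_Mapping.lookup f m *
     (\<Prod>l\<in>Poly_Mapping.keys m. t l ^ Poly_Mapping.lookup m l))"

text \<open>The embedding of \<open>T\<^sub>p\<close> into \<open>T\<^sub>p\<^sub>+\<^sub>1\<close>: the algebra homomorphism taking the coordinate with
  multi-index \<open>l\<close> to its tensor product with \<open>x0\<close>.\<close>

definition tpoly_embed ::
  "('k ^ 'n \<Rightarrow> 'k) \<Rightarrow> ('k::field, 'n::finite) tpoly \<Rightarrow> ('k, 'n) tpoly" where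
  "tpoly_embed x0 f = (\<Sum>m\<in>Poly_Mapping.keys f. Poly_Mapping.single 0 (Poly_Mapping.lookup f m) *
     (\<Prod>l\<in>Poly_Mapping.keys m.
        (\<Sum>j\<in>UNIV. Poly_Mapping.single (Poly_Mapping.single (l @ [j]) 1) (x0 (axis j 1)))
          ^ Poly_Mapping.lookup m l))"

definition tpoly_fun ::
  "('k ^ 'n \<Rightarrow> 'k) \<Rightarrow> nat \<Rightarrow> ('k::field, 'n::finite) tpoly \<Rightarrow> (nat \<Rightarrow> ('k, 'n) tensor) \<Rightarrow> 'k" where
  "tpoly_fun x0 p f = restrict (\<lambda>\<omega>. tpoly_val f (\<omega> p)) (A_inf x0)"

text \<open>The union \<open>T\<^sub>\<infinity>\<close> is formed inside the algebra of functions on \<open>A_inf x0\<close>. By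
  \<open>tpoly_fun_embed\<close> and \<open>inj_on_tpoly_fun\<close> below, for infinite \<open>K\<close> and nonzero \<open>x0\<close> this is the
  union of the rings \<open>T_fin p\<close> along the embeddings \<open>tpoly_embed x0\<close>.\<close>

definition T_inf :: "('k ^ 'n \<Rightarrow> 'k) \<Rightarrow> ((nat \<Rightarrow> ('k::field, 'n::finite) tensor) \<Rightarrow> 'k) set" where
  "T_inf x0 = (\<Union>p. tpoly_fun x0 p ` T_fin p)"


section \<open>The groups and their actions\<close>

text \<open>A pair \<open>(\<sigma>, g)\<close> stands for the product of \<open>\<sigma> \<in> S\<^sub>p\<close> and \<open>g \<in> GL(V)\<^sup>p\<close>, i.e. it acts by \<open>g\<close> first
  and by \<open>\<sigma>\<close> afterwards. With permutations of \<open>nat\<close> fixing all positions from \<open>p\<close> on and sequences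
  of matrices equal to 1 from \<open>p\<close> on, the embedding of \<open>G\<^sub>p\<close> into \<open>G\<^sub>p\<^sub>+\<^sub>1\<close> is an inclusion.\<close>

type_synonym ('k, 'n) gelem = "(nat \<Rightarrow> nat) \<times> (nat \<Rightarrow> 'k ^ 'n ^ 'n)"

definition G_fin :: "nat \<Rightarrow> ('k::field, 'n::finite) gelem monoid" where
  "G_fin p = \<lparr>
     carrier = {(\<sigma>, g). \<sigma> permutes {..<p} \<and> (\<forall>i. invertible (g i)) \<and> (\<forall>i\<ge>p. g i = mat 1)},
     monoid.mult = (\<lambda>(\<sigma>, g) (\<tau>, h). (\<sigma> \<circ> \<tau>, \<lambda>i. g (\<tau> i) ** h i)),
     one = (id, \<lambda>_. mat 1)\<rparr>"

definition G_inf :: "('k::field, 'n::finite) gelem monoid" where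
  "G_inf = \<lparr>
     carrier = (\<Union>p. carrier (G_fin p)),
     monoid.mult = (\<lambda>(\<sigma>, g) (\<tau>, h). (\<sigma> \<circ> \<tau>, \<lambda>i. g (\<tau> i) ** h i)),
     one = (id, \<lambda>_. mat 1)\<rparr>"

definition gl_act ::
  "nat \<Rightarrow> (nat \<Rightarrow> 'k ^ 'n ^ 'n) \<Rightarrow> ('k::field, 'n::finite) tensor \<Rightarrow> ('k, 'n) tensor" where
  "gl_act p g t = (\<lambda>l. if length l = p
     then \<Sum>m | length m = p. (\<Prod>i<p. g i $ (l ! i) $ (m ! i)) * t m else 0)"

text \<open>The factor in position \<open>i\<close> is moved to position \<open>\<sigma> i\<close>; see \<open>perm_act_tprod\<close> below.\<close>

definition perm_act ::
  "nat \<Rightarrow> (nat \<Rightarrow> nat) \<Rightarrow> ('k::field, 'n::finite) tensor \<Rightarrow> ('k, 'n) tensor" where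
  "perm_act p \<sigma> t = (\<lambda>l. if length l = p then t (map (\<lambda>i. l ! \<sigma> i) [0..<p]) else 0)"

definition tensor_act ::
  "nat \<Rightarrow> ('k, 'n) gelem \<Rightarrow> ('k::field, 'n::finite) tensor \<Rightarrow> ('k, 'n) tensor" where
  "tensor_act p g t = perm_act p (fst g) (gl_act p (snd g) t)"

text \<open>For \<open>g \<in> G\<^sub>p\<close> the component of \<open>g \<omega>\<close> in degree \<open>q \<ge> p\<close> is \<open>g \<omega>\<^sub>q\<close>, which determines the
  components in lower degrees by contraction; see \<open>A_act_eq\<close> and \<open>A_act_closed\<close> below.\<close>

definition A_act ::
  "('k ^ 'n \<Rightarrow> 'k) \<Rightarrow> ('k, 'n) gelem \<Rightarrow> (nat \<Rightarrow> ('k::field, 'n::finite) tensor)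
     \<Rightarrow> nat \<Rightarrow> ('k, 'n) tensor" where
  "A_act x0 g \<omega> = (\<lambda>q. let r = max q (LEAST p. g \<in> carrier (G_fin p))
     in (contract x0 ^^ (r - q)) (tensor_act r g (\<omega> r)))"

definition T_act ::
  "('k ^ 'n \<Rightarrow> 'k) \<Rightarrow> ('k, 'n) gelem \<Rightarrow> ((nat \<Rightarrow> ('k::field, 'n::finite) tensor) \<Rightarrow> 'k)
     \<Rightarrow> (nat \<Rightarrow> ('k, 'n) tensor) \<Rightarrow> 'k" where
  "T_act x0 g f = restrict (\<lambda>\<omega>. f (A_act x0 (inv\<^bsub>G_inf\<^esub> g) \<omega>)) (A_inf x0)"


section \<open>Bounded border rank\<close>

definition zariski_closure ::
  "nat \<Rightarrow> ('k::field, 'n::finite) tensor set \<Rightarrow> ('k, 'n) tensor set" where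
  "zariski_closure p S = {t \<in> tensors p.
     \<forall>f \<in> T_fin p. (\<forall>s\<in>S. tpoly_val f s = 0) \<longrightarrow> tpoly_val f t = 0}"

definition X_fin :: "nat \<Rightarrow> nat \<Rightarrow> ('k::field, 'n::finite) tensor set" where
  "X_fin k p = zariski_closure p {t \<in> tensors p. tensor_rank p t \<le> k}"

definition X_inf :: "('k ^ 'n \<Rightarrow> 'k) \<Rightarrow> nat \<Rightarrow> (nat \<Rightarrow> ('k::field, 'n::finite) tensor) set" where
  "X_inf x0 k = {\<omega> \<in> A_inf x0. \<forall>p. \<omega> p \<in> X_fin k p}"


section \<open>Basic facts about the definitions\<close>

lemma sum_lists_Suc:
  fixes F :: "'n::finite list \<Rightarrow> 'k::comm_monoid_add"
  shows "(\<Sum>m | length m = Suc p. F m) = (\<Sum>m | length m = p. \<Sum>j\<in>UNIV. F (m @ [j]))"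
proof -
  have "(\<Sum>m | length m = Suc p. F m)
      = (\<Sum>z \<in> {m. length m = p} \<times> UNIV. F (fst z @ [snd z]))"
    by (rule sum.reindex_bij_witness[where i = "\<lambda>z. fst z @ [snd z]" and j = "\<lambda>m. (butlast m, last m)"])
       (auto simp: length_Suc_conv_rev)
  then show ?thesis
    by (simp add: sum.cartesian_product case_prod_unfold)
qed

lemma sum_lists_prod:
  fixes F :: "nat \<Rightarrow> 'n::finite \<Rightarrow> 'k::comm_semiring_1"
  shows "(\<Sum>m | length m = p. \<Prod>i<p. F i (m ! i)) = (\<Prod>i<p. \<Sum>j\<in>UNIV. F i j)"
proof (induction p)
  case 0
  have "{m :: 'n list. length m = 0} = {[]}" by auto
  then show ?case by simp
next
  case (Suc p)
  have "(\<Sum>m | length m = Suc p. \<Prod>i<Suc p. F i (m ! i))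
     = (\<Sum>m | length m = p. \<Sum>j\<in>UNIV. (\<Prod>i<p. F i (m ! i)) * F p j)"
    unfolding sum_lists_Suc
  proof (intro sum.cong refl)
    fix m :: "'n list" and j assume "m \<in> {m. length m = p}"
    then show "(\<Prod>i<Suc p. F i ((m @ [j]) ! i)) = (\<Prod>i<p. F i (m ! i)) * F p j"
      by (simp add: nth_append)
  qed
  then show ?case
    by (simp add: Suc.IH[symmetric] sum_distrib_left[symmetric] sum_distrib_right[symmetric])
qed

lemma linear_expand:
  fixes x0 :: "'k::field ^ 'n::finite \<Rightarrow> 'k"
  assumes "Vector_Spaces.linear (*s) (*) x0"
  shows "x0 v = (\<Sum>j\<in>UNIV. x0 (axis j 1) * v $ j)"
proof -
  interpret Vector_Spaces.linear "(*s)" "(*)" x0 by fact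
  have "x0 v = x0 (\<Sum>j\<in>UNIV. (v $ j) *s axis j 1)"
    by (simp add: basis_expansion)
  then show ?thesis by (simp add: sum scale mult.commute)
qed

lemma contract_tprod:
  fixes x0 :: "'k::field ^ 'n::finite \<Rightarrow> 'k"
  assumes "Vector_Spaces.linear (*s) (*) x0"
  shows "contract x0 (tprod (Suc p) v) = (\<lambda>l. x0 (v p) * tprod p v l)"
proof
  fix l :: "'n list"
  show "contract x0 (tprod (Suc p) v) l = x0 (v p) * tprod p v l"
    by (auto simp: contract_def tprod_def nth_append linear_expand[OF assms, of "v p"]
        sum_distrib_right mult_ac intro!: sum.cong)
qed

lemma gl_act_tprod:
  fixes v :: "nat \<Rightarrow> 'k::field ^ 'n::finite"
  shows "gl_act p g (tprod p v) = tprod p (\<lambda>i. g i *v v i)"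
proof
  fix l :: "'n list"
  show "gl_act p g (tprod p v) l = tprod p (\<lambda>i. g i *v v i) l"
  proof (cases "length l = p")
    case True
    have "gl_act p g (tprod p v) l
       = (\<Sum>m | length m = p. \<Prod>i<p. g i $ (l ! i) $ (m ! i) * v i $ (m ! i))"
      using True by (auto simp: gl_act_def tprod_def prod.distrib intro!: sum.cong)
    also have "\<dots> = tprod p (\<lambda>i. g i *v v i) l"
      using True sum_lists_prod[of "\<lambda>i j. g i $ (l ! i) $ j * v i $ j" p]
      by (simp add: tprod_def matrix_vector_mult_def)
    finally show ?thesis .
  qed (simp add: gl_act_def tprod_def)
qed

lemma perm_act_tprod:
  fixes v :: "nat \<Rightarrow> 'k::field ^ 'n::finite"
  assumes "\<sigma> permutes {..<p}"
  shows "perm_act p \<sigma> (tprod p v) = tprod p (v \<circ> inv_into UNIV \<sigma>)"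
proof
  fix l :: "'n list"
  have "(\<Prod>i<p. v i $ (l ! \<sigma> i)) = (\<Prod>i<p. v (inv_into UNIV \<sigma> i) $ (l ! i))"
    using prod.permute[OF assms, of "\<lambda>i. v (inv_into UNIV \<sigma> i) $ (l ! i)"] permutes_inverses[OF assms]
    by (simp add: o_def)
  then show "perm_act p \<sigma> (tprod p v) l = tprod p (v \<circ> inv_into UNIV \<sigma>) l"
    by (simp add: perm_act_def tprod_def)
qed

lemma tensor_act_mult:
  assumes "g \<in> carrier (G_fin p)" "h \<in> carrier (G_fin p)"
  shows "tensor_act p (g \<otimes>\<^bsub>G_fin p\<^esub> h) t = tensor_act p g (tensor_act p h t)"
proof
  obtain \<sigma> a \<tau> b where gh: "g = (\<sigma>, a)" "h = (\<tau>, b)" by (cases g, cases h)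
  have \<sigma>: "\<sigma> permutes {..<p}" and \<tau>: "\<tau> permutes {..<p}"
    using assms by (auto simp: gh G_fin_def)
  have \<sigma>p: "\<sigma> i < p \<longleftrightarrow> i < p" for i using permutes_in_image[OF \<sigma>, of i] by simp
  have \<tau>p: "\<tau> i < p \<longleftrightarrow> i < p" for i using permutes_in_image[OF \<tau>, of i] by simp
  fix l :: "'b list"
  show "tensor_act p (g \<otimes>\<^bsub>G_fin p\<^esub> h) t l = tensor_act p g (tensor_act p h t) l"
  proof (cases "length l = p")
    case True
    let ?L = "{m :: 'b list. length m = p}"
    let ?r = "\<lambda>m. map (\<lambda>i. m ! \<tau> i) [0..<p]"
    let ?r' = "\<lambda>m. map (\<lambda>i. m ! inv_into UNIV \<tau> i) [0..<p]"
    have \<tau>i: "inv_into UNIV \<tau> i < p \<longleftrightarrow> i < p" for i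
      using permutes_in_image[OF permutes_inv[OF \<tau>], of i] by simp
    have "tensor_act p g (tensor_act p h t) l
      = (\<Sum>m\<in>?L. (\<Prod>i<p. a i $ (l ! \<sigma> i) $ (m ! i)) * gl_act p b t (?r m))"
      using True by (auto simp: tensor_act_def gh perm_act_def gl_act_def intro!: sum.cong)
    also have "\<dots> = (\<Sum>m\<in>?L. (\<Prod>i<p. a (\<tau> i) $ (l ! \<sigma> (\<tau> i)) $ (m ! i)) * gl_act p b t m)"
    proof (rule sum.reindex_bij_witness[where i = ?r' and j = ?r])
      fix m assume m: "m \<in> ?L"
      show "?r' (?r m) = m" using m \<tau>i permutes_inverses[OF \<tau>] by (auto intro!: nth_equalityI)
      show "?r (?r' m) = m" using m \<tau>p permutes_inverses[OF \<tau>] by (auto intro!: nth_equalityI)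
      have "(\<Prod>i<p. a i $ (l ! \<sigma> i) $ (m ! i)) =
            (\<Prod>i<p. a (\<tau> i) $ (l ! \<sigma> (\<tau> i)) $ (m ! \<tau> i))"
        using prod.permute[OF \<tau>, of "\<lambda>i. a i $ (l ! \<sigma> i) $ (m ! i)"] by (simp add: o_def)
      then show "(\<Prod>i<p. a (\<tau> i) $ (l ! \<sigma> (\<tau> i)) $ (?r m ! i)) * gl_act p b t (?r m)
           = (\<Prod>i<p. a i $ (l ! \<sigma> i) $ (m ! i)) * gl_act p b t (?r m)"
        by simp
    qed auto
    also have "\<dots> = (\<Sum>m\<in>?L. \<Sum>m'\<in>?L. (\<Prod>i<p. a (\<tau> i) $ (l ! \<sigma> (\<tau> i)) $ (m ! i))
           * ((\<Prod>i<p. b i $ (m ! i) $ (m' ! i)) * t m'))"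
      by (auto simp: gl_act_def sum_distrib_left intro!: sum.cong)
    also have "\<dots> = (\<Sum>m'\<in>?L. (\<Sum>m\<in>?L. \<Prod>i<p. a (\<tau> i) $ (l ! \<sigma> (\<tau> i)) $ (m ! i)
           * b i $ (m ! i) $ (m' ! i)) * t m')"
      by (subst sum.swap) (simp add: sum_distrib_right prod.distrib mult.assoc)
    also have "\<dots> = (\<Sum>m'\<in>?L. (\<Prod>i<p. (a (\<tau> i) ** b i) $ (l ! \<sigma> (\<tau> i)) $ (m' ! i)) * t m')"
      unfolding sum_lists_prod[where F = "\<lambda>i j. a (\<tau> i) $ (l ! \<sigma> (\<tau> i)) $ j * b i $ j $ (_ ! i)"]
      by (simp add: matrix_matrix_mult_def)
    also have "\<dots> = tensor_act p (g \<otimes>\<^bsub>G_fin p\<^esub> h) t l"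
      using True by (auto simp: tensor_act_def gh perm_act_def gl_act_def G_fin_def intro!: sum.cong)
    finally show ?thesis by simp
  qed (simp add: tensor_act_def perm_act_def)
qed

lemma group_G_inf: "group (G_inf :: ('k::field, 'n::finite) gelem monoid)"
proof (rule groupI)
  fix x y :: "('k, 'n) gelem"
  assume x: "x \<in> carrier G_inf" and y: "y \<in> carrier G_inf"
  obtain \<sigma> a \<tau> b where xy: "x = (\<sigma>, a)" "y = (\<tau>, b)" by (cases x, cases y)
  obtain p q where p: "\<sigma> permutes {..<p}" "\<forall>i. invertible (a i)" "\<forall>i\<ge>p. a i = mat 1"
    and q: "\<tau> permutes {..<q}" "\<forall>i. invertible (b i)" "\<forall>i\<ge>q. b i = mat 1"
    using x y by (auto simp: G_inf_def G_fin_def xy)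
  have P: "\<sigma> permutes {..<max p q}" "\<tau> permutes {..<max p q}"
    by (rule permutes_subset[OF p(1)], simp) (rule permutes_subset[OF q(1)], simp)
  have "\<tau> i \<ge> max p q" if "i \<ge> max p q" for i
    using permutes_not_in[OF P(2), of i] that by simp
  then have "(\<sigma> \<circ> \<tau>, \<lambda>i. a (\<tau> i) ** b i) \<in> carrier (G_fin (max p q))"
    using p q permutes_compose[OF P(2,1)] by (auto simp: G_fin_def invertible_mult)
  then show "x \<otimes>\<^bsub>G_inf\<^esub> y \<in> carrier G_inf"
    by (auto simp: G_inf_def xy intro!: exI[of _ "max p q"])
next
  show "\<one>\<^bsub>G_inf\<^esub> \<in> carrier (G_inf :: ('k, 'n) gelem monoid)"
    by (auto simp: G_inf_def G_fin_def permutes_id invertible_def intro!: exI[of _ "mat 1"])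
next
  fix x y z :: "('k, 'n) gelem"
  show "x \<otimes>\<^bsub>G_inf\<^esub> y \<otimes>\<^bsub>G_inf\<^esub> z = x \<otimes>\<^bsub>G_inf\<^esub> (y \<otimes>\<^bsub>G_inf\<^esub> z)"
    by (simp add: G_inf_def case_prod_unfold o_assoc matrix_mul_assoc)
next
  fix x :: "('k, 'n) gelem"
  show "\<one>\<^bsub>G_inf\<^esub> \<otimes>\<^bsub>G_inf\<^esub> x = x"
    by (simp add: G_inf_def case_prod_unfold)
  assume x: "x \<in> carrier G_inf"
  obtain \<sigma> a where xx: "x = (\<sigma>, a)" by (cases x)
  obtain p where p: "\<sigma> permutes {..<p}" "\<forall>i. invertible (a i)" "\<forall>i\<ge>p. a i = mat 1"
    using x by (auto simp: G_inf_def G_fin_def xx)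
  define b where "b = (\<lambda>i. if i < p then matrix_inv (a i) else mat 1)"
  have m1: "invertible (mat 1 :: 'k ^ 'n ^ 'n)"
    by (auto simp: invertible_def intro!: exI[of _ "mat 1"])
  have ba: "b i ** a i = mat 1" and ab: "a i ** b i = mat 1" for i
    using p someI_ex[of "\<lambda>A'. a i ** A' = mat 1 \<and> A' ** a i = mat 1"]
    by (auto simp: b_def matrix_inv_def invertible_def)
  have bi: "invertible (b i)" for i using ba ab unfolding invertible_def by blast
  have ip: "inv_into UNIV \<sigma> permutes {..<p}" using p(1) by (rule permutes_inv)
  have ge: "inv_into UNIV \<sigma> i \<ge> p" if "i \<ge> p" for i using permutes_not_in[OF ip, of i] that by simp
  have "b (inv_into UNIV \<sigma> i) = mat 1" if "i \<ge> p" for i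
    using ge[OF that] by (simp add: b_def)
  then have c: "(inv_into UNIV \<sigma>, \<lambda>i. b (inv_into UNIV \<sigma> i)) \<in> carrier (G_fin p)"
    using ip bi by (simp add: G_fin_def)
  show "\<exists>y\<in>carrier G_inf. y \<otimes>\<^bsub>G_inf\<^esub> x = \<one>\<^bsub>G_inf\<^esub>"
    using c permutes_inverses[OF p(1)] ba permutes_inv_o[OF p(1)]
    by (intro bexI[of _ "(inv_into UNIV \<sigma>, \<lambda>i. b (inv_into UNIV \<sigma> i))"]) (auto simp: G_inf_def xx)
qed

lemma G_fin_mono: "p \<le> q \<Longrightarrow> carrier (G_fin p) \<subseteq> carrier (G_fin q)"
  by (auto simp: G_fin_def intro: permutes_subset)

lemma contract_tensor_act:
  assumes g: "g \<in> carrier (G_fin p)" and t: "t \<in> tensors (Suc p)"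
  shows "contract x0 (tensor_act (Suc p) g t) = tensor_act p g (contract x0 t)"
proof
  obtain \<sigma> a where gg: "g = (\<sigma>, a)" by (cases g)
  have \<sigma>: "\<sigma> permutes {..<p}" and a: "a p = mat 1"
    using g by (auto simp: gg G_fin_def)
  have \<sigma>p: "\<sigma> i < p \<longleftrightarrow> i < p" for i using permutes_in_image[OF \<sigma>, of i] by simp
  have sp: "\<sigma> p = p" using permutes_not_in[OF \<sigma>, of p] by simp
  fix l :: "'b list"
  show "contract x0 (tensor_act (Suc p) g t) l = tensor_act p g (contract x0 t) l"
  proof (cases "length l = p")
    case True
    have "contract x0 (tensor_act (Suc p) g t) l
      = (\<Sum>j\<in>UNIV. x0 (axis j 1) * (\<Sum>m | length m = p. \<Sum>j'\<in>UNIV.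
          (\<Prod>i<p. a i $ (l ! \<sigma> i) $ (m ! i)) * (if j = j' then t (m @ [j']) else 0)))"
      using True
      by (auto simp: contract_def tensor_act_def gg perm_act_def gl_act_def sum_lists_Suc sp
          nth_append \<sigma>p a mat_def intro!: sum.cong)
    also have "\<dots> = (\<Sum>j\<in>UNIV. x0 (axis j 1) * (\<Sum>m | length m = p.
          (\<Prod>i<p. a i $ (l ! \<sigma> i) $ (m ! i)) * t (m @ [j])))"
      by (simp add: sum_distrib_left[symmetric] sum.delta)
    also have "\<dots> = tensor_act p g (contract x0 t) l"
      using True
      by (simp add: contract_def tensor_act_def gg perm_act_def gl_act_def sum_distrib_left \<sigma>p)
         (subst sum.swap, simp add: mult_ac)
    finally show ?thesis .
  qed (simp add: contract_def tensor_act_def perm_act_def)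
qed

lemma tensor_act_closed: "tensor_act p g t \<in> tensors p"
  by (simp add: tensor_act_def perm_act_def tensors_def)

lemma contract_funpow_A_inf:
  "\<omega> \<in> A_inf x0 \<Longrightarrow> (contract x0 ^^ d) (\<omega> (q + d)) = \<omega> q"
proof (induction d)
  case (Suc d)
  then show ?case by (simp add: funpow_swap1 A_inf_def)
qed simp

lemma contract_funpow_tensor_act:
  assumes "\<omega> \<in> A_inf x0" "g \<in> carrier (G_fin q)"
  shows "(contract x0 ^^ d) (tensor_act (q + d) g (\<omega> (q + d))) = tensor_act q g (\<omega> q)"
proof (induction d)
  case (Suc d)
  have "g \<in> carrier (G_fin (q + d))" using assms(2) G_fin_mono[of q "q + d"] by auto
  moreover have "\<omega> (Suc (q + d)) \<in> tensors (Suc (q + d))" "contract x0 (\<omega> (Suc (q + d))) = \<omega> (q + d)"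
    using assms(1) by (auto simp: A_inf_def)
  ultimately have "contract x0 (tensor_act (Suc (q + d)) g (\<omega> (Suc (q + d))))
     = tensor_act (q + d) g (\<omega> (q + d))"
    by (simp add: contract_tensor_act)
  then show ?case using Suc.IH by (simp add: funpow_swap1)
qed simp

lemma A_act_eq:
  assumes "\<omega> \<in> A_inf x0" "g \<in> carrier (G_fin p)" "p \<le> q"
  shows "A_act x0 g \<omega> q = tensor_act q g (\<omega> q)"
proof -
  have "(LEAST p. g \<in> carrier (G_fin p)) \<le> p" using assms(2) by (rule Least_le)
  then show ?thesis using assms(3) by (simp add: A_act_def max_absorb1)
qed

lemma contract_tensors: "t \<in> tensors (Suc p) \<Longrightarrow> contract x0 t \<in> tensors p"
  by (auto simp: contract_def tensors_def)

lemma A_act_closed: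
  assumes w: "\<omega> \<in> A_inf x0" and g: "g \<in> carrier G_inf"
  shows "A_act x0 g \<omega> \<in> A_inf x0"
proof -
  define p where "p = (LEAST p. g \<in> carrier (G_fin p))"
  have gp: "g \<in> carrier (G_fin p)"
    using g unfolding p_def by (auto simp: G_inf_def intro: LeastI)
  have closed: "(contract x0 ^^ d) t \<in> tensors q" if "t \<in> tensors (q + d)" for q d t
    using that
  proof (induction d arbitrary: t)
    case (Suc d)
    have "contract x0 t \<in> tensors (q + d)" using Suc.prems by (simp add: contract_tensors)
    then show ?case using Suc.IH by (simp add: funpow_swap1)
  qed simp
  show ?thesis unfolding A_inf_def
  proof (intro CollectI allI conjI)
    fix q
    show "A_act x0 g \<omega> q \<in> tensors q"
      unfolding A_act_def Let_def p_def[symmetric]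
      by (rule closed) (simp add: tensor_act_closed)
    show "contract x0 (A_act x0 g \<omega> (Suc q)) = A_act x0 g \<omega> q"
    proof (cases "Suc q \<le> p")
      case True
      then have "p - q = Suc (p - Suc q)" by simp
      then show ?thesis using True
        by (simp add: A_act_def Let_def p_def[symmetric] max_absorb2)
    next
      case False
      then have le: "p \<le> q" by simp
      then have "g \<in> carrier (G_fin q)" using gp G_fin_mono by blast
      then show ?thesis
        using A_act_eq[OF w gp, of q] A_act_eq[OF w gp, of "Suc q"] le
          contract_funpow_tensor_act[OF w, of g q 1] by simp
    qed
  qed
qed


lemma tensor_rank_le_iff:
  fixes t :: "('k::field, 'n::finite) tensor"
  assumes t: "t \<in> tensors p"
  shows "tensor_rank p t \<le> k \<longleftrightarrow>
    (\<exists>s. (\<forall>i<k. s i \<in> pure_tensors p) \<and> t = (\<lambda>l. \<Sum>i<k. s i l))"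
proof -
  define P where "P r \<longleftrightarrow> (\<exists>s. (\<forall>i<r. s i \<in> pure_tensors p) \<and> t = (\<lambda>l. \<Sum>i<r. s i l))"
    for r :: nat
  let ?L = "{l :: 'n list. length l = p}"
  have finL: "finite ?L" using finite_lists_length_eq[of "UNIV :: 'n set" p] by simp
  obtain e where e: "bij_betw e {..<card ?L} ?L"
    using ex_bij_betw_nat_finite[OF finL] by (auto simp: atLeast0LessThan)
  have unit: "tprod p (\<lambda>i. axis (m ! i) 1) l = (if l = m then 1 else 0 :: 'k)"
    if "length m = p" "length l = p" for m l :: "'n list"
    using that by (auto simp: tprod_def axis_def list_eq_iff_nth_eq)
  have "t l = (\<Sum>i<card ?L. t (e i) * tprod p (\<lambda>j. axis (e i ! j) 1) l)" for l
  proof -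
    have "t l = (\<Sum>m\<in>?L. t m * tprod p (\<lambda>j. axis (m ! j) 1) l)"
    proof (cases "length l = p")
      case True
      have "(\<Sum>m\<in>?L. t m * tprod p (\<lambda>j. axis (m ! j) 1) l) = (\<Sum>m\<in>?L. if m = l then t m else 0)"
        using True by (intro sum.cong) (auto simp: unit)
      then show ?thesis using True finL by (simp add: sum.delta)
    next
      case False
      then show ?thesis using t by (simp add: tensors_def tprod_def)
    qed
    then show ?thesis using sum.reindex_bij_betw[OF e, of "\<lambda>m. t m * tprod p (\<lambda>j. axis (m ! j) 1) l"]
      by simp
  qed
  then have "t = (\<lambda>l. \<Sum>i<card ?L. t (e i) * tprod p (\<lambda>j. axis (e i ! j) 1) l)"
    by (rule ext)
  moreover have "(\<lambda>l. t (e i) * tprod p (\<lambda>j. axis (e i ! j) 1) l) \<in> pure_tensors p" for i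
    unfolding pure_tensors_def by blast
  ultimately have "P (card ?L)"
    unfolding P_def by (intro exI[of _ "\<lambda>i l. t (e i) * tprod p (\<lambda>j. axis (e i ! j) 1) l"]) blast
  moreover have rank: "tensor_rank p t = Least P"
    unfolding tensor_rank_def P_def[symmetric] ..
  ultimately have least: "P (tensor_rank p t)"
    by (simp add: LeastI)
  have mono: "P k" if Pr: "P r" and rk: "r \<le> k" for r
  proof -
    obtain s where s: "\<forall>i<r. s i \<in> pure_tensors p" "t = (\<lambda>l. \<Sum>i<r. s i l)"
      using Pr unfolding P_def by (elim exE conjE) (rule that)
    define s' where "s' i = (if i < r then s i else (\<lambda>_. 0))" for i
    have "(\<lambda>_. 0 :: 'k) \<in> (pure_tensors p :: ('k, 'n) tensor set)"
      unfolding pure_tensors_def by (intro CollectI exI[of _ 0]) simp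
    then have "\<forall>i<k. s' i \<in> pure_tensors p" using s(1) by (simp add: s'_def)
    moreover have "(\<Sum>i<k. s' i l) = (\<Sum>i<r. s i l)" for l
      by (rule sum.mono_neutral_cong_right) (use rk in \<open>auto simp: s'_def\<close>)
    then have "t = (\<lambda>l. \<Sum>i<k. s' i l)" by (simp only: s(2))
    ultimately show ?thesis unfolding P_def by blast
  qed
  have "tensor_rank p t \<le> k \<longleftrightarrow> P k"
    using mono[OF least] Least_le[of P k] rank by auto
  then show ?thesis unfolding P_def .
qed

lemma tpoly_val_superset:
  assumes "finite A" "Poly_Mapping.keys f \<subseteq> A"
  shows "tpoly_val f t = (\<Sum>m\<in>A. Poly_Mapping.lookup f m * (\<Prod>l\<in>Poly_Mapping.keys m. t l ^ Poly_Mapping.lookup m l))"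
  unfolding tpoly_val_def
  by (rule sum.mono_neutral_left) (use assms in \<open>auto simp: in_keys_iff\<close>)

lemma tpoly_val_add: "tpoly_val (f + h) t = tpoly_val f t + tpoly_val h t"
proof -
  let ?A = "Poly_Mapping.keys f \<union> Poly_Mapping.keys h"
  have "Poly_Mapping.keys (f + h) \<subseteq> ?A" by (rule keys_add)
  then show ?thesis
    by (simp add: tpoly_val_superset[of ?A] lookup_add distrib_right sum.distrib)
qed

lemma tpoly_val_zero: "tpoly_val 0 t = 0"
  by (simp add: tpoly_val_def)

lemma tpoly_val_sum: "tpoly_val (\<Sum>i\<in>I. F i) t = (\<Sum>i\<in>I. tpoly_val (F i) t)"
  by (induction I rule: infinite_finite_induct) (auto simp: tpoly_val_add tpoly_val_zero)

lemma tpoly_val_single: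
  "tpoly_val (Poly_Mapping.single m c) t = c * (\<Prod>l\<in>Poly_Mapping.keys m. t l ^ Poly_Mapping.lookup m l)"
  by (simp add: tpoly_val_superset[of "{m}"])

lemma monom_val_add:
  fixes t :: "'v \<Rightarrow> 'k::field"
  shows "(\<Prod>l\<in>Poly_Mapping.keys (m + m'). t l ^ Poly_Mapping.lookup (m + m') l)
     = (\<Prod>l\<in>Poly_Mapping.keys m. t l ^ Poly_Mapping.lookup m l)
       * (\<Prod>l\<in>Poly_Mapping.keys m'. t l ^ Poly_Mapping.lookup m' l)"
proof -
  let ?A = "Poly_Mapping.keys m \<union> Poly_Mapping.keys m'"
  have *: "(\<Prod>l\<in>Poly_Mapping.keys n. t l ^ Poly_Mapping.lookup n l) = (\<Prod>l\<in>?A. t l ^ Poly_Mapping.lookup n l)" if "Poly_Mapping.keys n \<subseteq> ?A" for n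
    by (rule prod.mono_neutral_left) (use that in \<open>auto simp: in_keys_iff\<close>)
  have "(\<Prod>l\<in>Poly_Mapping.keys (m + m'). t l ^ Poly_Mapping.lookup (m + m') l)
      = (\<Prod>l\<in>?A. t l ^ Poly_Mapping.lookup (m + m') l)"
    by (rule *, rule keys_add)
  then show ?thesis
    by (simp add: *[of m] *[of m'] lookup_add power_add prod.distrib)
qed

lemma poly_mapping_sum_single:
  fixes f :: "'a \<Rightarrow>\<^sub>0 'b::comm_monoid_add"
  shows "(\<Sum>m\<in>Poly_Mapping.keys f. Poly_Mapping.single m (Poly_Mapping.lookup f m)) = f"
  by (rule poly_mapping_eqI)
     (auto simp: lookup_sum lookup_single when_def in_keys_iff cong: if_cong)

lemma tpoly_val_mult: "tpoly_val (f * h) t = tpoly_val f t * tpoly_val h t"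
proof -
  have "tpoly_val (f * h) t = tpoly_val ((\<Sum>m\<in>Poly_Mapping.keys f. Poly_Mapping.single m (Poly_Mapping.lookup f m))
      * (\<Sum>m\<in>Poly_Mapping.keys h. Poly_Mapping.single m (Poly_Mapping.lookup h m))) t"
    by (simp only: poly_mapping_sum_single)
  also have "\<dots> = tpoly_val f t * tpoly_val h t"
    by (simp add: sum_product mult_single tpoly_val_sum tpoly_val_single monom_val_add)
       (simp add: tpoly_val_def sum_product mult_ac)
  finally show ?thesis .
qed

lemma tpoly_val_one: "tpoly_val 1 t = 1"
  using tpoly_val_single[of 0 1 t] by simp

lemma tpoly_val_power: "tpoly_val (f ^ d) t = tpoly_val f t ^ d"
  by (induction d) (auto simp: tpoly_val_one tpoly_val_mult)

lemma tpoly_val_prod: "tpoly_val (\<Prod>i\<in>I. F i) t = (\<Prod>i\<in>I. tpoly_val (F i) t)"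
  by (induction I rule: infinite_finite_induct) (auto simp: tpoly_val_one tpoly_val_mult)

lemma tpoly_val_embed: "tpoly_val (tpoly_embed x0 f) t = tpoly_val f (contract x0 t)"
  unfolding tpoly_embed_def tpoly_val_sum tpoly_val_mult tpoly_val_prod tpoly_val_power tpoly_val_single
  by (simp add: tpoly_val_def contract_def)

lemma T_fin_sum: "(\<And>i. i \<in> I \<Longrightarrow> F i \<in> T_fin p) \<Longrightarrow> (\<Sum>i\<in>I. F i) \<in> T_fin p"
proof (induction I rule: infinite_finite_induct)
  case (insert i I)
  then have "F i \<in> T_fin p" "(\<Sum>i\<in>I. F i) \<in> T_fin p" by auto
  then show ?case using insert(1,2) keys_add[of "F i" "\<Sum>i\<in>I. F i"] by (auto simp: T_fin_def)
qed (auto simp: T_fin_def)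

lemma T_fin_mult: "f \<in> T_fin p \<Longrightarrow> h \<in> T_fin p \<Longrightarrow> f * h \<in> T_fin p"
proof -
  assume f: "f \<in> T_fin p" and h: "h \<in> T_fin p"
  show ?thesis unfolding T_fin_def
  proof (intro CollectI ballI)
    fix m l assume m: "m \<in> Poly_Mapping.keys (f * h)" and l: "l \<in> Poly_Mapping.keys m"
    obtain a b where ab: "a \<in> Poly_Mapping.keys f" "b \<in> Poly_Mapping.keys h" "m = a + b"
      using keys_mult[of f h] m by auto
    then have "l \<in> Poly_Mapping.keys a \<or> l \<in> Poly_Mapping.keys b" using l keys_add[of a b] by auto
    then show "length l = p" using f h ab by (auto simp: T_fin_def)
  qed
qed

lemma T_fin_power: "f \<in> T_fin p \<Longrightarrow> f ^ d \<in> T_fin p"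
  by (induction d) (auto simp: T_fin_mult, auto simp: T_fin_def)

lemma T_fin_prod: "(\<And>i. i \<in> I \<Longrightarrow> F i \<in> T_fin p) \<Longrightarrow> (\<Prod>i\<in>I. F i) \<in> T_fin p"
  by (induction I rule: infinite_finite_induct) (auto simp: T_fin_mult, auto simp: T_fin_def)

lemma tpoly_embed_T_fin: "f \<in> T_fin p \<Longrightarrow> tpoly_embed x0 f \<in> T_fin (Suc p)"
  unfolding tpoly_embed_def
  by (intro T_fin_sum T_fin_mult T_fin_prod T_fin_power)
     (auto simp: T_fin_def split: if_splits)

lemma tpoly_fun_embed: "tpoly_fun x0 (Suc p) (tpoly_embed x0 f) = tpoly_fun x0 p f"
  by (auto simp: tpoly_fun_def tpoly_val_embed A_inf_def restrict_def)

lemma monomials_independent: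
  fixes c :: "'i \<Rightarrow> 'k::field" and e :: "'i \<Rightarrow> 'v \<Rightarrow> nat"
  assumes inf: "infinite (UNIV :: 'k set)" and "finite L"
    and "finite M" and "\<And>m m'. m \<in> M \<Longrightarrow> m' \<in> M \<Longrightarrow> m \<noteq> m' \<Longrightarrow> \<exists>l\<in>L. e m l \<noteq> e m' l"
    and "\<And>t. (\<Sum>m\<in>M. c m * (\<Prod>l\<in>L. t l ^ e m l)) = 0" and "m0 \<in> M"
  shows "c m0 = 0"
  using assms(2-)
proof (induction L arbitrary: M rule: finite_induct)
  case empty
  then have "M = {m0}" by blast
  then show ?case using empty.prems(3) by simp
next
  case (insert x L)
  define M' where "M' = {m \<in> M. e m x = e m0 x}"
  have "(\<Sum>m\<in>M'. c m * (\<Prod>l\<in>L. t l ^ e m l)) = 0" for t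
  proof -
    define P where "P = (\<Sum>m\<in>M. monom (c m * (\<Prod>l\<in>L. t l ^ e m l)) (e m x))"
    have "poly P y = 0" for y
    proof -
      have "(\<Prod>l\<in>L. (t(x := y)) l ^ e m l) = (\<Prod>l\<in>L. t l ^ e m l)" for m
        using insert.hyps by (intro prod.cong) auto
      then show ?thesis
        using insert.prems(3)[of "t(x := y)"] insert.hyps
        by (simp add: P_def poly_sum poly_monom mult_ac)
    qed
    then have "P = 0" using poly_roots_finite[of P] inf by auto
    then have "0 = coeff P (e m0 x)" by simp
    also have "\<dots> = (\<Sum>m\<in>M. if e m x = e m0 x then c m * (\<Prod>l\<in>L. t l ^ e m l) else 0)"
      by (simp add: P_def coeff_sum)
    also have "\<dots> = (\<Sum>m\<in>M'. c m * (\<Prod>l\<in>L. t l ^ e m l))"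
      unfolding M'_def using insert.prems(1) by (simp add: sum.inter_filter)
    finally show ?thesis by simp
  qed
  moreover have "\<exists>l\<in>L. e m l \<noteq> e m' l" if "m \<in> M'" "m' \<in> M'" "m \<noteq> m'" for m m'
    using insert.prems(2)[of m m'] that by (auto simp: M'_def)
  ultimately show ?case
    using insert.IH[of M'] insert.prems(1,4) by (auto simp: M'_def)
qed

lemma tpoly_zero:
  fixes f :: "('k::field, 'n::finite) tpoly"
  assumes inf: "infinite (UNIV :: 'k set)" and f: "f \<in> T_fin p"
    and z: "\<And>t. t \<in> tensors p \<Longrightarrow> tpoly_val f t = 0"
  shows "f = 0"
proof (rule poly_mapping_eqI)
  fix m0
  let ?L = "{l :: 'n list. length l = p}"
  have finL: "finite ?L" using finite_lists_length_eq[of "UNIV :: 'n set" p] by simp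
  show "Poly_Mapping.lookup f m0 = Poly_Mapping.lookup 0 m0"
  proof (cases "m0 \<in> Poly_Mapping.keys f")
    case True
    have "Poly_Mapping.lookup f m0 = 0"
    proof (rule monomials_independent[OF inf finL finite_keys _ _ True, where c = "Poly_Mapping.lookup f" and e = Poly_Mapping.lookup])
      fix m m' assume "m \<in> Poly_Mapping.keys f" "m' \<in> Poly_Mapping.keys f" "m \<noteq> m'"
      then obtain l where "Poly_Mapping.lookup m l \<noteq> Poly_Mapping.lookup m' l" by (metis poly_mapping_eqI)
      moreover from this have "l \<in> Poly_Mapping.keys m \<or> l \<in> Poly_Mapping.keys m'" by (auto simp: in_keys_iff)
      ultimately show "\<exists>l\<in>?L. Poly_Mapping.lookup m l \<noteq> Poly_Mapping.lookup m' l"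
        using f \<open>m \<in> Poly_Mapping.keys f\<close> \<open>m' \<in> Poly_Mapping.keys f\<close> by (auto simp: T_fin_def)
    next
      fix t :: "'n list \<Rightarrow> 'k"
      let ?t = "\<lambda>l. if length l = p then t l else 0"
      have "(\<Prod>l\<in>Poly_Mapping.keys m. ?t l ^ Poly_Mapping.lookup m l) = (\<Prod>l\<in>?L. t l ^ Poly_Mapping.lookup m l)" if "m \<in> Poly_Mapping.keys f" for m
      proof -
        have "(\<Prod>l\<in>Poly_Mapping.keys m. ?t l ^ Poly_Mapping.lookup m l) = (\<Prod>l\<in>?L. ?t l ^ Poly_Mapping.lookup m l)"
          by (rule prod.mono_neutral_left) (use that f finL in \<open>auto simp: T_fin_def in_keys_iff\<close>)
        then show ?thesis by simp
      qed
      then show "(\<Sum>m\<in>Poly_Mapping.keys f. Poly_Mapping.lookup f m * (\<Prod>l\<in>?L. t l ^ Poly_Mapping.lookup m l)) = 0"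
        using z[of ?t] by (simp add: tensors_def tpoly_val_def)
    qed
    then show ?thesis by simp
  qed (simp add: in_keys_iff)
qed

lemma A_inf_surj:
  fixes x0 :: "'k::field ^ 'n::finite \<Rightarrow> 'k"
  assumes lin: "Vector_Spaces.linear (*s) (*) x0" and nz: "x0 \<noteq> (\<lambda>_. 0)"
    and t: "t \<in> tensors p"
  shows "\<exists>\<omega> \<in> A_inf x0. \<omega> p = t"
proof -
  obtain v where "x0 v \<noteq> 0" using nz by auto
  then have "(\<Sum>j\<in>UNIV. x0 (axis j 1) * v $ j) \<noteq> 0"
    by (simp only: linear_expand[OF lin, of v, symmetric] not_False_eq_True)
  then obtain j0 where j0: "x0 (axis j0 1) \<noteq> 0"
    by (metis (no_types, lifting) mult_zero_left sum.neutral)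
  define lift where
    "lift t = (\<lambda>l. if l \<noteq> [] \<and> last l = j0 then t (butlast l) / x0 (axis j0 1) else 0)"
    for t :: "('k, 'n) tensor"
  have cl: "contract x0 (lift t) = t" for t
  proof
    fix l
    have "contract x0 (lift t) l = (\<Sum>j\<in>UNIV. if j = j0 then t l else 0)"
      unfolding contract_def lift_def by (intro sum.cong) (use j0 in auto)
    then show "contract x0 (lift t) l = t l" by simp
  qed
  have l1: "(lift ^^ d) t \<in> tensors (p + d)" for d
  proof (induction d)
    case (Suc d)
    have "length (butlast l) \<noteq> p + d" if "l \<noteq> []" "length l \<noteq> Suc (p + d)" for l :: "'n list"
      using that by (cases l rule: rev_cases) auto
    then show ?case using Suc by (auto simp: tensors_def lift_def)
  qed (use t in simp)
  have c1: "(contract x0 ^^ d) t \<in> tensors (p - d)" if "d \<le> p" for d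
    using that
  proof (induction d)
    case (Suc d)
    then have "p - d = Suc (p - Suc d)" by simp
    then show ?case using Suc contract_tensors[of _ "p - Suc d"] by simp
  qed (use t in simp)
  define \<omega> where "\<omega> q = (if p \<le> q then (lift ^^ (q - p)) t else (contract x0 ^^ (p - q)) t)" for q
  have "\<omega> \<in> A_inf x0" unfolding A_inf_def
  proof (intro CollectI allI conjI)
    fix q
    show "\<omega> q \<in> tensors q" using l1[of "q - p"] c1[of "p - q"] by (auto simp: \<omega>_def)
    show "contract x0 (\<omega> (Suc q)) = \<omega> q"
    proof (cases "p \<le> q")
      case True
      then show ?thesis by (simp add: \<omega>_def Suc_diff_le cl)
    next
      case False
      then have "p - q = Suc (p - Suc q)" by simp
      then show ?thesis using False by (auto simp: \<omega>_def le_Suc_eq)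
    qed
  qed
  moreover have "\<omega> p = t" by (simp add: \<omega>_def)
  ultimately show ?thesis by blast
qed

lemma inj_on_tpoly_fun:
  fixes x0 :: "'k::field ^ 'n::finite \<Rightarrow> 'k"
  assumes "infinite (UNIV :: 'k set)" and "Vector_Spaces.linear (*s) (*) x0" and "x0 \<noteq> (\<lambda>_. 0)"
  shows "inj_on (tpoly_fun x0 p) (T_fin p)"
proof (rule inj_onI)
  fix f h assume f: "f \<in> T_fin p" and h: "h \<in> T_fin p" and eq: "tpoly_fun x0 p f = tpoly_fun x0 p h"
  have m: "- h \<in> T_fin p" using h by (simp add: T_fin_def)
  have "tpoly_val (f + - h) t = 0" if t: "t \<in> tensors p" for t
  proof -
    obtain \<omega> where w: "\<omega> \<in> A_inf x0" "\<omega> p = t" using A_inf_surj[OF assms(2,3) t] by blast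
    have "tpoly_val f t = tpoly_val h t"
      using fun_cong[OF eq, of \<omega>] w by (simp add: tpoly_fun_def)
    moreover have "tpoly_val (h + - h) t = 0" by (simp add: tpoly_val_zero)
    ultimately show ?thesis
      using tpoly_val_add[of f "- h" t] tpoly_val_add[of h "- h" t] by simp
  qed
  moreover have "f + - h \<in> T_fin p"
    using f m keys_add[of f "- h"] by (auto simp: T_fin_def)
  ultimately have "f + - h = 0" using tpoly_zero[OF assms(1)] by blast
  then show "f = h" by simp
qed

end

theory Submission
  imports Defs "HOL-Library.Sublist" "Jordan_Normal_Form.Determinant"
begin

text \<open>
  Let \<open>\<xi>\<close> be the covector of \<open>x0\<close>. A point \<open>\<omega>\<close> of \<open>A_inf x0\<close> is the same thing as a multilinear form on
  sequences \<open>y\<close> of covectors with \<open>y i = \<xi>\<close> for almost all \<open>i\<close>: pair \<open>\<omega> p\<close> with the tensor product of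
  \<open>y 0, \<dots>, y (p - 1)\<close>; once \<open>y\<close> is constantly \<open>\<xi>\<close> from \<open>p\<close> on, the result no longer depends on \<open>p\<close>
  (\<open>form_of\<close>). In this picture the embeddings of the rings and groups disappear: polynomials are
  polynomials in the values \<open>\<Omega> y\<close>, and the group acts by substitution in \<open>y\<close> (\<open>form_of_act\<close>). For a set
  \<open>I\<close> of positions, the values at the sequences that follow \<open>y\<close> on \<open>I\<close> and \<open>z\<close> off \<open>I\<close> form a matrix
  indexed by \<open>y\<close> and \<open>z\<close>, a flattening. Tensors of rank at most \<open>k\<close> have flattenings of rank at
  most \<open>k\<close>, and minors are polynomials, so \<open>X_inf x0 k\<close> lies in the set of forms all of whose
  \<open>k + 1\<close>-minors of flattenings vanish (\<open>X_inf_rank_lt\<close>). Two facts about this set give the theorem.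

  It is cut out by finitely many orbits of minors (\<open>detect_rank\<close>). Indeed, a nonzero \<open>r\<close>-minor of a form
  can be replaced by a nonzero \<open>r\<close>-minor whose entries are values at sequences that all agree outside
  \<open>2 * r\<close> positions (\<open>few_positions\<close>); the group moves these positions to the front and turns the common covectors at all
  other positions into \<open>\<xi>\<close>, and multilinearity reduces to basis covectors in the front positions.

  It is Noetherian up to the group: on it, the zeros of any set of polynomials are the common zeros of
  the orbits of finitely many of them (\<open>rank_lt_noetherian\<close>). This goes by induction on the rank. A
  form of flattening rank exactly \<open>k\<close> has, after a group element, one of finitely many \<open>k\<close>-minors
  nonzero. The \<open>k + 1\<close>-minors that border this invertible block vanish and express the corner entry by
  the inverse of the block and the entries of the border. Choosing the flattening such that one
  position behind the block is separated from the others, one expresses every coordinate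
  polynomially by the inverse of the block and by coordinates with at most one letter different from
  \<open>\<xi>\<close> behind the block (\<open>basis_word_in_chart\<close>). The latter are finitely many for each position, and
  permutations of positions permute them. So it suffices that polynomials in variables indexed by
  \<open>\<nat> \<times> C\<close> with \<open>C\<close> finite are Noetherian up to increasing renamings of \<open>\<nat>\<close> (\<open>polys_noetherian\<close>), a theorem of
  Cohen. Its proof is that of Hilbert's basis theorem by leading monomials, with Dickson's lemma
  replaced by Higman's lemma over \<open>\<nat>\<^sup>C\<close>.

  Applied to the set of all polynomials that vanish on \<open>X_inf x0 k\<close>, the second fact yields finitely many
  orbits, which together with the orbits of the minors define \<open>X_inf x0 k\<close>, since membership in
  \<open>X_inf x0 k\<close> is by definition tested by polynomials.
\<close>

section \<open>Dickson and Higman\<close>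

text \<open>
  The strong form of being a well-quasi-order, in which it passes to finite products.
\<close>

definition mono_subseqs :: "('a \<Rightarrow> 'a \<Rightarrow> bool) \<Rightarrow> bool" where
  "mono_subseqs P \<longleftrightarrow> (\<forall>u :: nat \<Rightarrow> 'a. \<exists>\<phi> :: nat \<Rightarrow> nat. strict_mono \<phi> \<and> (\<forall>i j. i < j \<longrightarrow> P (u (\<phi> i)) (u (\<phi> j))))"

definition bad_seq :: "('a \<Rightarrow> 'a \<Rightarrow> bool) \<Rightarrow> (nat \<Rightarrow> 'a) \<Rightarrow> bool" where
  "bad_seq P f \<longleftrightarrow> (\<forall>i j. i < j \<longrightarrow> \<not> P (f i) (f j))"

lemma nat_nondecreasing_subseq:
  fixes u :: "nat \<Rightarrow> nat"
  shows "\<exists>\<phi> :: nat \<Rightarrow> nat. strict_mono \<phi> \<and> (\<forall>i j. i < j \<longrightarrow> u (\<phi> i) \<le> u (\<phi> j))"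
proof -
  have step: "\<exists>y>x. \<forall>z\<ge>y. u y \<le> u z" for x
  proof -
    define m where "m = (LEAST v. v \<in> u ` {x<..})"
    have "m \<in> u ` {x<..}" unfolding m_def by (rule LeastI[of _ "u (Suc x)"]) auto
    then obtain y where y: "y > x" "u y = m" by auto
    have "m \<le> u z" if "z > x" for z unfolding m_def by (rule Least_le) (use that in auto)
    then show ?thesis using y by (intro exI[of _ y]) auto
  qed
  have "\<exists>\<phi>. \<forall>n. (\<forall>z\<ge>\<phi> n. u (\<phi> n) \<le> u z) \<and> \<phi> n < \<phi> (Suc n)"
    by (rule dependent_nat_choice) (use step in blast)+
  then obtain \<phi> where \<phi>: "\<And>n z. z \<ge> \<phi> n \<Longrightarrow> u (\<phi> n) \<le> u z" "\<And>n. \<phi> n < \<phi> (Suc n)" by blast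
  have sm: "strict_mono \<phi>" using \<phi>(2) by (simp add: strict_mono_Suc_iff)
  then show ?thesis using \<phi>(1) by (metis less_imp_le strict_mono_less)
qed

lemma dickson:
  assumes "finite C"
  shows "mono_subseqs (\<lambda>u v. \<forall>c\<in>C. u c \<le> (v c :: nat))"
  using assms
proof (induction C rule: finite_induct)
  case empty
  show ?case unfolding mono_subseqs_def by (auto intro!: exI[of _ id] simp: strict_mono_def)
next
  case (insert c C)
  show ?case unfolding mono_subseqs_def
  proof
    fix u :: "nat \<Rightarrow> 'a \<Rightarrow> nat"
    obtain \<phi> :: "nat \<Rightarrow> nat" where \<phi>: "strict_mono \<phi>" "\<And>i j. i < j \<Longrightarrow> \<forall>c\<in>C. u (\<phi> i) c \<le> u (\<phi> j) c"
      using insert.IH unfolding mono_subseqs_def by blast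
    obtain \<psi> :: "nat \<Rightarrow> nat" where \<psi>: "strict_mono \<psi>" "\<And>i j. i < j \<Longrightarrow> u (\<phi> (\<psi> i)) c \<le> u (\<phi> (\<psi> j)) c"
      using nat_nondecreasing_subseq[of "\<lambda>i. u (\<phi> i) c"] by blast
    have "strict_mono (\<phi> \<circ> \<psi>)" using \<phi>(1) \<psi>(1) by (simp add: strict_mono_def)
    moreover have "\<forall>c'\<in>insert c C. u ((\<phi> \<circ> \<psi>) i) c' \<le> u ((\<phi> \<circ> \<psi>) j) c'" if "i < j" for i j
      using \<phi>(2)[of "\<psi> i" "\<psi> j"] \<psi>(2)[OF that] strict_monoD[OF \<psi>(1) that] by auto
    ultimately show "\<exists>\<phi> :: nat \<Rightarrow> nat. strict_mono \<phi> \<and>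
        (\<forall>i j. i < j \<longrightarrow> (\<forall>c'\<in>insert c C. u (\<phi> i) c' \<le> u (\<phi> j) c'))" by blast
  qed
qed

text \<open>
  Nash-Williams' construction: the terms are chosen one after the other, each of least size
  among all bad sequences that continue the choices made before.
\<close>

lemma minimal_bad_seq:
  fixes size :: "'a \<Rightarrow> nat"
  assumes "bad_seq P f"
  shows "\<exists>g. bad_seq P g \<and>
    (\<forall>n h. bad_seq P h \<longrightarrow> (\<forall>i<n. h i = g i) \<longrightarrow> size (g n) \<le> size (h n))"
proof -
  define Q where "Q n f \<longleftrightarrow> bad_seq P f \<and>
    (\<forall>h. bad_seq P h \<longrightarrow> (\<forall>i<n. h i = f i) \<longrightarrow> size (f n) \<le> size (h n))" for n f
  have ex: "\<exists>y. Q n y \<and> (\<forall>i<n. y i = f i)" if f: "bad_seq P f" for n f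
  proof -
    define S where "S = {h. bad_seq P h \<and> (\<forall>i<n. h i = f i)}"
    have "f \<in> S" using f by (auto simp: S_def)
    then obtain y where "y \<in> S" "\<And>h. h \<in> S \<Longrightarrow> size (y n) \<le> size (h n)"
      using ex_has_least_nat[of "\<lambda>h. h \<in> S" f "\<lambda>h. size (h n)"] by blast
    then show ?thesis by (intro exI[of _ y]) (auto simp: S_def Q_def)
  qed
  have "\<exists>F. \<forall>n. Q n (F n) \<and> (\<forall>i\<le>n. F (Suc n) i = F n i)"
  proof (rule dependent_nat_choice)
    show "\<exists>x. Q 0 x" using ex[OF assms, of 0] by blast
    fix x n assume "Q n x"
    then show "\<exists>y. Q (Suc n) y \<and> (\<forall>i\<le>n. y i = x i)"
      using ex[of x "Suc n"] unfolding Q_def by (simp add: less_Suc_eq_le)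
  qed
  then obtain F where F: "\<And>n. Q n (F n)" "\<And>n i. i \<le> n \<Longrightarrow> F (Suc n) i = F n i" by blast
  have agree: "F n i = F i i" if "i \<le> n" for i n
    using that by (induction n rule: dec_induct) (use F(2) in auto)
  define g where "g n = F n n" for n
  have "bad_seq P g" unfolding bad_seq_def
  proof (intro allI impI)
    fix i j :: nat assume "i < j"
    then have "\<not> P (F j i) (F j j)" using F(1)[of j] by (auto simp: Q_def bad_seq_def)
    then show "\<not> P (g i) (g j)" using agree[of i j] \<open>i < j\<close> by (simp add: g_def)
  qed
  moreover have "size (g n) \<le> size (h n)" if "bad_seq P h" "\<forall>i<n. h i = g i" for n h
  proof -
    have "\<forall>i<n. h i = F n i" using that(2) agree[of _ n] by (simp add: g_def)
    then show ?thesis using F(1)[of n] that(1) unfolding Q_def g_def by blast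
  qed
  ultimately show ?thesis by (intro exI[of _ g]) blast
qed

text \<open>
  In a minimal bad sequence of lists all lists are nonempty. Choose positions \<open>\<phi> 0 < \<phi> 1 < \<dots>\<close> at
  which the heads increase. Keeping the terms before \<open>\<phi> 0\<close> and continuing with the tails of the
  lists at \<open>\<phi> 0, \<phi> 1, \<dots>\<close> gives a bad sequence again, which contradicts minimality.
\<close>

lemma higman:
  assumes P: "mono_subseqs P"
  shows "\<not> bad_seq (list_emb P) f"
proof
  assume "bad_seq (list_emb P) f"
  then obtain g where g: "bad_seq (list_emb P) g"
    and min: "\<And>n h. bad_seq (list_emb P) h \<Longrightarrow> \<forall>i<n. h i = g i \<Longrightarrow> length (g n) \<le> length (h n)"
    using minimal_bad_seq[of "list_emb P" f length] by blast
  have ne: "g i \<noteq> []" for i using g unfolding bad_seq_def by (metis list_emb_Nil lessI)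
  obtain \<phi> :: "nat \<Rightarrow> nat" where \<phi>: "strict_mono \<phi>" "\<And>i j. i < j \<Longrightarrow> P (hd (g (\<phi> i))) (hd (g (\<phi> j)))"
    using P[unfolded mono_subseqs_def, rule_format, of "\<lambda>i. hd (g i)"] by blast
  have split: "g i = hd (g i) # tl (g i)" for i using ne by simp
  define h where "h i = (if i < \<phi> 0 then g i else tl (g (\<phi> (i - \<phi> 0))))" for i
  have "bad_seq (list_emb P) h" unfolding bad_seq_def
  proof (intro allI impI notI)
    fix i j :: nat assume ij: "i < j" and emb: "list_emb P (h i) (h j)"
    consider "j < \<phi> 0" | "i < \<phi> 0" "\<phi> 0 \<le> j" | "\<phi> 0 \<le> i" by linarith
    then show False
    proof cases
      case 1
      then show ?thesis using emb ij g by (auto simp: h_def bad_seq_def)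
    next
      case 2
      then have "list_emb P (g i) (tl (g (\<phi> (j - \<phi> 0))))" using emb by (simp add: h_def)
      then have "list_emb P (g i) (g (\<phi> (j - \<phi> 0)))" by (metis list_emb_Cons split)
      moreover have "i < \<phi> (j - \<phi> 0)"
        using 2 strict_mono_less_eq[OF \<phi>(1), of 0 "j - \<phi> 0"] by simp
      ultimately show ?thesis using g by (auto simp: bad_seq_def)
    next
      case 3
      let ?i = "\<phi> (i - \<phi> 0)" and ?j = "\<phi> (j - \<phi> 0)"
      have lt: "i - \<phi> 0 < j - \<phi> 0" using 3 ij by simp
      have "list_emb P (tl (g ?i)) (tl (g ?j))" using emb 3 ij by (simp add: h_def)
      then have "list_emb P (g ?i) (g ?j)"
        using \<phi>(2)[OF lt] by (metis list_emb_Cons2 split)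
      then show ?thesis using g strict_monoD[OF \<phi>(1) lt] by (auto simp: bad_seq_def)
    qed
  qed
  then have "length (g (\<phi> 0)) \<le> length (h (\<phi> 0))" by (rule min) (simp add: h_def)
  then show False using ne[of "\<phi> 0"] by (cases "g (\<phi> 0)") (simp_all add: h_def)
qed

lemma finite_basis:
  assumes "\<And>f. range f \<subseteq> L \<Longrightarrow> \<not> bad_seq P f"
  shows "\<exists>B\<subseteq>L. finite B \<and> (\<forall>x\<in>L. \<exists>b\<in>B. P b x)"
proof (rule ccontr)
  assume contra: "\<not> ?thesis"
  have step: "\<exists>x\<in>L. \<forall>b\<in>B. \<not> P b x" if B: "B \<subseteq> L" "finite B" for B
  proof (rule ccontr)
    assume "\<not> (\<exists>x\<in>L. \<forall>b\<in>B. \<not> P b x)"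
    then have "B \<subseteq> L \<and> finite B \<and> (\<forall>x\<in>L. \<exists>b\<in>B. P b x)" using B by simp
    then show False by (rule notE[OF contra exI])
  qed
  have "\<exists>S. \<forall>n. (fst (S n) \<subseteq> L \<and> finite (fst (S n)) \<and> snd (S n) \<in> L \<and> (\<forall>b\<in>fst (S n). \<not> P b (snd (S n))))
      \<and> fst (S (Suc n)) = insert (snd (S n)) (fst (S n))"
  proof (rule dependent_nat_choice)
    show "\<exists>x. fst x \<subseteq> L \<and> finite (fst x) \<and> snd x \<in> L \<and> (\<forall>b\<in>fst x. \<not> P b (snd x))"
    proof -
      obtain z where "z \<in> L" using step[of "{}"] by auto
      then show ?thesis by (intro exI[of _ "({}, z)"]) simp
    qed
    fix x :: "'a set \<times> 'a" and n
    assume x: "fst x \<subseteq> L \<and> finite (fst x) \<and> snd x \<in> L \<and> (\<forall>b\<in>fst x. \<not> P b (snd x))"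
    then obtain z where "z \<in> L" "\<forall>b\<in>insert (snd x) (fst x). \<not> P b z"
      using step[of "insert (snd x) (fst x)"] by auto
    then show "\<exists>y. (fst y \<subseteq> L \<and> finite (fst y) \<and> snd y \<in> L \<and> (\<forall>b\<in>fst y. \<not> P b (snd y)))
       \<and> fst y = insert (snd x) (fst x)"
      using x by (intro exI[of _ "(insert (snd x) (fst x), z)"]) auto
  qed
  then obtain S where S: "\<forall>n. (fst (S n) \<subseteq> L \<and> finite (fst (S n)) \<and> snd (S n) \<in> L \<and>
      (\<forall>b\<in>fst (S n). \<not> P b (snd (S n)))) \<and> fst (S (Suc n)) = insert (snd (S n)) (fst (S n))"
    by (rule exE)
  have mem: "snd (S i) \<in> fst (S j)" if "i < j" for i j
    using that
  proof (induction j)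
    case (Suc j)
    then show ?case by (cases "i = j") (simp_all add: S)
  qed simp
  have "bad_seq P (\<lambda>n. snd (S n))" unfolding bad_seq_def
    using S mem by simp
  moreover have "range (\<lambda>n. snd (S n)) \<subseteq> L" using S by auto
  ultimately show False using assms[of "\<lambda>n. snd (S n)"] by simp
qed

section \<open>Monomials and leading terms\<close>

text \<open>
  Monomials in variables indexed by natural numbers are exponent functions of finite support.
\<close>

definition fsupp :: "(nat \<Rightarrow> nat) set" where
  "fsupp = {m. finite {v. m v \<noteq> 0}}"

definition mon :: "(nat \<Rightarrow> nat) \<Rightarrow> (nat \<Rightarrow> 'k::field) \<Rightarrow> 'k" where
  "mon m a = (\<Prod>v | m v \<noteq> 0. a v ^ m v)"

lemma mon_superset:
  assumes "finite A" "{v. m v \<noteq> 0} \<subseteq> A"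
  shows "mon m a = (\<Prod>v\<in>A. a v ^ m v)"
  unfolding mon_def by (rule prod.mono_neutral_left) (use assms in auto)

lemma fsupp_add: "m \<in> fsupp \<Longrightarrow> m' \<in> fsupp \<Longrightarrow> (\<lambda>v. m v + m' v) \<in> fsupp"
  unfolding fsupp_def mem_Collect_eq
  by (rule finite_subset[of _ "{v. m v \<noteq> 0} \<union> {v. m' v \<noteq> 0}"]) auto

lemma mon_add:
  assumes "m \<in> fsupp" "m' \<in> fsupp"
  shows "mon (\<lambda>v. m v + m' v) a = mon m a * mon m' a"
proof -
  let ?A = "{v. m v \<noteq> 0} \<union> {v. m' v \<noteq> 0}"
  have A: "finite ?A" using assms by (auto simp: fsupp_def)
  have "mon (\<lambda>v. m v + m' v) a = (\<Prod>v\<in>?A. a v ^ (m v + m' v))"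
    by (rule mon_superset[OF A]) auto
  also have "\<dots> = (\<Prod>v\<in>?A. a v ^ m v) * (\<Prod>v\<in>?A. a v ^ m' v)"
    by (simp add: power_add prod.distrib)
  also have "\<dots> = mon m a * mon m' a"
    using mon_superset[OF A, of m a] mon_superset[OF A, of m' a] by auto
  finally show ?thesis .
qed

text \<open>
  The lexicographic order with the highest variable as the most significant one. With infinitely
  many variables this choice makes the order a well-order, and it is preserved by increasing
  renamings of the variables.
\<close>

definition mon_less :: "(nat \<Rightarrow> nat) \<Rightarrow> (nat \<Rightarrow> nat) \<Rightarrow> bool" where
  "mon_less \<mu> m \<longleftrightarrow> (\<exists>v. \<mu> v < m v \<and> (\<forall>w>v. \<mu> w = m w))"

lemma mon_less_trans: "mon_less l m \<Longrightarrow> mon_less m n \<Longrightarrow> mon_less l n"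
proof -
  assume "mon_less l m" "mon_less m n"
  then obtain v w where v: "l v < m v" "\<And>u. u > v \<Longrightarrow> l u = m u"
    and w: "m w < n w" "\<And>u. u > w \<Longrightarrow> m u = n u" unfolding mon_less_def by blast
  have "l (max v w) < n (max v w)" using v w
    by (cases v w rule: linorder_cases) (auto simp: max_def)
  moreover have "l u = n u" if "u > max v w" for u using v(2) w(2) that by simp
  ultimately show "mon_less l n" unfolding mon_less_def by blast
qed

lemma mon_less_linear:
  assumes "l \<in> fsupp" "m \<in> fsupp" "l \<noteq> m"
  shows "mon_less l m \<or> mon_less m l"
proof -
  let ?D = "{v. l v \<noteq> m v}"
  have fin: "finite ?D"
    by (rule finite_subset[of _ "{v. l v \<noteq> 0} \<union> {v. m v \<noteq> 0}"]) (use assms in \<open>auto simp: fsupp_def\<close>)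
  have ne: "?D \<noteq> {}" using assms(3) by auto
  have "\<exists>M. l M \<noteq> m M \<and> (\<forall>w>M. l w = m w)"
  proof (intro exI conjI allI impI)
    show "l (Max ?D) \<noteq> m (Max ?D)" using Max_in[OF fin ne] by simp
    show "l w = m w" if "w > Max ?D" for w using Max_ge[OF fin, of w] that by fastforce
  qed
  then obtain M where M: "l M \<noteq> m M" "\<And>w. w > M \<Longrightarrow> l w = m w" by blast
  show ?thesis
  proof (cases "l M < m M")
    case True
    then have "mon_less l m" unfolding mon_less_def using M(2) by blast
    then show ?thesis ..
  next
    case False
    then have "m M < l M" using M(1) by simp
    moreover have "m w = l w" if "w > M" for w using M(2)[OF that] by simp
    ultimately have "mon_less m l" unfolding mon_less_def by blast
    then show ?thesis ..
  qed
qed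

text \<open>
  With variables below \<open>N + 1\<close>, first minimize the exponent of variable \<open>N\<close>, then the rest.
\<close>

lemma mon_less_minimal_bounded:
  assumes "Q \<noteq> {}" "\<And>m v. m \<in> Q \<Longrightarrow> v \<ge> N \<Longrightarrow> m v = 0"
  shows "\<exists>m\<in>Q. \<forall>\<mu>\<in>Q. \<not> mon_less \<mu> m"
  using assms
proof (induction N arbitrary: Q)
  case 0
  then obtain m where "m \<in> Q" by blast
  moreover from this have "m v = 0" for v by (rule 0(2)) simp
  ultimately show ?case by (intro bexI[of _ m]) (auto simp: mon_less_def)
next
  case (Suc N)
  obtain m0 where m0: "m0 \<in> Q" "\<And>m. m \<in> Q \<Longrightarrow> m0 N \<le> m N"
    using ex_has_least_nat[of "\<lambda>m. m \<in> Q" _ "\<lambda>m. m N"] Suc.prems(1) by blast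
  define R where "R = (\<lambda>m. m(N := 0)) ` {m \<in> Q. m N = m0 N}"
  have "R \<noteq> {}" using m0(1) by (auto simp: R_def)
  moreover have "m v = 0" if m: "m \<in> R" and v: "v \<ge> N" for m v
  proof -
    obtain m' where m': "m' \<in> Q" "m = m'(N := 0)" using m by (auto simp: R_def)
    then show ?thesis using Suc.prems(2)[OF m'(1), of v] v by (cases "v = N") auto
  qed
  ultimately obtain r where r: "r \<in> R" "\<And>\<mu>. \<mu> \<in> R \<Longrightarrow> \<not> mon_less \<mu> r"
    using Suc.IH[of R] by blast
  obtain m where m: "m \<in> Q" "m N = m0 N" "r = m(N := 0)" using r(1) by (auto simp: R_def)
  have "\<not> mon_less \<mu> m" if \<mu>: "\<mu> \<in> Q" for \<mu>
  proof
    assume "mon_less \<mu> m"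
    then obtain v where v: "\<mu> v < m v" "\<And>w. w > v \<Longrightarrow> \<mu> w = m w" unfolding mon_less_def by blast
    have vN: "v < Suc N" using Suc.prems(2)[OF m(1), of v] v(1) by (cases "v < Suc N") auto
    have "v \<noteq> N" using v(1) m0(2)[OF \<mu>] m(2) by auto
    then have "v < N" using vN by simp
    then have "\<mu> N = m0 N" using v(2)[of N] m(2) by simp
    then have "\<mu>(N := 0) \<in> R" using \<mu> by (auto simp: R_def)
    moreover have "mon_less (\<mu>(N := 0)) r" unfolding mon_less_def m(3)
      by (rule exI[of _ v]) (use v \<open>v < N\<close> in auto)
    ultimately show False using r(2) by blast
  qed
  then show ?case using m(1) by blast
qed

text \<open>
  A monomial below one in variables less than \<open>N\<close> involves only variables less than \<open>N\<close>.
\<close>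

lemma mon_less_wf: "wf {(\<mu>, m). \<mu> \<in> fsupp \<and> m \<in> fsupp \<and> mon_less \<mu> m}"
proof (rule wfI_min)
  fix x :: "nat \<Rightarrow> nat" and Q assume x: "x \<in> Q"
  show "\<exists>z\<in>Q. \<forall>y. (y, z) \<in> {(\<mu>, m). \<mu> \<in> fsupp \<and> m \<in> fsupp \<and> mon_less \<mu> m} \<longrightarrow> y \<notin> Q"
  proof (cases "x \<in> fsupp")
    case True
    then have "finite {v. x v \<noteq> 0}" by (simp add: fsupp_def)
    then obtain N where "\<forall>v\<in>{v. x v \<noteq> 0}. v < N" using finite_nat_set_iff_bounded by blast
    then have N: "x v = 0" if "v \<ge> N" for v using that by (metis (mono_tags) leD mem_Collect_eq)
    \<comment> \<open>nothing outside \<open>Q'\<close> is below an element of \<open>Q'\<close>, so a minimal element of \<open>Q'\<close> will do\<close>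
    define Q' where "Q' = {m \<in> Q. \<forall>v\<ge>N. m v = 0}"
    have "\<exists>m\<in>Q'. \<forall>\<mu>\<in>Q'. \<not> mon_less \<mu> m"
      by (rule mon_less_minimal_bounded[of _ N]) (use x N in \<open>auto simp: Q'_def\<close>)
    then obtain m where m: "m \<in> Q'" "\<And>\<mu>. \<mu> \<in> Q' \<Longrightarrow> \<not> mon_less \<mu> m" by blast
    have "y \<notin> Q" if "mon_less y m" for y
    proof
      assume "y \<in> Q"
      obtain v where v: "y v < m v" "\<And>w. w > v \<Longrightarrow> y w = m w" using \<open>mon_less y m\<close> unfolding mon_less_def by blast
      have vN: "v < N" using m(1) v(1) by (cases "v < N") (auto simp: Q'_def)
      have "y w = 0" if "w \<ge> N" for w using m(1) v(2)[of w] vN that by (auto simp: Q'_def)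
      then show False using m(2)[of y] \<open>y \<in> Q\<close> \<open>mon_less y m\<close> by (simp add: Q'_def)
    qed
    then show ?thesis using m(1) by (auto simp: Q'_def)
  qed (use x in auto)
qed

text \<open>
  The renaming of variables along an injection \<open>p\<close>, on exponents.
\<close>

definition push :: "(nat \<Rightarrow> nat) \<Rightarrow> (nat \<Rightarrow> nat) \<Rightarrow> nat \<Rightarrow> nat" where
  "push p m = (\<lambda>w. if w \<in> range p then m (inv_into UNIV p w) else 0)"

lemma push_apply: "strict_mono p \<Longrightarrow> push p m (p v) = m v"
  by (simp add: push_def strict_mono_imp_inj_on)

lemma push_outside: "w \<notin> range p \<Longrightarrow> push p m w = 0"
  by (simp add: push_def)

lemma push_supp:
  assumes "strict_mono p" shows "{w. push p m w \<noteq> 0} = p ` {v. m v \<noteq> 0}"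
proof -
  have "push p m w \<noteq> 0 \<longleftrightarrow> w \<in> p ` {v. m v \<noteq> 0}" for w
  proof (cases "w \<in> range p")
    case True
    then obtain v where "w = p v" by blast
    then show ?thesis using assms by (auto simp: push_apply inj_image_mem_iff strict_mono_imp_inj_on strict_mono_eq)
  qed (auto simp: push_outside)
  then show ?thesis by blast
qed

lemma push_fsupp: "strict_mono p \<Longrightarrow> m \<in> fsupp \<Longrightarrow> push p m \<in> fsupp"
  unfolding fsupp_def mem_Collect_eq by (subst push_supp) auto

lemma mon_push:
  assumes "strict_mono p" shows "mon (push p m) a = mon m (\<lambda>v. a (p v))"
proof -
  have "mon (push p m) a = (\<Prod>v | m v \<noteq> 0. a (p v) ^ push p m (p v))"
    unfolding mon_def push_supp[OF assms]
    by (rule prod.reindex_cong[of p]) (auto simp: inj_on_def strict_mono_eq[OF assms])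
  then show ?thesis by (simp add: push_apply[OF assms] mon_def)
qed

lemma mon_less_push:
  assumes "strict_mono p" "mon_less \<mu> m" shows "mon_less (push p \<mu>) (push p m)"
proof -
  obtain v where v: "\<mu> v < m v" "\<And>w. w > v \<Longrightarrow> \<mu> w = m w" using assms(2) unfolding mon_less_def by blast
  have "push p \<mu> w = push p m w" if "w > p v" for w
  proof (cases "w \<in> range p")
    case True
    then obtain u where "w = p u" by blast
    then show ?thesis using v(2)[of u] that strict_mono_less[OF assms(1)] by (simp add: push_apply[OF assms(1)])
  qed (simp add: push_outside)
  then show ?thesis unfolding mon_less_def using v(1)
    by (intro exI[of _ "p v"]) (simp add: push_apply[OF assms(1)])
qed

lemma mon_less_add: "mon_less \<mu> m \<Longrightarrow> mon_less (\<lambda>v. q v + \<mu> v) (\<lambda>v. q v + m v)"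
  by (auto simp: mon_less_def)

text \<open>
  Polynomials are treated as functions, and having a leading monomial as a property of functions;
  the argument does not require that the leading monomial is unique.
\<close>

inductive_set mon_span :: "(nat \<Rightarrow> nat) set \<Rightarrow> ((nat \<Rightarrow> 'k::field) \<Rightarrow> 'k) set" for S where
  zero: "(\<lambda>a. 0) \<in> mon_span S"
| step: "f \<in> mon_span S \<Longrightarrow> \<mu> \<in> S \<Longrightarrow> (\<lambda>a. c * mon \<mu> a + f a) \<in> mon_span S"

lemma mon_span_add: "f \<in> mon_span S \<Longrightarrow> g \<in> mon_span S \<Longrightarrow> (\<lambda>a. f a + g a) \<in> mon_span S"
proof (induction f rule: mon_span.induct)
  case (step f \<mu> c)
  then show ?case using mon_span.step[of "\<lambda>a. f a + g a" S \<mu> c] by (simp add: add.assoc)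
qed simp

lemma mon_span_mono: "f \<in> mon_span S \<Longrightarrow> S \<subseteq> S' \<Longrightarrow> f \<in> mon_span S'"
  by (induction f rule: mon_span.induct) (auto intro: mon_span.intros)

lemma mon_span_mon: "\<mu> \<in> S \<Longrightarrow> (\<lambda>a. c * mon \<mu> a) \<in> mon_span S"
  using mon_span.step[OF mon_span.zero, of \<mu> S c] by simp

lemma mon_span_push:
  assumes "f \<in> mon_span S" "S \<subseteq> fsupp" "q \<in> fsupp" "strict_mono p"
    and "\<And>\<mu>. \<mu> \<in> S \<Longrightarrow> (\<lambda>v. q v + push p \<mu> v) \<in> S'"
  shows "(\<lambda>a. c * (mon q a * f (\<lambda>v. a (p v)))) \<in> mon_span S'"
  using assms(1)
proof (induction f rule: mon_span.induct)
  case zero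
  then show ?case by (simp add: mon_span.zero)
next
  case (step f \<mu> d)
  have "(\<lambda>a. (c * d) * mon (\<lambda>v. q v + push p \<mu> v) a + c * (mon q a * f (\<lambda>v. a (p v)))) \<in> mon_span S'"
    by (rule mon_span.step[OF step.IH assms(5)[OF step.hyps(2)]])
  moreover have "mon (\<lambda>v. q v + push p \<mu> v) a = mon q a * mon \<mu> (\<lambda>v. a (p v))" for a :: "nat \<Rightarrow> 'a"
    using mon_add[OF assms(3) push_fsupp[OF assms(4)], of \<mu> a] step.hyps(2) assms(2)
    by (auto simp: mon_push[OF assms(4)])
  ultimately show ?case by (simp add: algebra_simps)
qed

lemma mon_span_mult:
  assumes "f \<in> mon_span fsupp" "g \<in> mon_span fsupp" shows "(\<lambda>a. f a * g a) \<in> mon_span fsupp"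
  using assms(1)
proof (induction f rule: mon_span.induct)
  case zero
  then show ?case by (simp add: mon_span.zero)
next
  case (step f \<mu> c)
  have id: "strict_mono (\<lambda>v::nat. v)" by (simp add: strict_mono_def)
  have "(\<lambda>a. c * (mon \<mu> a * g (\<lambda>v. a v))) \<in> mon_span fsupp"
    by (rule mon_span_push[OF assms(2) subset_refl step.hyps(2) id])
       (intro fsupp_add step.hyps(2) push_fsupp id)
  from mon_span_add[OF this step.IH] show ?case by (simp add: algebra_simps)
qed

definition below :: "(nat \<Rightarrow> nat) \<Rightarrow> (nat \<Rightarrow> nat) set" where
  "below m = {\<mu> \<in> fsupp. mon_less \<mu> m}"

definition leads :: "(nat \<Rightarrow> nat) \<Rightarrow> ((nat \<Rightarrow> 'k::field) \<Rightarrow> 'k) \<Rightarrow> bool" where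
  "leads m f \<longleftrightarrow> (\<exists>c g. c \<noteq> 0 \<and> g \<in> mon_span (below m) \<and> f = (\<lambda>a. c * mon m a + g a))"

text \<open>
  Terms are added one at a time. The leading terms of the two summands compete unless they are
  multiples of the same monomial \<open>m\<close> and cancel; what is left then lies in the span of smaller
  monomials, for which the claim is assumed.
\<close>

lemma leads_aux:
  fixes f :: "(nat \<Rightarrow> 'k::field) \<Rightarrow> 'k"
  assumes S: "S \<subseteq> fsupp" "\<And>m \<mu>. m \<in> S \<Longrightarrow> \<mu> \<in> below m \<Longrightarrow> \<mu> \<in> S"
    and IH: "\<And>m (g :: (nat \<Rightarrow> 'k) \<Rightarrow> 'k). m \<in> S \<Longrightarrow> g \<in> mon_span (below m) \<Longrightarrow> g = (\<lambda>a. 0) \<or> (\<exists>m'\<in>below m. leads m' g)"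
    and f: "f \<in> mon_span S"
  shows "f = (\<lambda>a. 0) \<or> (\<exists>m\<in>S. leads m f)"
  using f
proof (induction f rule: mon_span.induct)
  case (step f \<mu> c)
  show ?case
  proof (cases "c = 0")
    case True
    then show ?thesis using step.IH by simp
  next
    case c: False
    from step.IH show ?thesis
    proof
      assume "f = (\<lambda>a. 0)"
      then have "leads \<mu> (\<lambda>a. c * mon \<mu> a + f a)"
        unfolding leads_def using c by (intro exI[of _ c] exI[of _ "\<lambda>a. 0"]) (simp add: mon_span.zero)
      then show ?thesis using step.hyps by blast
    next
      assume "\<exists>m\<in>S. leads m f"
      then obtain m d g where m: "m \<in> S" and d: "d \<noteq> 0" and g: "g \<in> mon_span (below m)"
        and f: "f = (\<lambda>a. d * mon m a + g a)" unfolding leads_def by blast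
      have fin: "m \<in> fsupp" "\<mu> \<in> fsupp" using m step.hyps(2) S(1) by auto
      consider "m = \<mu>" "c + d \<noteq> 0" | "m = \<mu>" "c + d = 0" | "mon_less m \<mu>" | "mon_less \<mu> m"
        using mon_less_linear[OF fin] by blast
      then show ?thesis
      proof cases
        case 1
        then have "leads m (\<lambda>a. c * mon \<mu> a + f a)"
          unfolding leads_def f using g by (intro exI[of _ "c + d"] exI[of _ g]) (simp add: algebra_simps)
        then show ?thesis using m by blast
      next
        case 2
        have "c * mon \<mu> a + f a = (c + d) * mon \<mu> a + g a" for a using 2(1) by (simp add: f algebra_simps)
        then have "(\<lambda>a. c * mon \<mu> a + f a) = g" using 2(2) by auto
        then show ?thesis using IH[OF m g] S(2)[OF m] by auto
      next
        case 3
        have "g \<in> mon_span (below \<mu>)"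
          by (rule mon_span_mono[OF g]) (use mon_less_trans[OF _ 3] in \<open>auto simp: below_def\<close>)
        then have "(\<lambda>a. d * mon m a + g a) \<in> mon_span (below \<mu>)"
          using 3 fin by (intro mon_span.step) (auto simp: below_def)
        then have "leads \<mu> (\<lambda>a. c * mon \<mu> a + f a)" unfolding leads_def using c f by blast
        then show ?thesis using step.hyps by blast
      next
        case 4
        have "(\<lambda>a. c * mon \<mu> a + g a) \<in> mon_span (below m)"
          using 4 fin by (intro mon_span.step g) (auto simp: below_def)
        then have "leads m (\<lambda>a. c * mon \<mu> a + f a)" unfolding leads_def using d
          by (intro exI[of _ d] exI[of _ "\<lambda>a. c * mon \<mu> a + g a"]) (simp add: f algebra_simps)
        then show ?thesis using m by blast
      qed
    qed
  qed
qed simp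

lemma leads_below:
  fixes g :: "(nat \<Rightarrow> 'k::field) \<Rightarrow> 'k"
  assumes "m \<in> fsupp" "g \<in> mon_span (below m)"
  shows "g = (\<lambda>a. 0) \<or> (\<exists>m'\<in>below m. leads m' g)"
  using assms
proof (induction m arbitrary: g rule: wf_induct_rule[OF mon_less_wf])
  case (1 m)
  show ?case
  proof (rule leads_aux[OF _ _ _ "1.prems"(2)])
    show "below m \<subseteq> fsupp" by (auto simp: below_def)
    show "\<mu> \<in> below m" if "m' \<in> below m" "\<mu> \<in> below m'" for m' \<mu>
      using that mon_less_trans by (auto simp: below_def)
    show "h = (\<lambda>a. 0) \<or> (\<exists>m''\<in>below m'. leads m'' h)"
      if "m' \<in> below m" "h \<in> mon_span (below m')" for m' and h :: "(nat \<Rightarrow> 'k) \<Rightarrow> 'k"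
      by (rule "1.IH") (use that "1.prems" in \<open>auto simp: below_def\<close>)
  qed
qed

lemma leads_exists:
  fixes f :: "(nat \<Rightarrow> 'k::field) \<Rightarrow> 'k"
  assumes "f \<in> mon_span fsupp"
  shows "f = (\<lambda>a. 0) \<or> (\<exists>m\<in>fsupp. leads m f)"
proof (rule leads_aux[OF subset_refl _ _ assms])
  show "\<mu> \<in> fsupp" if "\<mu> \<in> below m" for m \<mu> using that by (simp add: below_def)
qed (rule leads_below)

section \<open>Noetherianity up to increasing maps\<close>

text \<open>
  Variable \<open>n * j + c\<close> with \<open>c < n\<close> stands for the variable in row \<open>j\<close> and column \<open>c\<close>. A map \<open>\<pi>\<close> of rows
  acts on variables by \<open>stretch n \<pi>\<close>.
\<close>

definition stretch :: "nat \<Rightarrow> (nat \<Rightarrow> nat) \<Rightarrow> nat \<Rightarrow> nat" where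
  "stretch n \<pi> v = n * \<pi> (v div n) + v mod n"

lemma stretch_div_mod:
  assumes "n > 0" shows "stretch n \<pi> v div n = \<pi> (v div n)" "stretch n \<pi> v mod n = v mod n"
  using assms by (simp_all add: stretch_def)

lemma stretch_strict_mono:
  assumes "n > 0" "strict_mono \<pi>" shows "strict_mono (stretch n \<pi>)"
proof (rule strict_monoI)
  fix x y :: nat assume xy: "x < y"
  show "stretch n \<pi> x < stretch n \<pi> y"
  proof (cases "x div n = y div n")
    case True
    have "n * (x div n) + x mod n < n * (y div n) + y mod n" using xy by simp
    moreover have "n * (x div n) = n * (y div n)" using True by simp
    ultimately have "x mod n < y mod n" by linarith
    then show ?thesis by (simp only: stretch_def True nat_add_left_cancel_less)
  next
    case False
    then have "x div n < y div n" using xy div_le_mono[of x y n] by simp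
    then have "Suc (\<pi> (x div n)) \<le> \<pi> (y div n)" using strict_monoD[OF assms(2)] by (simp add: Suc_leI)
    then have "n * Suc (\<pi> (x div n)) \<le> n * \<pi> (y div n)" by (rule mult_le_mono2)
    then show ?thesis using mod_less_divisor[OF assms(1), of x] by (simp add: stretch_def)
  qed
qed

lemma stretch_comp: "n > 0 \<Longrightarrow> stretch n \<pi> (stretch n \<rho> v) = stretch n (\<pi> \<circ> \<rho>) v"
  by (simp add: stretch_def)

definition inc_div :: "nat \<Rightarrow> (nat \<Rightarrow> nat) \<Rightarrow> (nat \<Rightarrow> nat) \<Rightarrow> bool" where
  "inc_div n b m \<longleftrightarrow> (\<exists>\<pi>. strict_mono \<pi> \<and> (\<forall>v. b v \<le> m (stretch n \<pi> v)))"

lemma list_emb_strict_mono: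
  assumes "list_emb P xs ys"
  shows "\<exists>\<pi> :: nat \<Rightarrow> nat. strict_mono \<pi> \<and> (\<forall>i<length xs. \<pi> i < length ys \<and> P (xs ! i) (ys ! \<pi> i))"
  using assms
proof (induction rule: list_emb.induct)
  case (list_emb_Nil ys)
  show ?case by (intro exI[of _ id]) (simp add: strict_mono_def)
next
  case (list_emb_Cons xs ys y)
  then obtain \<pi> :: "nat \<Rightarrow> nat" where "strict_mono \<pi>"
    "\<forall>i<length xs. \<pi> i < length ys \<and> P (xs ! i) (ys ! \<pi> i)" by blast
  then show ?case by (intro exI[of _ "\<lambda>i. Suc (\<pi> i)"]) (simp add: strict_mono_def)
next
  case (list_emb_Cons2 x y xs ys)
  then obtain \<pi> :: "nat \<Rightarrow> nat" where "strict_mono \<pi>"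
    "\<forall>i<length xs. \<pi> i < length ys \<and> P (xs ! i) (ys ! \<pi> i)" by blast
  then show ?case using list_emb_Cons2.hyps
    by (intro exI[of _ "case_nat 0 (\<lambda>i. Suc (\<pi> i))"])
       (auto simp: strict_mono_def nth_Cons split: nat.splits)
qed

text \<open>
  Written as the list of its rows, each of which is a vector of \<open>n\<close> exponents, a monomial divides
  another one up to an increasing map as soon as its list embeds, so Higman's and Dickson's lemmas apply.
\<close>

lemma inc_div_finite_basis:
  assumes n: "n > 0" and L: "L \<subseteq> fsupp"
  shows "\<exists>B\<subseteq>L. finite B \<and> (\<forall>m\<in>L. \<exists>b\<in>B. inc_div n b m)"
proof (rule finite_basis)
  fix f :: "nat \<Rightarrow> nat \<Rightarrow> nat" assume f: "range f \<subseteq> L"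
  have "\<exists>N. \<forall>v\<ge>N. f i v = 0" for i
  proof -
    have "finite {v. f i v \<noteq> 0}" using f L by (auto simp: fsupp_def)
    then obtain N where N: "\<forall>v\<in>{v. f i v \<noteq> 0}. v < N" using finite_nat_set_iff_bounded by blast
    then have "f i v = 0" if "v \<ge> N" for v
      using that by (metis (mono_tags) leD mem_Collect_eq)
    then show ?thesis by blast
  qed
  then obtain N where N: "\<And>i v. v \<ge> N i \<Longrightarrow> f i v = 0" by metis
  let ?P = "\<lambda>u v. \<forall>c\<in>{..<n}. u c \<le> (v c :: nat)"
  define l where "l i = map (\<lambda>j c. f i (n * j + c)) [0..<N i]" for i
  have "\<not> bad_seq (list_emb ?P) l" by (rule higman[OF dickson]) simp
  then obtain i j where ij: "i < j" "list_emb ?P (l i) (l j)" by (auto simp: bad_seq_def)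
  obtain \<pi> :: "nat \<Rightarrow> nat" where \<pi>: "strict_mono \<pi>"
    "\<And>s. s < length (l i) \<Longrightarrow> \<pi> s < length (l j) \<and> ?P (l i ! s) (l j ! \<pi> s)"
    using list_emb_strict_mono[OF ij(2)] by blast
  have "f i v \<le> f j (stretch n \<pi> v)" for v
  proof (cases "v div n < N i")
    case True
    then have "\<pi> (v div n) < N j" "?P (l i ! (v div n)) (l j ! \<pi> (v div n))"
      using \<pi>(2)[of "v div n"] by (auto simp: l_def)
    then have P: "\<forall>c\<in>{..<n}. f i (n * (v div n) + c) \<le> f j (n * \<pi> (v div n) + c)"
      using True by (simp add: l_def)
    show ?thesis using bspec[OF P, of "v mod n"] n by (simp add: stretch_def)
  next
    case False
    then have "N i \<le> v" using div_le_dividend[of v n] by linarith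
    then show ?thesis using N[of i v] by simp
  qed
  then show "\<not> bad_seq (inc_div n) f" unfolding bad_seq_def inc_div_def using ij(1) \<pi>(1) by blast
qed

definition inc_zeros :: "nat \<Rightarrow> ((nat \<Rightarrow> 'k::field) \<Rightarrow> 'k) set \<Rightarrow> (nat \<Rightarrow> 'k) set" where
  "inc_zeros n F = {a. \<forall>f\<in>F. \<forall>\<pi>. strict_mono \<pi> \<longrightarrow> f (\<lambda>v. a (stretch n \<pi> v)) = 0}"

lemma inc_zeros_stretch:
  assumes "n > 0" "a \<in> inc_zeros n F" "strict_mono \<pi>"
  shows "(\<lambda>v. a (stretch n \<pi> v)) \<in> inc_zeros n F"
  unfolding inc_zeros_def
proof (intro CollectI ballI allI impI)
  fix f \<rho> assume "f \<in> F" "strict_mono (\<rho> :: nat \<Rightarrow> nat)"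
  moreover from this have "strict_mono (\<pi> \<circ> \<rho>)" using assms(3) by (simp add: strict_mono_def)
  ultimately show "f (\<lambda>v. a (stretch n \<pi> (stretch n \<rho> v))) = 0"
    using assms(2) unfolding stretch_comp[OF assms(1)] inc_zeros_def by blast
qed

lemma inc_zeros_contains: "a \<in> inc_zeros n F \<Longrightarrow> f \<in> F \<Longrightarrow> f a = 0"
proof -
  assume a: "a \<in> inc_zeros n F" "f \<in> F"
  then have "f (\<lambda>v. a (stretch n (\<lambda>i. i) v)) = 0" by (auto simp: inc_zeros_def strict_mono_def)
  then show ?thesis by (simp add: stretch_def)
qed

text \<open>
  Let \<open>I\<close> be the set of polynomials \<open>h\<close> that vanish on the common zeros of the translates of
  finitely many elements of \<open>F\<close>. It is closed under differences, under multiplication and under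
  increasing renamings. Choose a finite basis \<open>B\<close> of its leading monomials, and for each \<open>b\<close> in \<open>B\<close> some
  \<open>H b\<close> in \<open>I\<close> with leading monomial \<open>b\<close>. The leading term of any \<open>h\<close> in \<open>I\<close> is removed by subtracting
  a multiple of a renaming of some \<open>H b\<close>, so by induction \<open>h\<close> vanishes where all renamings of the \<open>H b\<close> do.
\<close>

theorem inc_noetherian:
  fixes F :: "((nat \<Rightarrow> 'k::field) \<Rightarrow> 'k) set"
  assumes n: "n > 0" and F: "F \<subseteq> mon_span fsupp"
  shows "\<exists>F0\<subseteq>F. finite F0 \<and> (\<forall>a\<in>inc_zeros n F0. \<forall>f\<in>F. f a = 0)"
proof -
  define I where "I = {h \<in> mon_span fsupp. \<exists>F0\<subseteq>F. finite F0 \<and> (\<forall>a\<in>inc_zeros n F0. h a = 0)}"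
  have "\<exists>B\<subseteq>{m \<in> fsupp. \<exists>h\<in>I. leads m h}. finite B \<and> (\<forall>m\<in>{m \<in> fsupp. \<exists>h\<in>I. leads m h}. \<exists>b\<in>B. inc_div n b m)"
    by (rule inc_div_finite_basis[OF n]) auto
  then obtain B where sub: "B \<subseteq> {m \<in> fsupp. \<exists>h\<in>I. leads m h}" and "finite B"
    and div: "\<forall>m\<in>{m \<in> fsupp. \<exists>h\<in>I. leads m h}. \<exists>b\<in>B. inc_div n b m" by (elim exE conjE)
  have B: "finite B" "\<And>b. b \<in> B \<Longrightarrow> b \<in> fsupp \<and> (\<exists>h\<in>I. leads b h)"
    "\<And>m h. m \<in> fsupp \<Longrightarrow> h \<in> I \<Longrightarrow> leads m h \<Longrightarrow> \<exists>b\<in>B. inc_div n b m"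
    using \<open>finite B\<close> sub div by (simp, blast, blast)
  have "\<forall>b\<in>B. \<exists>h Fb. h \<in> I \<and> leads b h \<and> Fb \<subseteq> F \<and> finite Fb \<and> (\<forall>a\<in>inc_zeros n Fb. h a = 0)"
  proof
    fix b assume "b \<in> B"
    then obtain h where h: "h \<in> I" "leads b h" using B(2) by blast
    then obtain Fb where "Fb \<subseteq> F" "finite Fb" "\<forall>a\<in>inc_zeros n Fb. h a = 0" unfolding I_def by blast
    then show "\<exists>h Fb. h \<in> I \<and> leads b h \<and> Fb \<subseteq> F \<and> finite Fb \<and> (\<forall>a\<in>inc_zeros n Fb. h a = 0)"
      using h by (intro exI[of _ h] exI[of _ Fb]) simp
  qed
  then obtain H FB where H: "\<And>b. b \<in> B \<Longrightarrow> H b \<in> I \<and> leads b (H b) \<and> FB b \<subseteq> F \<and> finite (FB b) \<and> (\<forall>a\<in>inc_zeros n (FB b). H b a = 0)"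
    by metis
  define F0 where "F0 = (\<Union>b\<in>B. FB b)"
  have F0: "F0 \<subseteq> F" "finite F0" using H B(1) by (auto simp: F0_def)
  have mono: "inc_zeros n F2 \<subseteq> inc_zeros n F1" if "F1 \<subseteq> F2" for F1 F2 :: "((nat \<Rightarrow> 'k) \<Rightarrow> 'k) set"
    using that by (auto simp: inc_zeros_def)
  have main: "\<forall>a\<in>inc_zeros n F0. h a = 0" if "m \<in> fsupp" "h \<in> I" "leads m h" for m h
    using that
  proof (induction m arbitrary: h rule: wf_induct_rule[OF mon_less_wf])
    case (1 m)
    obtain b where b: "b \<in> B" "inc_div n b m" using B(3) "1.prems" by blast
    obtain \<pi> where \<pi>: "strict_mono \<pi>" "\<And>v. b v \<le> m (stretch n \<pi> v)" using b(2) by (auto simp: inc_div_def)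
    let ?p = "stretch n \<pi>"
    have p: "strict_mono ?p" using n \<pi>(1) by (rule stretch_strict_mono)
    have bf: "b \<in> fsupp" using B(2) b(1) by blast
    define q where "q = (\<lambda>v. m v - push ?p b v)"
    have le: "push ?p b v \<le> m v" for v
      by (cases "v \<in> range ?p") (auto simp: push_apply[OF p] \<pi>(2) push_outside)
    have m: "m = (\<lambda>v. q v + push ?p b v)" using le by (simp add: q_def)
    have q: "q \<in> fsupp" using "1.prems"(1) unfolding fsupp_def mem_Collect_eq
      by (rule rev_finite_subset) (auto simp: q_def)
    obtain c g where c: "c \<noteq> 0" "g \<in> mon_span (below m)" "h = (\<lambda>a. c * mon m a + g a)"
      using "1.prems"(3) unfolding leads_def by blast
    obtain d g' where d: "d \<noteq> 0" "g' \<in> mon_span (below b)" "H b = (\<lambda>a. d * mon b a + g' a)"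
      using H[OF b(1)] unfolding leads_def by blast
    \<comment> \<open>the leading terms of the two summands cancel\<close>
    define r where "r a = h a + (- c / d) * (mon q a * H b (\<lambda>v. a (?p v)))" for a
    have "mon m a = mon q a * mon b (\<lambda>v. a (?p v))" for a :: "nat \<Rightarrow> 'k"
      by (subst m, subst mon_add[OF q push_fsupp[OF p bf]]) (simp add: mon_push[OF p])
    then have "r a = g a + (- c / d) * (mon q a * g' (\<lambda>v. a (?p v)))" for a
      using d(1) by (simp add: r_def c(3) d(3) field_simps)
    then have r: "r = (\<lambda>a. g a + (- c / d) * (mon q a * g' (\<lambda>v. a (?p v))))" by blast
    have "(\<lambda>a. (- c / d) * (mon q a * g' (\<lambda>v. a (?p v)))) \<in> mon_span (below m)"
    proof (rule mon_span_push[OF d(2) _ q p])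
      show "below b \<subseteq> fsupp" by (auto simp: below_def)
      fix \<mu> assume "\<mu> \<in> below b"
      then have \<mu>: "\<mu> \<in> fsupp" "mon_less \<mu> b" by (auto simp: below_def)
      have "mon_less (\<lambda>v. q v + push ?p \<mu> v) m" by (subst m) (intro mon_less_add mon_less_push p \<mu>(2))
      then show "(\<lambda>v. q v + push ?p \<mu> v) \<in> below m"
        by (simp add: below_def fsupp_add q push_fsupp p \<mu>(1))
    qed
    then have rb: "r \<in> mon_span (below m)" unfolding r by (intro mon_span_add c(2))
    obtain Fh where Fh: "Fh \<subseteq> F" "finite Fh" "\<forall>a\<in>inc_zeros n Fh. h a = 0"
      using "1.prems"(2) unfolding I_def by blast
    have "r a = 0" if "a \<in> inc_zeros n (Fh \<union> FB b)" for a
    proof -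
      have "h a = 0" using Fh(3) mono[of Fh "Fh \<union> FB b"] that by blast
      moreover have "H b (\<lambda>v. a (?p v)) = 0"
        using H[OF b(1)] mono[of "FB b" "Fh \<union> FB b"] inc_zeros_stretch[OF n _ \<pi>(1), of a "FB b"] that by blast
      ultimately show ?thesis by (simp add: r_def)
    qed
    moreover have "Fh \<union> FB b \<subseteq> F" "finite (Fh \<union> FB b)" using Fh H[OF b(1)] by auto
    moreover have "r \<in> mon_span fsupp" by (rule mon_span_mono[OF rb]) (auto simp: below_def)
    ultimately have rI: "r \<in> I" unfolding I_def by blast
    have rz: "\<forall>a\<in>inc_zeros n F0. r a = 0"
      using leads_below[OF "1.prems"(1) rb]
    proof
      assume "\<exists>m'\<in>below m. leads m' r"
      then obtain m' where "m' \<in> below m" "leads m' r" by blast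
      then show ?thesis using "1.IH"[of m' r] "1.prems"(1) rI by (auto simp: below_def)
    qed simp
    show ?case
    proof
      fix a assume a: "a \<in> inc_zeros n F0"
      have "a \<in> inc_zeros n (FB b)" using mono[of "FB b" F0] a b(1) by (auto simp: F0_def)
      then have "H b (\<lambda>v. a (?p v)) = 0" using H[OF b(1)] inc_zeros_stretch[OF n _ \<pi>(1), of a "FB b"] by blast
      then show "h a = 0" using rz a by (simp add: r_def)
    qed
  qed
  have "\<forall>a\<in>inc_zeros n F0. f a = 0" if f: "f \<in> F" for f
  proof -
    have "f \<in> mon_span fsupp" using f F by blast
    moreover have "\<exists>F0\<subseteq>F. finite F0 \<and> (\<forall>a\<in>inc_zeros n F0. f a = 0)"
      by (rule exI[of _ "{f}"]) (use f inc_zeros_contains in auto)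
    ultimately have "f \<in> I" unfolding I_def by blast
    then show ?thesis using leads_exists[OF \<open>f \<in> mon_span fsupp\<close>] main[of _ f] by auto
  qed
  then show ?thesis using F0 by blast
qed

text \<open>
  The algebra of functions generated by \<open>V\<close>.
\<close>

inductive_set polys :: "('a \<Rightarrow> 'k::field) set \<Rightarrow> ('a \<Rightarrow> 'k) set" for V where
  const: "(\<lambda>a. c) \<in> polys V"
| gen: "f \<in> V \<Longrightarrow> f \<in> polys V"
| add: "f \<in> polys V \<Longrightarrow> g \<in> polys V \<Longrightarrow> (\<lambda>a. f a + g a) \<in> polys V"
| mult: "f \<in> polys V \<Longrightarrow> g \<in> polys V \<Longrightarrow> (\<lambda>a. f a * g a) \<in> polys V"

text \<open>
  Polynomial dependence needs to be checked on generators only. The two maps \<open>s\<close> and \<open>r\<close> cover both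
  the action of a group and a change of coordinates.
\<close>

lemma polys_pullback:
  assumes "f \<in> polys V" and gen: "\<And>v. v \<in> V \<Longrightarrow> \<exists>h\<in>polys W. \<forall>b\<in>B. v (s b) = h (r b)"
  shows "\<exists>h\<in>polys W. \<forall>b\<in>B. f (s b) = h (r b)"
  using assms(1)
proof (induction f rule: polys.induct)
  case (const c)
  then show ?case by (intro bexI[of _ "\<lambda>_. c"]) (auto intro: polys.intros)
next
  case (gen f)
  then show ?case by (rule assms(2))
next
  case (add f g)
  then obtain f' g' where "f' \<in> polys W" "\<forall>b\<in>B. f (s b) = f' (r b)" "g' \<in> polys W" "\<forall>b\<in>B. g (s b) = g' (r b)" by blast
  then show ?case by (intro bexI[of _ "\<lambda>b. f' b + g' b"]) (auto intro: polys.intros)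
next
  case (mult f g)
  then obtain f' g' where "f' \<in> polys W" "\<forall>b\<in>B. f (s b) = f' (r b)" "g' \<in> polys W" "\<forall>b\<in>B. g (s b) = g' (r b)" by blast
  then show ?case by (intro bexI[of _ "\<lambda>b. f' b * g' b"]) (auto intro: polys.intros)
qed

lemma polys_mspan: "f \<in> polys (range (\<lambda>v a. a v)) \<Longrightarrow> f \<in> mon_span fsupp"
proof (induction f rule: polys.induct)
  case (const c)
  have "(\<lambda>a. c * mon (\<lambda>v. 0) a :: 'a) \<in> mon_span fsupp" by (rule mon_span_mon) (simp add: fsupp_def)
  then show ?case by (simp add: mon_def)
next
  case (gen f)
  then obtain v where f: "f = (\<lambda>a. a v)" by blast
  have "(\<lambda>a. 1 * mon (\<lambda>w. if w = v then 1 else 0) a :: 'a) \<in> mon_span fsupp"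
    by (rule mon_span_mon) (simp add: fsupp_def)
  moreover have "mon (\<lambda>w. if w = v then 1 else 0) a = a v" for a :: "nat \<Rightarrow> 'a"
    by (subst mon_superset[of "{v}"]) auto
  ultimately show ?case by (simp add: f)
qed (auto intro: mon_span_add mon_span_mult)

text \<open>
  The theorem of Cohen, for zero sets: \<open>inc_noetherian\<close> after numbering the elements of \<open>C\<close>.
\<close>

theorem polys_noetherian:
  fixes F :: "((nat \<Rightarrow> 'c \<Rightarrow> 'k::field) \<Rightarrow> 'k) set"
  assumes C: "finite C" "C \<noteq> {}" and F: "F \<subseteq> polys {(\<lambda>a. a j c) | j c. c \<in> C}"
  shows "\<exists>F0\<subseteq>F. finite F0 \<and> (\<forall>a. (\<forall>f\<in>F0. \<forall>\<pi> :: nat \<Rightarrow> nat. strict_mono \<pi> \<longrightarrow> f (a \<circ> \<pi>) = 0) \<longrightarrow> (\<forall>f\<in>F. f a = 0))"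
proof -
  let ?n = "card C"
  have n: "?n > 0" using C by (simp add: card_gt_0_iff)
  obtain e where e: "bij_betw e {..<?n} C"
    using ex_bij_betw_nat_finite[OF C(1)] by (auto simp: atLeast0LessThan)
  define flat where "flat a v = a (v div ?n) (e (v mod ?n))" for a :: "nat \<Rightarrow> 'c \<Rightarrow> 'k" and v
  have ex: "\<exists>f'\<in>mon_span fsupp. \<forall>a. f a = f' (flat a)" if "f \<in> polys {(\<lambda>a. a j c) | j c. c \<in> C}" for f
  proof -
    have "\<exists>f'\<in>polys (range (\<lambda>v a. a v)). \<forall>a\<in>UNIV. f a = f' (flat a)" using that
    proof (rule polys_pullback)
      fix f :: "(nat \<Rightarrow> 'c \<Rightarrow> 'k) \<Rightarrow> 'k" assume "f \<in> {(\<lambda>a. a j c) | j c. c \<in> C}"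
      then obtain j c where f: "f = (\<lambda>a. a j c)" "c \<in> C" by blast
      then have "c \<in> e ` {..<?n}" using e by (simp add: bij_betw_def)
      then obtain i where i: "i < ?n" "e i = c" by blast
      show "\<exists>f'\<in>polys (range (\<lambda>v a. a v)). \<forall>a\<in>UNIV. f a = f' (flat a)"
        by (rule bexI[of _ "\<lambda>a. a (?n * j + i)"]) (use i f in \<open>auto simp: flat_def intro!: polys.gen\<close>)
    qed
    then show ?thesis using polys_mspan by blast
  qed
  have "\<forall>f\<in>F. \<exists>f'. f' \<in> mon_span fsupp \<and> (\<forall>a. f a = f' (flat a))"
    using ex F by (meson subsetD)
  then obtain \<phi> where "\<forall>f\<in>F. \<phi> f \<in> mon_span fsupp \<and> (\<forall>a. f a = \<phi> f (flat a))"
    by (elim bchoice[THEN exE])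
  then have \<phi>: "\<phi> f \<in> mon_span fsupp \<and> (\<forall>a. f a = \<phi> f (flat a))" if "f \<in> F" for f
    using that by blast
  have "\<phi> ` F \<subseteq> mon_span fsupp" using \<phi> by blast
  from inc_noetherian[OF n this]
  obtain G where G: "G \<subseteq> \<phi> ` F" "finite G" "\<forall>a\<in>inc_zeros ?n G. \<forall>f\<in>\<phi> ` F. f a = 0"
    by (elim exE conjE)
  obtain F0 where F0: "F0 \<subseteq> F" "finite F0" "G = \<phi> ` F0" using finite_subset_image[OF G(2,1)] by blast
  have "f a = 0" if a: "\<forall>f\<in>F0. \<forall>\<pi> :: nat \<Rightarrow> nat. strict_mono \<pi> \<longrightarrow> f (a \<circ> \<pi>) = 0" and f: "f \<in> F" for a f
  proof -
    have "flat a \<in> inc_zeros ?n G" unfolding inc_zeros_def F0(3)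
    proof (intro CollectI ballI allI impI)
      fix g \<pi> assume "g \<in> \<phi> ` F0" and \<pi>: "strict_mono (\<pi> :: nat \<Rightarrow> nat)"
      then obtain h where h: "h \<in> F0" "g = \<phi> h" by blast
      have "(\<lambda>v. flat a (stretch ?n \<pi> v)) = flat (a \<circ> \<pi>)"
        using stretch_div_mod[OF n] by (simp add: flat_def fun_eq_iff)
      moreover have "h (a \<circ> \<pi>) = 0" using a h(1) \<pi> by blast
      moreover have "h (a \<circ> \<pi>) = \<phi> h (flat (a \<circ> \<pi>))" using \<phi>[of h] h(1) F0(1) by blast
      ultimately show "g (\<lambda>v. flat a (stretch ?n \<pi> v)) = 0" by (simp add: h(2))
    qed
    then show ?thesis using G(3) \<phi>[OF f] f by auto
  qed
  then show ?thesis using F0 by blast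
qed

section \<open>Minors\<close>

definition minor :: "nat \<Rightarrow> (nat \<Rightarrow> nat \<Rightarrow> 'k::field) \<Rightarrow> 'k" where
  "minor r M = det (mat r r (\<lambda>(i, j). M i j))"

lemma minor_cong: "(\<And>i j. i < r \<Longrightarrow> j < r \<Longrightarrow> M i j = M' i j) \<Longrightarrow> minor r M = minor r M'"
  unfolding minor_def by (rule arg_cong[of _ _ det]) (auto intro!: cong_mat)

lemma minor_transpose: "minor r (\<lambda>i j. M j i) = minor r M"
proof -
  have "mat r r (\<lambda>(i, j). M j i) = transpose_mat (mat r r (\<lambda>(i, j). M i j))" by (rule eq_matI) auto
  then show ?thesis unfolding minor_def by (simp add: det_transpose[of _ r])
qed

lemma minor_leibniz:
  "minor r M = (\<Sum>\<sigma> | \<sigma> permutes {0..<r}. signof \<sigma> * (\<Prod>i = 0..<r. M i (\<sigma> i)))"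
  unfolding minor_def
  by (subst det_def'[of _ r]) (auto intro!: sum.cong prod.cong simp: permutes_in_image)

lemma minor_zero_iff:
  "minor r M = 0 \<longleftrightarrow> (\<exists>v. (\<exists>j<r. v j \<noteq> 0) \<and> (\<forall>i<r. (\<Sum>j<r. M i j * v j) = 0))"
proof -
  let ?A = "mat r r (\<lambda>(i, j). M i j)"
  have row: "(?A *\<^sub>v w) $ i = (\<Sum>j<r. M i j * w $ j)" if "w \<in> carrier_vec r" "i < r" for w i
    using that by (auto simp: scalar_prod_def atLeast0LessThan intro!: sum.cong)
  have "minor r M = 0 \<longleftrightarrow> (\<exists>w. w \<in> carrier_vec r \<and> w \<noteq> 0\<^sub>v r \<and> ?A *\<^sub>v w = 0\<^sub>v r)"
    unfolding minor_def by (rule det_0_iff_vec_prod_zero_field) simp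
  also have "\<dots> \<longleftrightarrow> (\<exists>v. (\<exists>j<r. v j \<noteq> 0) \<and> (\<forall>i<r. (\<Sum>j<r. M i j * v j) = 0))"
  proof
    assume "\<exists>w. w \<in> carrier_vec r \<and> w \<noteq> 0\<^sub>v r \<and> ?A *\<^sub>v w = 0\<^sub>v r"
    then obtain w where w: "w \<in> carrier_vec r" "w \<noteq> 0\<^sub>v r" "?A *\<^sub>v w = 0\<^sub>v r" by blast
    have "\<exists>j<r. w $ j \<noteq> 0" using w(1,2) by (metis carrier_vecD eq_vecI index_zero_vec)
    moreover have "(\<Sum>j<r. M i j * w $ j) = 0" if "i < r" for i
      using row[OF w(1) that] w(3) that by simp
    ultimately show "\<exists>v. (\<exists>j<r. v j \<noteq> 0) \<and> (\<forall>i<r. (\<Sum>j<r. M i j * v j) = 0)" by blast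
  next
    assume "\<exists>v. (\<exists>j<r. v j \<noteq> 0) \<and> (\<forall>i<r. (\<Sum>j<r. M i j * v j) = 0)"
    then obtain v j where v: "j < r" "v j \<noteq> 0" "\<And>i. i < r \<Longrightarrow> (\<Sum>j<r. M i j * v j) = 0" by blast
    let ?w = "vec r v"
    have "?w $ j \<noteq> 0\<^sub>v r $ j" using v by simp
    then have "?w \<noteq> 0\<^sub>v r" by metis
    moreover have "?A *\<^sub>v ?w = 0\<^sub>v r"
      by (rule eq_vecI) (auto simp: scalar_prod_def atLeast0LessThan v(3) intro!: trans[OF sum.cong v(3)])
    ultimately show "\<exists>w. w \<in> carrier_vec r \<and> w \<noteq> 0\<^sub>v r \<and> ?A *\<^sub>v w = 0\<^sub>v r"
      by (intro exI[of _ ?w]) simp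
  qed
  finally show ?thesis .
qed

definition left_inverse :: "nat \<Rightarrow> (nat \<Rightarrow> nat \<Rightarrow> 'k::field) \<Rightarrow> (nat \<Rightarrow> nat \<Rightarrow> 'k) \<Rightarrow> bool" where
  "left_inverse r N M \<longleftrightarrow> (\<forall>i<r. \<forall>j<r. (\<Sum>l<r. N i l * M l j) = (if i = j then 1 else 0))"

lemma left_inverse_exists:
  assumes "minor r M \<noteq> 0" shows "\<exists>N. left_inverse r N M"
proof -
  let ?A = "mat r r (\<lambda>(i, j). M i j)"
  have adj: "adj_mat ?A \<in> carrier_mat r r" "adj_mat ?A * ?A = det ?A \<cdot>\<^sub>m 1\<^sub>m r" using adj_mat[of ?A r] by auto
  define N where "N i l = adj_mat ?A $$ (i, l) / det ?A" for i l
  have "(\<Sum>l<r. N i l * M l j) = (if i = j then 1 else 0)" if ij: "i < r" "j < r" for i j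
  proof -
    have "(\<Sum>l<r. adj_mat ?A $$ (i, l) * M l j) = (adj_mat ?A * ?A) $$ (i, j)"
      using ij adj(1) by (auto simp: scalar_prod_def atLeast0LessThan intro!: sum.cong)
    also have "\<dots> = (if i = j then det ?A else 0)" using ij by (simp add: adj(2))
    finally have "(\<Sum>l<r. adj_mat ?A $$ (i, l) * M l j) / det ?A = (if i = j then 1 else 0)"
      using assms by (simp add: minor_def)
    then show ?thesis by (simp add: N_def sum_divide_distrib)
  qed
  then show ?thesis unfolding left_inverse_def by blast
qed

text \<open>
  A matrix that factors through dimension \<open>r < k\<close> is singular: pad the second factor with zero rows to
  a \<open>k \<times> k\<close> matrix, which has a kernel because of the zero row \<open>r\<close>.
\<close>

lemma minor_factor_zero:
  assumes "r < k" "\<And>i j. i < k \<Longrightarrow> j < k \<Longrightarrow> M i j = (\<Sum>s<r. A i s * B s j)"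
  shows "minor k M = 0"
proof -
  define B' where "B' s j = (if s < r then B s j else 0)" for s j
  have "minor k (\<lambda>i j. B' j i) = 0" unfolding minor_zero_iff
    by (rule exI[of _ "\<lambda>j. if j = r then 1 else 0"])
       (use assms(1) in \<open>auto simp: B'_def if_distrib[of "\<lambda>x. _ * x"] sum.delta cong: if_cong\<close>)
  then have "minor k B' = 0" using minor_transpose[of k B'] by simp
  then obtain v j where v: "j < k" "v j \<noteq> 0" "\<And>i. i < k \<Longrightarrow> (\<Sum>j<k. B' i j * v j) = 0"
    unfolding minor_zero_iff by blast
  have "(\<Sum>j<k. M i j * v j) = 0" if i: "i < k" for i
  proof -
    have "(\<Sum>j<k. M i j * v j) = (\<Sum>j<k. \<Sum>s<r. A i s * (B' s j * v j))"
      using i by (auto simp: assms(2) sum_distrib_right B'_def mult.assoc intro!: sum.cong)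
    also have "\<dots> = (\<Sum>s<r. A i s * (\<Sum>j<k. B' s j * v j))"
      by (subst sum.swap) (simp add: sum_distrib_left)
    finally show ?thesis using v(3) assms(1) by simp
  qed
  then show ?thesis unfolding minor_zero_iff using v(1,2) by blast
qed

text \<open>
  A kernel vector of the bordered matrix has a nonzero last entry, because the block has no kernel, so
  the last column is a combination of the others. Applying \<open>N\<close> to the first \<open>r\<close> rows yields the coefficients.
\<close>

lemma bordered_minor_zero:
  assumes N: "left_inverse r N M" and z: "minor (Suc r) M = 0" and i: "i \<le> r"
  shows "M i r = (\<Sum>j<r. (\<Sum>l<r. N j l * M l r) * M i j)"
proof -
  obtain v j0 where v: "j0 < Suc r" "v j0 \<noteq> 0" "\<And>i. i < Suc r \<Longrightarrow> (\<Sum>j<Suc r. M i j * v j) = 0"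
    using z unfolding minor_zero_iff by blast
  have vj: "v j = - (\<Sum>l<r. N j l * M l r) * v r" if j: "j < r" for j
  proof -
    have "v j = (\<Sum>j'<r. if j = j' then v j' else 0)" using j by simp
    also have "\<dots> = (\<Sum>j'<r. (if j = j' then 1 else 0) * v j')" by (intro sum.cong) auto
    also have "\<dots> = (\<Sum>j'<r. (\<Sum>l<r. N j l * M l j') * v j')"
      using N j by (auto simp: left_inverse_def intro!: sum.cong)
    also have "\<dots> = (\<Sum>l<r. N j l * (\<Sum>j'<r. M l j' * v j'))"
      by (simp add: sum_distrib_right sum_distrib_left mult.assoc, subst sum.swap, simp)
    also have "\<dots> = (\<Sum>l<r. N j l * - (M l r * v r))"
    proof (intro sum.cong refl arg_cong2[of _ _ _ _ "(*)"])
      fix l assume "l \<in> {..<r}"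
      then have "(\<Sum>j'<r. M l j' * v j') + M l r * v r = 0" using v(3)[of l] by simp
      then show "(\<Sum>j'<r. M l j' * v j') = - (M l r * v r)" by (simp add: eq_neg_iff_add_eq_0)
    qed
    finally show ?thesis by (simp add: sum_negf sum_distrib_right mult.assoc)
  qed
  have vr: "v r \<noteq> 0"
  proof
    assume "v r = 0"
    then have "v j = 0" if "j < Suc r" for j using vj[of j] that by (cases "j = r") auto
    then show False using v by blast
  qed
  have "(\<Sum>j<r. M i j * v j) + M i r * v r = 0" using v(3)[of i] i by simp
  then have "M i r * v r = - (\<Sum>j<r. M i j * v j)" by (simp add: eq_neg_iff_add_eq_0 add.commute)
  also have "\<dots> = (\<Sum>j<r. (\<Sum>l<r. N j l * M l r) * M i j) * v r"
  proof -
    define c where "c j = (\<Sum>l<r. N j l * M l r)" for j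
    have "(\<Sum>j<r. M i j * v j) = (\<Sum>j<r. - (c j * M i j * v r))"
      by (intro sum.cong) (auto simp: vj c_def[symmetric])
    then show ?thesis by (simp add: c_def[symmetric] sum_negf sum_distrib_right)
  qed
  finally show ?thesis using vr by simp
qed

text \<open>
  The minor is a polynomial in \<open>s\<close> that does not vanish at \<open>0\<close>.
\<close>

lemma minor_perturb:
  assumes "minor r M \<noteq> 0" shows "finite {s. minor r (\<lambda>i j. M i j + s * M' i j) = 0}"
proof -
  define p where "p = det (mat r r (\<lambda>(i, j). [:M i j, M' i j:]))"
  have p: "poly p s = minor r (\<lambda>i j. M i j + s * M' i j)" for s
  proof -
    interpret comm_ring_hom "\<lambda>p. poly p s" by unfold_locales auto
    have "poly p s = det (map_mat (\<lambda>p. poly p s) (mat r r (\<lambda>(i, j). [:M i j, M' i j:])))"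
      unfolding p_def by (rule hom_det[symmetric])
    also have "map_mat (\<lambda>p. poly p s) (mat r r (\<lambda>(i, j). [:M i j, M' i j:])) = mat r r (\<lambda>(i, j). M i j + s * M' i j)"
      by (rule eq_matI) auto
    finally show ?thesis by (simp add: minor_def)
  qed
  have "poly p 0 \<noteq> 0" using assms by (simp add: p)
  then have "p \<noteq> 0" by auto
  then show ?thesis using poly_roots_finite[of p] by (simp add: p)
qed

lemma minor_row_sum:
  fixes c :: "'x \<Rightarrow> 'k::field"
  assumes "a < r" "finite X"
  shows "minor r (\<lambda>i j. if i = a then (\<Sum>x\<in>X. c x * R x j) else M i j)
    = (\<Sum>x\<in>X. c x * minor r (\<lambda>i j. if i = a then R x j else M i j))"
proof -
  have split: "(\<Prod>i = 0..<r. if i = a then g i else h i) = g a * (\<Prod>i \<in> {0..<r} - {a}. h i)" for g h :: "nat \<Rightarrow> 'k"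
    using assms(1) by (subst prod.remove[of _ a]) auto
  have "minor r (\<lambda>i j. if i = a then (\<Sum>x\<in>X. c x * R x j) else M i j)
     = (\<Sum>\<sigma> | \<sigma> permutes {0..<r}. \<Sum>x\<in>X. c x * (signof \<sigma> * (R x (\<sigma> a) * (\<Prod>i \<in> {0..<r} - {a}. M i (\<sigma> i)))))"
    unfolding minor_leibniz split by (simp add: sum_distrib_left sum_distrib_right mult_ac)
  also have "\<dots> = (\<Sum>x\<in>X. c x * minor r (\<lambda>i j. if i = a then R x j else M i j))"
    unfolding minor_leibniz split by (subst sum.swap) (simp add: sum_distrib_left)
  finally show ?thesis .
qed

lemma minor_row_replace:
  assumes "a < r" "finite X" "\<And>j. j < r \<Longrightarrow> M a j = (\<Sum>x\<in>X. c x * R x j)" "minor r M \<noteq> 0"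
  shows "\<exists>x\<in>X. minor r (\<lambda>i j. if i = a then R x j else M i j) \<noteq> 0"
proof (rule ccontr)
  assume "\<not> ?thesis"
  then have "minor r (\<lambda>i j. if i = a then (\<Sum>x\<in>X. c x * R x j) else M i j) = 0"
    unfolding minor_row_sum[OF assms(1,2)] by (intro sum.neutral) auto
  moreover have "minor r (\<lambda>i j. if i = a then (\<Sum>x\<in>X. c x * R x j) else M i j) = minor r M"
    by (rule minor_cong) (use assms(3) in auto)
  ultimately show False using assms(4) by simp
qed

section \<open>Multilinear forms and their flattenings\<close>

text \<open>
  The sequences at which a form of infinitely many arguments is evaluated.
\<close>

definition adm :: "'v \<Rightarrow> (nat \<Rightarrow> 'v) \<Rightarrow> bool" where
  "adm \<xi> y \<longleftrightarrow> finite {i. y i \<noteq> \<xi>}"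

lemma adm_const [simp]: "adm \<xi> (\<lambda>_. \<xi>)"
  by (simp add: adm_def)

lemma adm_upd [simp]: "adm \<xi> y \<Longrightarrow> adm \<xi> (y(i := v))"
  unfolding adm_def by (rule finite_subset[of _ "insert i {i. y i \<noteq> \<xi>}"]) auto

definition mix :: "nat set \<Rightarrow> (nat \<Rightarrow> 'v) \<Rightarrow> (nat \<Rightarrow> 'v) \<Rightarrow> nat \<Rightarrow> 'v" where
  "mix I y z = (\<lambda>i. if i \<in> I then y i else z i)"

lemma adm_mix [simp]: "adm \<xi> y \<Longrightarrow> adm \<xi> z \<Longrightarrow> adm \<xi> (mix I y z)"
  unfolding adm_def mix_def by (rule finite_subset[of _ "{i. y i \<noteq> \<xi>} \<union> {i. z i \<noteq> \<xi>}"]) auto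

lemma mix_upd_left: "i \<in> I \<Longrightarrow> mix I (y(i := v)) z = (mix I y z)(i := v)"
  and mix_upd_left': "i \<notin> I \<Longrightarrow> mix I (y(i := v)) z = mix I y z"
  and mix_upd_right: "i \<notin> I \<Longrightarrow> mix I y (z(i := v)) = (mix I y z)(i := v)"
  and mix_upd_right': "i \<in> I \<Longrightarrow> mix I y (z(i := v)) = mix I y z"
  by (auto simp: mix_def)

lemma mix_Compl: "mix (- I) z y = mix I y z"
  by (auto simp: mix_def)

type_synonym ('k, 'n) form = "(nat \<Rightarrow> 'k ^ 'n) \<Rightarrow> 'k"

definition multilin :: "'k ^ 'n \<Rightarrow> ('k::field, 'n::finite) form \<Rightarrow> bool" where
  "multilin \<xi> \<Omega> \<longleftrightarrow> (\<forall>y i u v c. adm \<xi> y \<longrightarrow>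
     \<Omega> (y(i := c *s u + v)) = c * \<Omega> (y(i := u)) + \<Omega> (y(i := v)))"

lemma multilinD:
  "multilin \<xi> \<Omega> \<Longrightarrow> adm \<xi> y \<Longrightarrow> \<Omega> (y(i := c *s u + v)) = c * \<Omega> (y(i := u)) + \<Omega> (y(i := v))"
  unfolding multilin_def by blast

lemma multilin_zero:
  assumes "multilin \<xi> \<Omega>" "adm \<xi> y" shows "\<Omega> (y(i := 0)) = 0"
proof -
  have "\<Omega> (y(i := 0)) = \<Omega> (y(i := 0)) + \<Omega> (y(i := 0))"
    using multilinD[OF assms, of i 1 0 0] by (simp del: fun_upd_apply)
  then show ?thesis by (simp only: add_cancel_right_right)
qed

lemma multilin_sum:
  assumes "multilin \<xi> \<Omega>" "adm \<xi> y" "finite X"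
  shows "\<Omega> (y(i := (\<Sum>x\<in>X. c x *s b x))) = (\<Sum>x\<in>X. c x * \<Omega> (y(i := b x)))"
  using assms(3)
proof (induction X rule: finite_induct)
  case empty
  show ?case using multilin_zero[OF assms(1,2)] by (simp del: fun_upd_apply)
next
  case (insert x X)
  then show ?case using multilinD[OF assms(1,2), of i "c x" "b x"] by (simp del: fun_upd_apply)
qed

text \<open>
  A minor of the flattening of \<open>\<Omega>\<close> along \<open>I\<close>, a matrix whose rows and columns are both indexed by all
  sequences.
\<close>

definition flattening_minor :: "('k::field, 'n::finite) form \<Rightarrow> nat \<Rightarrow> nat set \<Rightarrow>
    (nat \<Rightarrow> nat \<Rightarrow> 'k ^ 'n) \<Rightarrow> (nat \<Rightarrow> nat \<Rightarrow> 'k ^ 'n) \<Rightarrow> 'k" where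
  "flattening_minor \<Omega> k I ys zs = minor k (\<lambda>a b. \<Omega> (mix I (ys a) (zs b)))"

lemma flattening_minor_Compl: "flattening_minor \<Omega> k (- I) zs ys = flattening_minor \<Omega> k I ys zs"
  unfolding flattening_minor_def mix_Compl by (rule minor_transpose)

section \<open>Concentrating a minor in few positions\<close>

text \<open>
  An \<open>r\<close>-minor with rows in \<open>Y\<close> whose columns agree, with value \<open>\<eta>\<close>, outside a set \<open>D\<close> of at most \<open>r\<close>
  positions. It is required that \<open>\<eta>\<close> has no zero, so that it can be moved to \<open>\<xi>\<close> by the group.
\<close>

definition config :: "'k ^ 'n \<Rightarrow> ('k::field, 'n::finite) form \<Rightarrow> nat set \<Rightarrow> (nat \<Rightarrow> 'k ^ 'n) set \<Rightarrow> nat \<Rightarrow>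
    nat set \<Rightarrow> (nat \<Rightarrow> 'k ^ 'n) \<Rightarrow> (nat \<Rightarrow> nat \<Rightarrow> 'k ^ 'n) \<Rightarrow> (nat \<Rightarrow> nat \<Rightarrow> 'k ^ 'n) \<Rightarrow> bool" where
  "config \<xi> \<Omega> I Y r D \<eta> ys zs \<longleftrightarrow> finite D \<and> card D \<le> r \<and> adm \<xi> \<eta> \<and> (\<forall>i. \<eta> i \<noteq> 0) \<and>
     (\<forall>a<r. ys a \<in> Y) \<and> (\<forall>b<r. adm \<xi> (zs b) \<and> (\<forall>i. i \<notin> D \<longrightarrow> zs b i = \<eta> i)) \<and>
     flattening_minor \<Omega> r I ys zs \<noteq> 0"

definition in_span :: "('k::field, 'n::finite) form \<Rightarrow> nat set \<Rightarrow> (nat \<Rightarrow> 'k ^ 'n) set \<Rightarrow> nat \<Rightarrow>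
    (nat \<Rightarrow> nat \<Rightarrow> 'k ^ 'n) \<Rightarrow> (nat \<Rightarrow> 'k ^ 'n) \<Rightarrow> bool" where
  "in_span \<Omega> I Y r zs z \<longleftrightarrow> (\<exists>c. \<forall>y\<in>Y. \<Omega> (mix I y z) = (\<Sum>j<r. c j * \<Omega> (mix I y (zs j))))"

lemma in_span_trans:
  assumes "in_span \<Omega> I Y r zs' z" "\<And>j. j < r \<Longrightarrow> in_span \<Omega> I Y r zs (zs' j)"
  shows "in_span \<Omega> I Y r zs z"
proof -
  obtain c where c: "\<And>y. y \<in> Y \<Longrightarrow> \<Omega> (mix I y z) = (\<Sum>j<r. c j * \<Omega> (mix I y (zs' j)))"
    using assms(1) unfolding in_span_def by blast
  have "\<forall>j\<in>{..<r}. \<exists>d. \<forall>y\<in>Y. \<Omega> (mix I y (zs' j)) = (\<Sum>l<r. d l * \<Omega> (mix I y (zs l)))"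
    using assms(2) unfolding in_span_def by simp
  from bchoice[OF this]
  obtain d where d: "\<forall>j\<in>{..<r}. \<forall>y\<in>Y. \<Omega> (mix I y (zs' j)) = (\<Sum>l<r. d j l * \<Omega> (mix I y (zs l)))" ..
  have "\<Omega> (mix I y z) = (\<Sum>l<r. (\<Sum>j<r. c j * d j l) * \<Omega> (mix I y (zs l)))" if "y \<in> Y" for y
  proof -
    have "\<Omega> (mix I y z) = (\<Sum>j<r. c j * (\<Sum>l<r. d j l * \<Omega> (mix I y (zs l))))"
      unfolding c[OF that] using d that by (intro sum.cong) auto
    also have "\<dots> = (\<Sum>l<r. (\<Sum>j<r. c j * d j l) * \<Omega> (mix I y (zs l)))"
      by (simp add: sum_distrib_left sum_distrib_right mult.assoc) (rule sum.swap)
    finally show ?thesis .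
  qed
  then show ?thesis unfolding in_span_def by (intro exI[of _ "\<lambda>l. \<Sum>j<r. c j * d j l"]) simp
qed

text \<open>
  If \<open>z\<close> differs from \<open>\<eta>\<close> in only one position outside \<open>D\<close> and any row \<open>y\<close> gave a nonzero bordered
  minor, then bordering by \<open>y\<close> and \<open>z\<close> would be a configuration of size \<open>r + 1\<close>.
\<close>

lemma in_span_one_more:
  assumes cfg: "config \<xi> \<Omega> I Y r D \<eta> ys zs"
    and max: "\<And>D \<eta> ys zs. \<not> config \<xi> \<Omega> I Y (Suc r) D \<eta> ys zs"
    and z: "adm \<xi> z" "\<And>i. i \<notin> insert i0 D \<Longrightarrow> z i = \<eta> i"
  shows "in_span \<Omega> I Y r zs z"
proof -
  obtain N where N: "left_inverse r N (\<lambda>a b. \<Omega> (mix I (ys a) (zs b)))"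
    using left_inverse_exists cfg unfolding config_def flattening_minor_def by blast
  have "\<Omega> (mix I y z) = (\<Sum>j<r. (\<Sum>l<r. N j l * \<Omega> (mix I (ys l) z)) * \<Omega> (mix I y (zs j)))" if y: "y \<in> Y" for y
  proof -
    let ?M = "\<lambda>a b. \<Omega> (mix I ((ys(r := y)) a) ((zs(r := z)) b))"
    have N': "left_inverse r N ?M" using N by (simp add: left_inverse_def)
    have card: "card (insert i0 D) \<le> Suc r"
      using cfg card_insert_le_m1[of "Suc r" D i0] by (simp add: config_def)
    have rows: "(ys(r := y)) a \<in> Y" if "a < Suc r" for a
      using that cfg y by (cases "a = r") (simp_all add: config_def)
    have cols: "adm \<xi> ((zs(r := z)) b) \<and> (\<forall>i. i \<notin> insert i0 D \<longrightarrow> (zs(r := z)) b i = \<eta> i)"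
      if "b < Suc r" for b
      using that cfg z by (cases "b = r") (simp_all add: config_def)
    have "flattening_minor \<Omega> (Suc r) I (ys(r := y)) (zs(r := z)) = 0"
    proof (rule ccontr)
      assume "flattening_minor \<Omega> (Suc r) I (ys(r := y)) (zs(r := z)) \<noteq> 0"
      then have "config \<xi> \<Omega> I Y (Suc r) (insert i0 D) \<eta> (ys(r := y)) (zs(r := z))"
        using cfg card rows cols unfolding config_def by (simp del: fun_upd_apply)
      then show False using max by blast
    qed
    then have "minor (Suc r) ?M = 0" by (simp only: flattening_minor_def)
    from bordered_minor_zero[OF N' this, of r] show ?thesis by simp
  qed
  then show ?thesis unfolding in_span_def by (intro exI[of _ "\<lambda>j. \<Sum>l<r. N j l * \<Omega> (mix I (ys l) z)"]) simp
qed

lemma finite_affine_zero: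
  fixes u v :: "'k::field ^ 'n::finite"
  assumes "u \<noteq> 0" shows "finite {s. u + s *s v = 0}"
proof -
  obtain t where t: "vec_nth u t \<noteq> 0" using assms by (auto simp: Finite_Cartesian_Product.vec_eq_iff)
  have "\<forall>s\<in>{s. u + s *s v = 0}. s = - (vec_nth u t) / (vec_nth v t)"
  proof
    fix s assume "s \<in> {s. u + s *s v = 0}"
    then have that: "u + s *s v = 0" by simp
    have eq: "vec_nth u t + s * vec_nth v t = 0"
      using arg_cong[OF that, of "\<lambda>w. vec_nth w t"] by simp
    then have "vec_nth v t \<noteq> 0" using t by auto
    then show "s = - (vec_nth u t) / (vec_nth v t)" using eq by (simp add: field_simps eq_neg_iff_add_eq_0)
  qed
  then have "{s. u + s *s v = 0} \<subseteq> {- (vec_nth u t) / (vec_nth v t)}"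
    by (intro subsetI) (simp only: singleton_iff)
  then show ?thesis by (rule finite_subset) simp
qed

text \<open>
  Induction on the set \<open>R\<close> of further positions where \<open>z\<close> may differ from \<open>\<eta>\<close>. To free position \<open>i\<close>, replace
  the value \<open>\<eta> i\<close> by \<open>\<eta> i + s * z i\<close> in \<open>\<eta>\<close> and in the columns of the configuration. For all but
  finitely many \<open>s\<close> this is again a configuration of size \<open>r\<close>, and its columns are in the span of the
  old ones, since they differ from \<open>\<eta>\<close> in one position outside \<open>D\<close>. So by induction \<open>z\<close> with
  either value at position \<open>i\<close> gives a column in this span, and the difference of the two is \<open>s\<close> times the column of \<open>z\<close>.
\<close>

lemma in_span_all:
  fixes \<Omega> :: "('k::field, 'n::finite) form"
  assumes inf: "infinite (UNIV :: 'k set)" and ml: "multilin \<xi> \<Omega>" and Y: "\<And>y. y \<in> Y \<Longrightarrow> adm \<xi> y"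
    and max: "\<And>D \<eta> ys zs. \<not> config \<xi> \<Omega> I Y (Suc r) D \<eta> ys zs"
    and "finite R" "config \<xi> \<Omega> I Y r D \<eta> ys zs" "adm \<xi> z" "\<And>i. i \<notin> D \<union> R \<Longrightarrow> z i = \<eta> i"
  shows "in_span \<Omega> I Y r zs z"
  using assms(5-)
proof (induction R arbitrary: \<eta> zs z rule: finite_induct)
  case empty
  show ?case by (rule in_span_one_more[OF empty.prems(1) max empty.prems(2), of 0]) (use empty.prems(3) in auto)
next
  case (insert i R)
  note cfg = insert.prems(1)
  consider "i \<in> D" | "i \<in> I" | "i \<notin> D" "i \<notin> I" by blast
  then show ?case
  proof cases
    case 1
    then show ?thesis using insert.IH[OF cfg insert.prems(2)] insert.prems(3) by blast
  next
    case 2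
    have "in_span \<Omega> I Y r zs (z(i := \<eta> i))"
      by (rule insert.IH[OF cfg adm_upd[OF insert.prems(2)]]) (use insert.prems(3) in auto)
    then show ?thesis using 2 by (simp add: in_span_def mix_upd_right')
  next
    case 3
    let ?M = "\<lambda>a b. \<Omega> (mix I (ys a) (zs b))" and ?M' = "\<lambda>a b. \<Omega> (mix I (ys a) ((zs b)(i := z i)))"
    let ?bad = "{s. minor r (\<lambda>a b. ?M a b + s * ?M' a b) = 0} \<union> {0} \<union> {s. \<eta> i + s *s z i = 0}"
    have fin: "finite ?bad" using cfg minor_perturb[of r ?M ?M'] finite_affine_zero[of "\<eta> i" "z i"]
      by (auto simp: config_def flattening_minor_def)
    obtain s where s: "s \<notin> ?bad" using ex_new_if_finite[OF inf fin] by (rule exE)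
    define v where "v = s *s z i + \<eta> i"
    define zs' where "zs' b = (zs b)(i := v)" for b
    have upd: "\<Omega> (mix I y (x(i := v))) = s * \<Omega> (mix I y (x(i := z i))) + \<Omega> (mix I y (x(i := \<eta> i)))"
      if "y \<in> Y" "adm \<xi> x" for x y
      unfolding v_def mix_upd_right[OF 3(2)] by (rule multilinD[OF ml]) (use that Y in simp)
    have zsi: "(zs b)(i := \<eta> i) = zs b" if "b < r" for b using cfg 3(1) that by (auto simp: config_def)
    have "flattening_minor \<Omega> r I ys zs' = minor r (\<lambda>a b. ?M a b + s * ?M' a b)"
      unfolding flattening_minor_def zs'_def
      by (rule minor_cong) (use cfg upd zsi in \<open>auto simp: config_def add.commute\<close>)
    then have "flattening_minor \<Omega> r I ys zs' \<noteq> 0" using s by simp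
    then have cfg': "config \<xi> \<Omega> I Y r D (\<eta>(i := v)) ys zs'"
      using cfg s by (auto simp: config_def zs'_def v_def add.commute)
    have 1: "in_span \<Omega> I Y r zs (z(i := \<eta> i))"
      by (rule insert.IH[OF cfg adm_upd[OF insert.prems(2)]]) (use insert.prems(3) in auto)
    have "in_span \<Omega> I Y r zs' (z(i := v))"
      by (rule insert.IH[OF cfg' adm_upd[OF insert.prems(2)]]) (use insert.prems(3) in auto)
    moreover have "in_span \<Omega> I Y r zs (zs' b)" if "b < r" for b
      by (rule in_span_one_more[OF cfg max, of _ i]) (use cfg that in \<open>auto simp: config_def zs'_def\<close>)
    ultimately have 2: "in_span \<Omega> I Y r zs (z(i := v))" by (rule in_span_trans)
    obtain c d where cd: "\<forall>y\<in>Y. \<Omega> (mix I y (z(i := \<eta> i))) = (\<Sum>j<r. c j * \<Omega> (mix I y (zs j)))"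
      "\<forall>y\<in>Y. \<Omega> (mix I y (z(i := v))) = (\<Sum>j<r. d j * \<Omega> (mix I y (zs j)))"
      using 1 2 unfolding in_span_def by blast
    have "\<Omega> (mix I y z) = (\<Sum>j<r. ((d j - c j) / s) * \<Omega> (mix I y (zs j)))" if y: "y \<in> Y" for y
    proof -
      have "s * \<Omega> (mix I y z) = (\<Sum>j<r. d j * \<Omega> (mix I y (zs j))) - (\<Sum>j<r. c j * \<Omega> (mix I y (zs j)))"
        using upd[OF y insert.prems(2)] cd y by simp
      also have "\<dots> = s * (\<Sum>j<r. ((d j - c j) / s) * \<Omega> (mix I y (zs j)))"
        unfolding sum_distrib_left sum_subtractf[symmetric]
        by (intro sum.cong) (use s in \<open>auto simp: field_simps\<close>)
      finally show ?thesis using s by simp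
    qed
    then show ?thesis unfolding in_span_def by (intro exI[of _ "\<lambda>j. (d j - c j) / s"]) simp
  qed
qed

text \<open>
  Take a configuration of maximal size \<open>r\<close>. If \<open>r < k\<close>, then all columns of the given nonzero minor
  are combinations of the \<open>r\<close> columns of the configuration, which is impossible.
\<close>

lemma few_positions_columns:
  fixes \<Omega> :: "('k::field, 'n::finite) form"
  assumes inf: "infinite (UNIV :: 'k set)" and ml: "multilin \<xi> \<Omega>" and \<xi>: "\<xi> \<noteq> 0"
    and Y: "\<And>y. y \<in> Y \<Longrightarrow> adm \<xi> y"
    and ys: "\<And>a. a < k \<Longrightarrow> ys a \<in> Y" and zs: "\<And>b. b < k \<Longrightarrow> adm \<xi> (zs b)"
    and nz: "flattening_minor \<Omega> k I ys zs \<noteq> 0"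
  shows "\<exists>D \<eta> ys zs. config \<xi> \<Omega> I Y k D \<eta> ys zs"
proof (rule ccontr)
  let ?E = "\<lambda>r. \<exists>D \<eta> ys zs. config \<xi> \<Omega> I Y r D \<eta> ys zs"
  assume "\<not> ?E k"
  moreover have "?E 0"
    by (rule exI[of _ "{}"], rule exI[of _ "\<lambda>_. \<xi>"]) (simp add: config_def \<xi> flattening_minor_def minor_def)
  ultimately obtain r where r: "?E r" "\<not> ?E (Suc r)" "r < k"
    using ex_least_nat_less[of "\<lambda>r. \<not> ?E r" k] by (metis order_refl)
  obtain D \<eta> ys' zs' where cfg: "config \<xi> \<Omega> I Y r D \<eta> ys' zs'" using r(1) by blast
  have "in_span \<Omega> I Y r zs' (zs b)" if b: "b < k" for b
  proof (rule in_span_all[OF inf ml Y _ _ cfg zs[OF b]])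
    show "finite {i. zs b i \<noteq> \<eta> i}"
      by (rule finite_subset[of _ "{i. zs b i \<noteq> \<xi>} \<union> {i. \<eta> i \<noteq> \<xi>}"])
         (use zs[OF b] cfg in \<open>auto simp: config_def adm_def\<close>)
  qed (use r(2) in auto)
  then have "\<forall>b\<in>{..<k}. \<exists>c. \<forall>y\<in>Y. \<Omega> (mix I y (zs b)) = (\<Sum>j<r. c j * \<Omega> (mix I y (zs' j)))"
    unfolding in_span_def by simp
  from bchoice[OF this]
  obtain c where c: "\<forall>b\<in>{..<k}. \<forall>y\<in>Y. \<Omega> (mix I y (zs b)) = (\<Sum>j<r. c b j * \<Omega> (mix I y (zs' j)))" ..
  have "flattening_minor \<Omega> k I ys zs = 0" unfolding flattening_minor_def
    by (rule minor_factor_zero[OF r(3), of _ "\<lambda>a j. \<Omega> (mix I (ys a) (zs' j))" "\<lambda>j b. c b j"])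
       (use c ys in \<open>auto simp: mult.commute\<close>)
  then show False using nz by simp
qed

text \<open>
  Concentrate the columns first. Then exchange the roles of rows and columns, with the set of
  sequences that agree with \<open>\<eta>1\<close> outside \<open>D1\<close> as the parameter \<open>Y\<close>; thus the second step preserves what
  the first one achieved.
\<close>

lemma few_positions:
  fixes \<Omega> :: "('k::field, 'n::finite) form"
  assumes inf: "infinite (UNIV :: 'k set)" and ml: "multilin \<xi> \<Omega>" and \<xi>: "\<xi> \<noteq> 0"
    and ys: "\<And>a. a < k \<Longrightarrow> adm \<xi> (ys a)" and zs: "\<And>b. b < k \<Longrightarrow> adm \<xi> (zs b)"
    and nz: "flattening_minor \<Omega> k I ys zs \<noteq> 0"
  shows "\<exists>S \<eta> ys zs. finite S \<and> card S \<le> 2 * k \<and> adm \<xi> \<eta> \<and> (\<forall>i. \<eta> i \<noteq> 0) \<and>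
    (\<forall>a<k. \<forall>b<k. \<forall>i. i \<notin> S \<longrightarrow> mix I (ys a) (zs b) i = \<eta> i) \<and> flattening_minor \<Omega> k I ys zs \<noteq> 0"
proof -
  obtain D1 \<eta>1 ys1 zs1 where 1: "config \<xi> \<Omega> I {y. adm \<xi> y} k D1 \<eta>1 ys1 zs1"
    using few_positions_columns[OF inf ml \<xi>, of "{y. adm \<xi> y}" k ys zs I] ys zs nz by auto
  let ?Z = "{z. adm \<xi> z \<and> (\<forall>i. i \<notin> D1 \<longrightarrow> z i = \<eta>1 i)}"
  have "flattening_minor \<Omega> k (- I) zs1 ys1 \<noteq> 0" using 1 by (simp add: config_def flattening_minor_Compl)
  then obtain D2 \<eta>2 ys2 zs2 where 2: "config \<xi> \<Omega> (- I) ?Z k D2 \<eta>2 zs2 ys2"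
    using few_positions_columns[OF inf ml \<xi>, of ?Z k zs1 ys1 "- I"] 1 by (auto simp: config_def)
  have "flattening_minor \<Omega> k I ys2 zs2 \<noteq> 0" using 2 by (simp add: config_def flattening_minor_Compl)
  moreover have "card (D1 \<union> D2) \<le> 2 * k"
    using 1 2 card_Un_le[of D1 D2] by (simp add: config_def)
  moreover have "mix I (ys2 a) (zs2 b) i = mix I \<eta>2 \<eta>1 i" if "a < k" "b < k" "i \<notin> D1 \<union> D2" for a b i
    using 2 that by (auto simp: config_def mix_def)
  moreover have "adm \<xi> (mix I \<eta>2 \<eta>1)" "\<forall>i. mix I \<eta>2 \<eta>1 i \<noteq> 0" using 1 2 by (simp_all add: config_def) (simp add: mix_def)
  ultimately show ?thesis using 1 2
    by (intro exI[of _ "D1 \<union> D2"] exI[of _ "mix I \<eta>2 \<eta>1"] exI[of _ ys2] exI[of _ zs2]) (auto simp: config_def)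
qed

section \<open>The group acting on forms\<close>

hide_const (open) Matrix.mat Matrix.vec

text \<open>
  The action on sequences of covectors that is dual to the action on tensors.
\<close>

definition gact :: "('k, 'n) gelem \<Rightarrow> (nat \<Rightarrow> 'k ^ 'n) \<Rightarrow> nat \<Rightarrow> ('k::field) ^ ('n::finite)" where
  "gact g y = (\<lambda>i. y (fst g i) v* snd g i)"

lemma G_inf_iff:
  "g \<in> carrier G_inf \<longleftrightarrow> (\<exists>p. fst g permutes {..<p} \<and> (\<forall>i. invertible (snd g i)) \<and> (\<forall>i\<ge>p. snd g i = mat 1))"
  by (cases g) (auto simp: G_inf_def G_fin_def)

lemma gact_eventually:
  assumes "g \<in> carrier G_inf" shows "\<exists>p. \<forall>i\<ge>p. \<forall>y. gact g y i = y i"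
proof -
  obtain p where p: "fst g permutes {..<p}" "\<forall>i\<ge>p. snd g i = mat 1" using assms G_inf_iff by blast
  have "gact g y i = y i" if "i \<ge> p" for y i
    using that p permutes_not_in[OF p(1), of i] by (simp add: gact_def)
  then show ?thesis by (intro exI[of _ p]) simp
qed

lemma adm_gact_iff:
  assumes "g \<in> carrier G_inf" shows "adm \<xi> (gact g y) \<longleftrightarrow> adm \<xi> y"
proof -
  obtain p where p: "\<forall>i\<ge>p. \<forall>y. gact g y i = y i" using gact_eventually[OF assms] ..
  have "{i. gact g y i \<noteq> \<xi>} \<subseteq> {..<p} \<union> {i. y i \<noteq> \<xi>}" "{i. y i \<noteq> \<xi>} \<subseteq> {..<p} \<union> {i. gact g y i \<noteq> \<xi>}"
    using p by (auto simp: not_less)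
  then show ?thesis unfolding adm_def by (metis finite_UnI finite_lessThan finite_subset)
qed

lemma gact_upd:
  assumes "fst g permutes X"
  shows "gact g (y(i := u)) = (gact g y)(inv_into UNIV (fst g) i := u v* snd g (inv_into UNIV (fst g) i))"
proof
  fix j show "gact g (y(i := u)) j = ((gact g y)(inv_into UNIV (fst g) i := u v* snd g (inv_into UNIV (fst g) i))) j"
    using permutes_inv_eq[OF assms, of i j] permutes_inverses[OF assms]
    by (auto simp: gact_def)
qed

text \<open>
  The group acts on sequences from the right.
\<close>

lemma gact_comp: "gact g (gact h y) = gact (h \<otimes>\<^bsub>G_inf\<^esub> g) y"
  by (cases g, cases h) (simp add: gact_def G_inf_def vector_matrix_mul_assoc)

lemma gact_mix: "gact g (mix I y z) = mix (fst g -` I) (gact g y) (gact g z)"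
  by (auto simp: gact_def mix_def)

lemma multilin_gact:
  assumes g: "g \<in> carrier G_inf" and \<Omega>: "multilin \<xi> \<Omega>" shows "multilin \<xi> (\<Omega> \<circ> gact g)"
  unfolding multilin_def
proof (intro allI impI)
  fix y i u v c assume y: "adm \<xi> y"
  obtain p where p: "fst g permutes {..<p}" using g G_inf_iff by blast
  let ?j = "inv_into UNIV (fst g) i"
  have "(c *s u + v) v* snd g ?j = c *s (u v* snd g ?j) + v v* snd g ?j"
    by (simp add: vector_matrix_left_distrib scalar_vector_matrix_assoc)
  then show "(\<Omega> \<circ> gact g) (y(i := c *s u + v)) = c * (\<Omega> \<circ> gact g) (y(i := u)) + (\<Omega> \<circ> gact g) (y(i := v))"
    unfolding comp_def gact_upd[OF p]
    using multilinD[OF \<Omega>, of "gact g y" ?j c] y adm_gact_iff[OF g] by (simp del: fun_upd_apply)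
qed

lemma flattening_minor_gact:
  "flattening_minor (\<Omega> \<circ> gact g) k I ys zs = flattening_minor \<Omega> k (fst g -` I) (\<lambda>a. gact g (ys a)) (\<lambda>b. gact g (zs b))"
  by (simp add: flattening_minor_def gact_mix)

text \<open>
  Forms all of whose flattenings have rank less than \<open>k\<close>. As every minor of size \<open>0\<close> is \<open>1\<close>, the set is
  empty for \<open>k = 0\<close>, which is where inductions start.
\<close>

definition rank_lt :: "'k ^ 'n \<Rightarrow> nat \<Rightarrow> ('k::field, 'n::finite) form set" where
  "rank_lt \<xi> k = {\<Omega>. multilin \<xi> \<Omega> \<and>
     (\<forall>I ys zs. (\<forall>a<k. adm \<xi> (ys a)) \<longrightarrow> (\<forall>b<k. adm \<xi> (zs b)) \<longrightarrow> flattening_minor \<Omega> k I ys zs = 0)}"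

lemma rank_lt_gact:
  assumes "g \<in> carrier G_inf" "\<Omega> \<in> rank_lt \<xi> k" shows "\<Omega> \<circ> gact g \<in> rank_lt \<xi> k"
proof -
  have ml: "multilin \<xi> \<Omega>" and z: "\<And>I ys zs. \<forall>a<k. adm \<xi> (ys a) \<Longrightarrow> \<forall>b<k. adm \<xi> (zs b) \<Longrightarrow> flattening_minor \<Omega> k I ys zs = 0"
    using assms(2) unfolding rank_lt_def by blast+
  have "flattening_minor (\<Omega> \<circ> gact g) k I ys zs = 0" if "\<forall>a<k. adm \<xi> (ys a)" "\<forall>b<k. adm \<xi> (zs b)" for I ys zs
    unfolding flattening_minor_gact by (rule z) (use that adm_gact_iff[OF assms(1)] in auto)
  then show ?thesis using multilin_gact[OF assms(1) ml] unfolding rank_lt_def by blast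
qed

section \<open>Bounded flattening rank is detected by finitely many orbits of minors\<close>

lemma extend_to_permutation:
  assumes A: "finite A" and f: "inj_on f A"
  shows "\<exists>q (\<sigma> :: nat \<Rightarrow> nat). \<sigma> permutes {..<q} \<and> (\<forall>a\<in>A. \<sigma> a = f a)"
proof -
  obtain q where q: "A \<union> f ` A \<subseteq> {..<q}" using finite_nat_iff_bounded[of "A \<union> f ` A"] A by auto
  have "card ({..<q} - A) = card ({..<q} - f ` A)"
    using q A f by (simp add: card_Diff_subset card_image)
  then obtain h where h: "bij_betw h ({..<q} - A) ({..<q} - f ` A)"
    using finite_same_card_bij[of "{..<q} - A" "{..<q} - f ` A"] by auto
  define \<sigma> where "\<sigma> i = (if i \<in> A then f i else if i < q then h i else i)" for i
  have 1: "bij_betw \<sigma> A (f ` A)" using f by (auto simp: bij_betw_def inj_on_def \<sigma>_def)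
  have 2: "bij_betw \<sigma> ({..<q} - A) ({..<q} - f ` A)"
    by (rule bij_betw_cong[THEN iffD1, OF _ h]) (auto simp: \<sigma>_def)
  have "bij_betw \<sigma> (A \<union> ({..<q} - A)) (f ` A \<union> ({..<q} - f ` A))"
    by (rule bij_betw_combine[OF 1 2]) auto
  moreover have "A \<union> ({..<q} - A) = {..<q}" "f ` A \<union> ({..<q} - f ` A) = {..<q}" using q by auto
  ultimately have "\<sigma> permutes {..<q}"
    by (intro bij_imp_permutes) (use q in \<open>auto simp: \<sigma>_def\<close>)
  then show ?thesis by (intro exI[of _ q] exI[of _ \<sigma>]) (simp add: \<sigma>_def)
qed

lemma invertible_row_kernel:
  fixes h :: "'k::field ^ 'n ^ 'n::finite"
  assumes "\<And>x. x v* h = 0 \<Longrightarrow> x = 0" shows "invertible h"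
proof -
  have "\<forall>x. transpose h *v x = 0 \<longrightarrow> x = 0" using assms by simp
  then obtain B where "B ** transpose h = mat 1" using matrix_left_invertible_ker[of "transpose h"] by blast
  then have "transpose (B ** transpose h) = mat 1" by (simp add: transpose_mat)
  then have "h ** transpose B = mat 1" by (simp add: matrix_transpose_mul)
  then show ?thesis using matrix_left_right_inverse[of h "transpose B"] unfolding invertible_def by blast
qed

text \<open>
  Fix all standard basis vectors except the one at \<open>t\<close>, and map \<open>u\<close> to \<open>w\<close>; the matrix of this
  map has determinant \<open>w\<^sub>t / u\<^sub>t\<close>.
\<close>

lemma exists_invertible_common_coordinate:
  fixes u w :: "'k::field ^ 'n::finite"
  assumes "vec_nth u t \<noteq> 0" "vec_nth w t \<noteq> 0"
  shows "\<exists>h. invertible h \<and> u v* h = w"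
proof -
  define h :: "'k ^ 'n ^ 'n" where
    "h = (\<chi> i j. if i = t then (if j = t then vec_nth w t / vec_nth u t else (vec_nth w j - vec_nth u j) / vec_nth u t)
       else if i = j then 1 else 0)"
  have nth: "vec_nth (x v* h) j = (if j = t then vec_nth x t * vec_nth w t / vec_nth u t
     else vec_nth x t * (vec_nth w j - vec_nth u j) / vec_nth u t + vec_nth x j)" for x j
  proof -
    have "vec_nth (x v* h) j = vec_nth x t * vec_nth (vec_nth h t) j + (\<Sum>i\<in>UNIV - {t}. vec_nth x i * vec_nth (vec_nth h i) j)"
      unfolding vector_matrix_mult_def by (simp add: sum.remove[of UNIV t])
    also have "(\<Sum>i\<in>UNIV - {t}. vec_nth x i * vec_nth (vec_nth h i) j) = (\<Sum>i\<in>UNIV - {t}. if i = j then vec_nth x j else 0)"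
      by (intro sum.cong) (auto simp: h_def)
    finally show ?thesis by (auto simp: h_def sum.delta)
  qed
  have "u v* h = w" unfolding Finite_Cartesian_Product.vec_eq_iff nth using assms(1) by simp
  moreover have "invertible h"
  proof (rule invertible_row_kernel)
    fix x :: "'k ^ 'n" assume "x v* h = 0"
    then have z: "vec_nth (x v* h) j = 0" for j by simp
    have "vec_nth x t = 0" using z[of t] assms unfolding nth by simp
    then have "vec_nth x j = 0" for j using z[of j] unfolding nth by (cases "j = t") simp_all
    then show "x = 0" by (simp add: Finite_Cartesian_Product.vec_eq_iff)
  qed
  ultimately show ?thesis by blast
qed

text \<open>
  The vector with all coordinates \<open>1\<close> shares a nonzero coordinate with both \<open>u\<close> and \<open>w\<close>.
\<close>

lemma exists_invertible_row:
  fixes u w :: "'k::field ^ 'n::finite"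
  assumes "u \<noteq> 0" "w \<noteq> 0"
  shows "\<exists>h. invertible h \<and> u v* h = w"
proof -
  obtain s t where s: "vec_nth u s \<noteq> 0" and t: "vec_nth w t \<noteq> 0"
    using assms by (auto simp: Finite_Cartesian_Product.vec_eq_iff)
  define z :: "'k ^ 'n" where "z = (\<chi> i. 1)"
  obtain h1 where h1: "invertible h1" "u v* h1 = z"
    using exists_invertible_common_coordinate[of u s z] s by (auto simp: z_def)
  obtain h2 where h2: "invertible h2" "z v* h2 = w"
    using exists_invertible_common_coordinate[of z t w] t by (auto simp: z_def)
  show ?thesis
    by (rule exI[of _ "h1 ** h2"]) (use h1 h2 in \<open>auto simp: invertible_mult vector_matrix_mul_assoc[symmetric]\<close>)
qed

text \<open>
  If \<open>\<xi>\<close> has a nonzero coordinate at \<open>o'\<close>, this is a basis in which \<open>\<xi>\<close> replaces the standard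
  basis vector at \<open>o'\<close>. The letter \<open>o'\<close> thus stands for \<open>\<xi>\<close>.
\<close>

definition bvec :: "'k ^ 'n \<Rightarrow> 'n \<Rightarrow> 'n \<Rightarrow> ('k::field) ^ ('n::finite)" where
  "bvec \<xi> o' j = (if j = o' then \<xi> else axis j 1)"

lemma bvec_expand:
  assumes "vec_nth \<xi> o' \<noteq> 0"
  shows "\<exists>c. v = (\<Sum>j\<in>UNIV. c j *s bvec \<xi> o' j)"
proof -
  define d where "d = vec_nth v o' / vec_nth \<xi> o'"
  define c where "c j = (if j = o' then d else vec_nth v j - d * vec_nth \<xi> j)" for j
  have "vec_nth (\<Sum>j\<in>UNIV. c j *s bvec \<xi> o' j) i = vec_nth v i" for i
  proof -
    have "vec_nth (\<Sum>j\<in>UNIV. c j *s bvec \<xi> o' j) i = (\<Sum>j\<in>UNIV. c j * vec_nth (bvec \<xi> o' j) i)"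
      by (simp add: sum_component)
    also have "\<dots> = d * vec_nth \<xi> i + (\<Sum>j\<in>UNIV - {o'}. c j * vec_nth (bvec \<xi> o' j) i)"
      by (simp add: sum.remove[of UNIV o'] c_def bvec_def)
    also have "(\<Sum>j\<in>UNIV - {o'}. c j * vec_nth (bvec \<xi> o' j) i) = (\<Sum>j\<in>UNIV - {o'}. if j = i then c i else 0)"
      by (intro sum.cong) (auto simp: bvec_def axis_def)
    also have "\<dots> = (if i = o' then 0 else c i)" by (simp add: sum.delta)
    finally show ?thesis using assms by (auto simp: c_def d_def)
  qed
  then show ?thesis by (intro exI[of _ c]) (simp add: Finite_Cartesian_Product.vec_eq_iff)
qed

definition wseq :: "'k ^ 'n \<Rightarrow> 'n \<Rightarrow> nat \<Rightarrow> 'n list \<Rightarrow> nat \<Rightarrow> ('k::field) ^ ('n::finite)" where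
  "wseq \<xi> o' P u = (\<lambda>i. if i < P then bvec \<xi> o' (u ! i) else \<xi>)"

lemma adm_wseq [simp]: "adm \<xi> (wseq \<xi> o' P u)"
  unfolding adm_def by (rule finite_subset[of _ "{..<P}"]) (auto simp: wseq_def)

text \<open>
  Expand the row in one position after the other; by linearity of the minor in this row some basis
  covector keeps the minor nonzero.
\<close>

lemma flattening_minor_replace_row:
  assumes \<xi>: "vec_nth \<xi> o' \<noteq> 0" and ml: "multilin \<xi> \<Omega>"
    and ys: "\<And>a. a < k \<Longrightarrow> adm \<xi> (ys a)" and zs: "\<And>b. b < k \<Longrightarrow> adm \<xi> (zs b)"
    and a: "a < k" and yP: "\<And>i. i \<ge> P \<Longrightarrow> ys a i = \<xi>" and nz: "flattening_minor \<Omega> k I ys zs \<noteq> 0"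
  shows "\<exists>u. length u = P \<and> flattening_minor \<Omega> k I (ys(a := wseq \<xi> o' P u)) zs \<noteq> 0"
proof -
  let ?y = "\<lambda>p u i. if i < p then bvec \<xi> o' (u ! i) else ys a i"
  have adm: "adm \<xi> (?y p u)" for p u
    using ys[OF a] unfolding adm_def by (rule finite_subset[rotated, OF finite_UnI[OF _ finite_lessThan[of p]]]) auto
  have "\<exists>u. length u = p \<and> flattening_minor \<Omega> k I (ys(a := ?y p u)) zs \<noteq> 0" for p
  proof (induction p)
    case 0
    then show ?case using nz by simp
  next
    case (Suc p)
    then obtain u where u: "length u = p" "flattening_minor \<Omega> k I (ys(a := ?y p u)) zs \<noteq> 0" by blast
    obtain c where c: "ys a p = (\<Sum>j\<in>UNIV. c j *s bvec \<xi> o' j)" using bvec_expand[OF \<xi>] by blast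
    have upd: "?y (Suc p) (u @ [j]) = (?y p u)(p := bvec \<xi> o' j)" for j
      using u(1) by (auto simp: nth_append less_Suc_eq fun_eq_iff)
    have "\<exists>j. flattening_minor \<Omega> k I (ys(a := (?y p u)(p := bvec \<xi> o' j))) zs \<noteq> 0"
    proof (cases "p \<in> I")
      case False
      have "flattening_minor \<Omega> k I (ys(a := (?y p u)(p := bvec \<xi> o' j))) zs = flattening_minor \<Omega> k I (ys(a := ?y p u)) zs" for j
        unfolding flattening_minor_def
      proof (rule minor_cong)
        fix a' b
        show "\<Omega> (mix I ((ys(a := (?y p u)(p := bvec \<xi> o' j))) a') (zs b)) = \<Omega> (mix I ((ys(a := ?y p u)) a') (zs b))"
          using mix_upd_left'[OF False, of "?y p u" "bvec \<xi> o' j" "zs b"] by (cases "a' = a") simp_all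
      qed
      then show ?thesis using u(2) by simp
    next
      case True
      let ?M = "\<lambda>a' b. \<Omega> (mix I ((ys(a := ?y p u)) a') (zs b))"
      have "\<exists>j\<in>UNIV. minor k (\<lambda>a' b. if a' = a then \<Omega> (mix I ((?y p u)(p := bvec \<xi> o' j)) (zs b)) else ?M a' b) \<noteq> 0"
      proof (rule minor_row_replace[where c = c])
        show "a < k" "finite (UNIV :: 'b set)" by (auto simp: a)
        show "minor k ?M \<noteq> 0" using u(2) unfolding flattening_minor_def .
        fix b assume b: "b < k"
        have "mix I (?y p u) (zs b) = (mix I (?y p u) (zs b))(p := (\<Sum>j\<in>UNIV. c j *s bvec \<xi> o' j))"
          unfolding c[symmetric] using True by (auto simp: mix_def fun_eq_iff)
        then have "?M a b = \<Omega> ((mix I (?y p u) (zs b))(p := (\<Sum>j\<in>UNIV. c j *s bvec \<xi> o' j)))"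
          by simp
        also have "\<dots> = (\<Sum>j\<in>UNIV. c j * \<Omega> ((mix I (?y p u) (zs b))(p := bvec \<xi> o' j)))"
          by (rule multilin_sum[OF ml]) (simp_all add: adm zs[OF b])
        finally show "?M a b = (\<Sum>j\<in>UNIV. c j * \<Omega> (mix I ((?y p u)(p := bvec \<xi> o' j)) (zs b)))"
          by (simp only: mix_upd_left[OF True])
      qed
      then obtain j where j: "minor k (\<lambda>a' b. if a' = a then \<Omega> (mix I ((?y p u)(p := bvec \<xi> o' j)) (zs b)) else ?M a' b) \<noteq> 0"
        by blast
      have "minor k (\<lambda>a' b. if a' = a then \<Omega> (mix I ((?y p u)(p := bvec \<xi> o' j)) (zs b)) else ?M a' b)
        = flattening_minor \<Omega> k I (ys(a := (?y p u)(p := bvec \<xi> o' j))) zs"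
        unfolding flattening_minor_def by (intro minor_cong) auto
      with j have "flattening_minor \<Omega> k I (ys(a := (?y p u)(p := bvec \<xi> o' j))) zs \<noteq> 0" by (simp only: not_False_eq_True)
      then show ?thesis by (rule exI)
    qed
    then obtain j where "flattening_minor \<Omega> k I (ys(a := (?y p u)(p := bvec \<xi> o' j))) zs \<noteq> 0" by blast
    then show ?case using u(1) by (intro exI[of _ "u @ [j]"]) (simp only: upd length_append_singleton simp_thms)
  qed
  then obtain u where u: "length u = P" "flattening_minor \<Omega> k I (ys(a := ?y P u)) zs \<noteq> 0" by blast
  have eq: "?y P u = wseq \<xi> o' P u" using yP by (auto simp: wseq_def fun_eq_iff not_less)
  show ?thesis using u(1) u(2)[unfolded eq] by (intro exI[of _ u] conjI)
qed

lemma flattening_minor_replace_rows: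
  assumes \<xi>: "vec_nth \<xi> o' \<noteq> 0" and ml: "multilin \<xi> \<Omega>"
    and ys: "\<And>a. a < k \<Longrightarrow> adm \<xi> (ys a)" and zs: "\<And>b. b < k \<Longrightarrow> adm \<xi> (zs b)"
    and yP: "\<And>a i. a < k \<Longrightarrow> i \<ge> P \<Longrightarrow> ys a i = \<xi>" and nz: "flattening_minor \<Omega> k I ys zs \<noteq> 0"
  shows "\<exists>\<rho>. length \<rho> = k \<and> (\<forall>u\<in>set \<rho>. length u = P) \<and>
    flattening_minor \<Omega> k I (\<lambda>a. wseq \<xi> o' P (\<rho> ! a)) zs \<noteq> 0"
proof -
  have "m \<le> k \<longrightarrow> (\<exists>\<rho>. length \<rho> = m \<and> (\<forall>u\<in>set \<rho>. length u = P) \<and>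
    flattening_minor \<Omega> k I (\<lambda>a. if a < m then wseq \<xi> o' P (\<rho> ! a) else ys a) zs \<noteq> 0)" for m
  proof (induction m)
    case 0
    then show ?case using nz by simp
  next
    case (Suc m)
    show ?case
    proof
      assume m: "Suc m \<le> k"
      then obtain \<rho> where \<rho>: "length \<rho> = m" "\<forall>u\<in>set \<rho>. length u = P"
        and nz: "flattening_minor \<Omega> k I (\<lambda>a. if a < m then wseq \<xi> o' P (\<rho> ! a) else ys a) zs \<noteq> 0"
        using Suc.IH by auto
      have "\<exists>u. length u = P \<and> flattening_minor \<Omega> k I ((\<lambda>a. if a < m then wseq \<xi> o' P (\<rho> ! a) else ys a)(m := wseq \<xi> o' P u)) zs \<noteq> 0"
        by (rule flattening_minor_replace_row[OF \<xi> ml _ zs _ _ nz]) (use ys yP m in auto)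
      then obtain u where u: "length u = P"
        "flattening_minor \<Omega> k I ((\<lambda>a. if a < m then wseq \<xi> o' P (\<rho> ! a) else ys a)(m := wseq \<xi> o' P u)) zs \<noteq> 0" by blast
      have "(\<lambda>a. if a < m then wseq \<xi> o' P (\<rho> ! a) else ys a)(m := wseq \<xi> o' P u)
         = (\<lambda>a. if a < Suc m then wseq \<xi> o' P ((\<rho> @ [u]) ! a) else ys a)"
        using \<rho>(1) by (auto simp: fun_eq_iff nth_append less_Suc_eq)
      then show "\<exists>\<rho>. length \<rho> = Suc m \<and> (\<forall>u\<in>set \<rho>. length u = P) \<and>
        flattening_minor \<Omega> k I (\<lambda>a. if a < Suc m then wseq \<xi> o' P (\<rho> ! a) else ys a) zs \<noteq> 0"
        using u \<rho> by (intro exI[of _ "\<rho> @ [u]"]) auto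
    qed
  qed
  then obtain \<rho> where \<rho>: "length \<rho> = k" "\<forall>u\<in>set \<rho>. length u = P"
    and nz: "flattening_minor \<Omega> k I (\<lambda>a. if a < k then wseq \<xi> o' P (\<rho> ! a) else ys a) zs \<noteq> 0" by blast
  have "flattening_minor \<Omega> k I (\<lambda>a. if a < k then wseq \<xi> o' P (\<rho> ! a) else ys a) zs = flattening_minor \<Omega> k I (\<lambda>a. wseq \<xi> o' P (\<rho> ! a)) zs"
    unfolding flattening_minor_def by (rule minor_cong) simp
  then show ?thesis using \<rho> nz by (intro exI[of _ \<rho>]) simp
qed

definition words :: "nat \<Rightarrow> nat \<Rightarrow> 'n list list set" where
  "words k P = {\<rho>. length \<rho> = k \<and> (\<forall>u\<in>set \<rho>. length u = P)}"

lemma finite_words: "finite (words k P :: 'n::finite list list set)"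
proof -
  have f: "finite {u :: 'n list. length u = P}" using finite_lists_length_eq[of "UNIV :: 'n set" P] by simp
  have "words k P = {\<rho>. set \<rho> \<subseteq> {u :: 'n list. length u = P} \<and> length \<rho> = k}" by (auto simp: words_def)
  then show ?thesis using finite_lists_length_eq[OF f, of k] by simp
qed

text \<open>
  Given a nonzero minor whose entries are values at sequences equal to \<open>\<eta>\<close> outside \<open>S\<close>, the group element
  moves \<open>S\<close> into the first \<open>P\<close> positions and acts at the other positions by matrices that map \<open>\<xi>\<close> to \<open>\<eta> i\<close>.
\<close>

theorem detect_rank:
  fixes \<Omega> :: "('k::field, 'n::finite) form"
  assumes inf: "infinite (UNIV :: 'k set)" and \<xi>: "vec_nth \<xi> o' \<noteq> 0" and ml: "multilin \<xi> \<Omega>"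
    and rk: "\<Omega> \<notin> rank_lt \<xi> k" and P: "P = 2 * k"
  shows "\<exists>g\<in>carrier G_inf. \<exists>I\<subseteq>{..<P}. \<exists>\<rho>\<in>words k P. \<exists>\<gamma>\<in>words k P.
    flattening_minor (\<Omega> \<circ> gact g) k I (\<lambda>a. wseq \<xi> o' P (\<rho> ! a)) (\<lambda>b. wseq \<xi> o' P (\<gamma> ! b)) \<noteq> 0"
proof -
  have \<xi>0: "\<xi> \<noteq> 0" using \<xi> by auto
  obtain I0 ys0 zs0 where "\<And>a. a < k \<Longrightarrow> adm \<xi> (ys0 a)" "\<And>b. b < k \<Longrightarrow> adm \<xi> (zs0 b)" "flattening_minor \<Omega> k I0 ys0 zs0 \<noteq> 0"
    using rk ml unfolding rank_lt_def by blast
  then have "\<exists>S \<eta> ys zs. finite S \<and> card S \<le> 2 * k \<and> adm \<xi> \<eta> \<and> (\<forall>i. \<eta> i \<noteq> 0) \<and>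
    (\<forall>a<k. \<forall>b<k. \<forall>i. i \<notin> S \<longrightarrow> mix I0 (ys a) (zs b) i = \<eta> i) \<and> flattening_minor \<Omega> k I0 ys zs \<noteq> 0"
    by (rule few_positions[OF inf ml \<xi>0])
  then obtain S \<eta> ys zs where S: "finite S" "card S \<le> 2 * k" and \<eta>: "adm \<xi> \<eta>" "\<forall>i. \<eta> i \<noteq> 0"
    and eq: "\<forall>a<k. \<forall>b<k. \<forall>i. i \<notin> S \<longrightarrow> mix I0 (ys a) (zs b) i = \<eta> i" and nz: "flattening_minor \<Omega> k I0 ys zs \<noteq> 0"
    by (elim exE conjE)
  obtain f where f: "bij_betw f S {..<card S}"
    using ex_bij_betw_finite_nat[OF S(1)] by (auto simp: atLeast0LessThan)
  obtain q \<tau> where \<tau>: "\<tau> permutes {..<q}" "\<forall>a\<in>S. \<tau> a = f a"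
    using extend_to_permutation[OF S(1), of f] f unfolding bij_betw_def by blast
  have \<tau>S: "\<tau> i < P" if "i \<in> S" for i
    using bij_betw_apply[OF f that] that \<tau>(2) S(2) P by auto
  have "\<forall>i. \<exists>h. invertible h \<and> \<xi> v* h = \<eta> i" using exists_invertible_row[OF \<xi>0] \<eta>(2) by blast
  then obtain h0 where h0: "\<And>i. invertible (h0 i)" "\<And>i. \<xi> v* h0 i = \<eta> i" by metis
  define h where "h i = (if i \<in> S \<or> \<eta> i = \<xi> then mat 1 else h0 i)" for i
  have h: "\<xi> v* h i = \<eta> i" if "i \<notin> S" for i using that h0 by (auto simp: h_def)
  have hS: "h i = mat 1" if "i \<in> S" for i using that by (simp add: h_def)
  have "finite ({i. \<eta> i \<noteq> \<xi>} \<union> {..<q})" using \<eta>(1) by (simp add: adm_def)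
  then obtain p where p: "{i. \<eta> i \<noteq> \<xi>} \<union> {..<q} \<subseteq> {..<p}" by (auto simp: finite_nat_iff_bounded)
  have inv1: "invertible (mat 1 :: 'k ^ 'n ^ 'n)" by (auto simp: invertible_def intro!: exI[of _ "mat 1"])
  have "\<tau> permutes {..<p}" by (rule permutes_subset[OF \<tau>(1)]) (use p in auto)
  moreover have "h i = mat 1" if "i \<ge> p" for i using p that by (auto simp: h_def)
  moreover have "invertible (h i)" for i using h0(1) inv1 by (simp add: h_def)
  ultimately have g: "(\<tau>, h) \<in> carrier G_inf" unfolding G_inf_iff by auto
  let ?g = "(\<tau>, h)"
  \<comment> \<open>transport of sequences along \<open>\<tau>\<close>, forgetting the values outside \<open>S\<close>\<close>
  define tr where "tr y j = (if inv_into UNIV \<tau> j \<in> S then y (inv_into UNIV \<tau> j) else \<xi>)" for y :: "nat \<Rightarrow> 'k ^ 'n" and j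
  define I where "I = \<tau> ` I0 \<inter> {..<P}"
  have trP: "tr y j = \<xi>" if "j \<ge> P" for y j
    using \<tau>S[of "inv_into UNIV \<tau> j"] that permutes_inverses(1)[OF \<tau>(1), of j] by (auto simp: tr_def)
  have tra: "adm \<xi> (tr y)" for y
    unfolding adm_def by (rule finite_subset[of _ "{..<P}"]) (use trP[of _ y] in \<open>auto simp: not_less[symmetric]\<close>)
  have key: "gact ?g (mix I (tr (ys a)) (tr (zs b))) = mix I0 (ys a) (zs b)" if ab: "a < k" "b < k" for a b
  proof
    fix i
    have ii: "inv_into UNIV \<tau> (\<tau> i) = i" using permutes_inverses(2)[OF \<tau>(1)] by simp
    have mem: "\<tau> i \<in> \<tau> ` I0 \<longleftrightarrow> i \<in> I0" using permutes_inj[OF \<tau>(1)] by (simp add: inj_image_mem_iff)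
    show "gact ?g (mix I (tr (ys a)) (tr (zs b))) i = mix I0 (ys a) (zs b) i"
    proof (cases "i \<in> S")
      case True
      then show ?thesis using mem \<tau>S[OF True] ii hS[OF True] by (simp add: gact_def mix_def I_def tr_def)
    next
      case False
      have "mix I (tr (ys a)) (tr (zs b)) (\<tau> i) = \<xi>" using False by (simp add: mix_def tr_def ii)
      then show ?thesis using h[OF False] eq ab False by (simp add: gact_def)
    qed
  qed
  have ml': "multilin \<xi> (\<Omega> \<circ> gact ?g)" by (rule multilin_gact[OF g ml])
  have "flattening_minor (\<Omega> \<circ> gact ?g) k I (\<lambda>a. tr (ys a)) (\<lambda>b. tr (zs b)) = flattening_minor \<Omega> k I0 ys zs"
    unfolding flattening_minor_def by (rule minor_cong) (simp add: key)
  then have nz1: "flattening_minor (\<Omega> \<circ> gact ?g) k I (\<lambda>a. tr (ys a)) (\<lambda>b. tr (zs b)) \<noteq> 0" using nz by simp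
  have "\<exists>\<rho>. length \<rho> = k \<and> (\<forall>u\<in>set \<rho>. length u = P) \<and>
    flattening_minor (\<Omega> \<circ> gact ?g) k I (\<lambda>a. wseq \<xi> o' P (\<rho> ! a)) (\<lambda>b. tr (zs b)) \<noteq> 0"
    by (rule flattening_minor_replace_rows[OF \<xi> ml' _ _ _ nz1]) (simp_all add: tra trP)
  then obtain \<rho> where \<rho>: "\<rho> \<in> words k P"
    and nz2: "flattening_minor (\<Omega> \<circ> gact ?g) k I (\<lambda>a. wseq \<xi> o' P (\<rho> ! a)) (\<lambda>b. tr (zs b)) \<noteq> 0"
    by (auto simp: words_def)
  have "flattening_minor (\<Omega> \<circ> gact ?g) k (- I) (\<lambda>b. tr (zs b)) (\<lambda>a. wseq \<xi> o' P (\<rho> ! a)) \<noteq> 0"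
    using nz2 by (simp only: flattening_minor_Compl not_False_eq_True)
  then have "\<exists>\<gamma>. length \<gamma> = k \<and> (\<forall>u\<in>set \<gamma>. length u = P) \<and>
    flattening_minor (\<Omega> \<circ> gact ?g) k (- I) (\<lambda>a. wseq \<xi> o' P (\<gamma> ! a)) (\<lambda>a. wseq \<xi> o' P (\<rho> ! a)) \<noteq> 0"
    by (rule flattening_minor_replace_rows[OF \<xi> ml', rotated 3]) (simp_all add: tra trP)
  then obtain \<gamma> where \<gamma>: "\<gamma> \<in> words k P"
    and "flattening_minor (\<Omega> \<circ> gact ?g) k (- I) (\<lambda>b. wseq \<xi> o' P (\<gamma> ! b)) (\<lambda>a. wseq \<xi> o' P (\<rho> ! a)) \<noteq> 0"
    by (auto simp: words_def)
  then have "flattening_minor (\<Omega> \<circ> gact ?g) k I (\<lambda>a. wseq \<xi> o' P (\<rho> ! a)) (\<lambda>b. wseq \<xi> o' P (\<gamma> ! b)) \<noteq> 0"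
    by (simp only: flattening_minor_Compl not_False_eq_True)
  moreover have "I \<subseteq> {..<P}" by (simp add: I_def)
  ultimately show ?thesis using g \<rho> \<gamma> by blast
qed

section \<open>Polynomials in the values of a form\<close>

lemma polys_sum: "(\<And>i. i \<in> I \<Longrightarrow> f i \<in> polys V) \<Longrightarrow> (\<lambda>a. \<Sum>i\<in>I. f i a) \<in> polys V"
  by (induction I rule: infinite_finite_induct) (auto intro: polys.intros)

lemma polys_prod: "(\<And>i. i \<in> I \<Longrightarrow> f i \<in> polys V) \<Longrightarrow> (\<lambda>a. \<Prod>i\<in>I. f i a) \<in> polys V"
  by (induction I rule: infinite_finite_induct) (auto intro: polys.intros)

lemma polys_power: "f \<in> polys V \<Longrightarrow> (\<lambda>a. f a ^ d) \<in> polys V"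
  by (induction d) (auto intro: polys.intros)

lemma polys_coordinate: "c \<in> C \<Longrightarrow> (\<lambda>a. a j c) \<in> polys {(\<lambda>a. a j c) | j c. c \<in> C}"
  by (rule polys.gen) blast

lemma polys_finite_dependence:
  assumes "f \<in> polys {(\<lambda>a. a j c) | j c. c \<in> C}"
  shows "\<exists>m. \<forall>a a'. (\<forall>j<m. a j = a' j) \<longrightarrow> f a = f (a' :: nat \<Rightarrow> 'c \<Rightarrow> 'k::field)"
  using assms
proof (induction f rule: polys.induct)
  case (gen f)
  then obtain j c where "f = (\<lambda>a. a j c)" by blast
  then show ?case by (intro exI[of _ "Suc j"]) simp
next
  case (add f g)
  then obtain m n where "\<forall>a a'. (\<forall>j<m. a j = a' j) \<longrightarrow> f a = f a'" "\<forall>a a'. (\<forall>j<n. a j = a' j) \<longrightarrow> g a = g a'" by blast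
  then show ?case by (intro exI[of _ "max m n"]) (metis less_max_iff_disj)
next
  case (mult f g)
  then obtain m n where "\<forall>a a'. (\<forall>j<m. a j = a' j) \<longrightarrow> f a = f a'" "\<forall>a a'. (\<forall>j<n. a j = a' j) \<longrightarrow> g a = g a'" by blast
  then show ?case by (intro exI[of _ "max m n"]) (metis less_max_iff_disj)
qed simp

definition form_polys :: "'k ^ 'n \<Rightarrow> (('k::field, 'n::finite) form \<Rightarrow> 'k) set" where
  "form_polys \<xi> = polys {(\<lambda>\<Omega>. \<Omega> y) | y. adm \<xi> y}"

lemma form_polys_gact:
  fixes f :: "('k::field, 'n::finite) form \<Rightarrow> 'k"
  assumes g: "g \<in> carrier G_inf" and f: "f \<in> form_polys \<xi>"
  shows "(\<lambda>\<Omega>. f (\<Omega> \<circ> gact g)) \<in> form_polys \<xi>"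
proof -
  have "\<exists>h\<in>form_polys \<xi>. \<forall>\<Omega>\<in>UNIV. f (\<Omega> \<circ> gact g) = h \<Omega>"
    using f unfolding form_polys_def
  proof (rule polys_pullback)
    fix v :: "('k, 'n) form \<Rightarrow> 'k" assume "v \<in> {(\<lambda>\<Omega>. \<Omega> y) | y. adm \<xi> y}"
    then obtain y where y: "v = (\<lambda>\<Omega>. \<Omega> y)" "adm \<xi> y" by blast
    then have "adm \<xi> (gact g y)" using adm_gact_iff[OF g] by blast
    then have "(\<lambda>\<Omega>. \<Omega> (gact g y)) \<in> polys {(\<lambda>\<Omega>. \<Omega> y) | y. adm \<xi> y}" by (intro polys.gen) blast
    then show "\<exists>h\<in>polys {(\<lambda>\<Omega>. \<Omega> y) | y. adm \<xi> y}. \<forall>\<Omega>\<in>UNIV. v (\<Omega> \<circ> gact g) = h \<Omega>"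
      by (rule bexI[rotated]) (simp add: y(1))
  qed
  then obtain h where h: "h \<in> form_polys \<xi>" "\<forall>\<Omega>\<in>UNIV. f (\<Omega> \<circ> gact g) = h \<Omega>" by blast
  then have "(\<lambda>\<Omega>. f (\<Omega> \<circ> gact g)) = h" by (simp add: fun_eq_iff)
  then show ?thesis using h(1) by simp
qed

section \<open>Coordinates where a minor does not vanish\<close>

definition bword :: "'k ^ 'n \<Rightarrow> 'n \<Rightarrow> (nat \<Rightarrow> 'n) \<Rightarrow> nat \<Rightarrow> ('k::field) ^ ('n::finite)" where
  "bword \<xi> o' w = (\<lambda>i. bvec \<xi> o' (w i))"

lemma bvec_base [simp]: "bvec \<xi> o' o' = \<xi>"
  by (simp add: bvec_def)

lemma adm_bword: "finite {i. w i \<noteq> o'} \<Longrightarrow> adm \<xi> (bword \<xi> o' w)"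
  unfolding adm_def by (rule finite_subset[of _ "{i. w i \<noteq> o'}"]) (auto simp: bword_def)

definition word1 :: "'n \<Rightarrow> nat \<Rightarrow> 'n list \<Rightarrow> 'n \<Rightarrow> nat \<Rightarrow> nat \<Rightarrow> 'n" where
  "word1 o' P u j i = (\<lambda>p. if p < P then u ! p else if p = P + i then j else o')"

text \<open>
  The kinds of coordinates of the chart: the values at the words \<open>word1 o' P u j i\<close>, of which there
  is one for each position \<open>i\<close>, and the entries of the inverse block, which are the same for all \<open>i\<close>.
\<close>

definition chart_index :: "nat \<Rightarrow> nat \<Rightarrow> ('n::finite list \<times> 'n + nat \<times> nat) set" where
  "chart_index k P = ({u. length u = P} \<times> UNIV) <+> ({..<k} \<times> {..<k})"

lemma finite_chart_index: "finite (chart_index k P :: ('n::finite list \<times> 'n + nat \<times> nat) set)"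
  using finite_lists_length_eq[of "UNIV :: 'n set" P] by (simp add: chart_index_def)

context
  fixes \<xi> :: "'k::field ^ 'n::finite" and o' :: 'n and k P :: nat and I :: "nat set"
    and \<rho> \<gamma> :: "'n list list"
begin

definition block :: "('k, 'n) form \<Rightarrow> nat \<Rightarrow> nat \<Rightarrow> 'k" where
  "block \<Omega> = (\<lambda>a b. \<Omega> (mix I (wseq \<xi> o' P (\<rho> ! a)) (wseq \<xi> o' P (\<gamma> ! b))))"

text \<open>
  Flattening rank exactly \<open>k\<close>, witnessed by the minor with rows \<open>\<rho>\<close> and columns \<open>\<gamma>\<close>.
\<close>

definition chart_domain :: "('k, 'n) form set" where
  "chart_domain = {\<Omega> \<in> rank_lt \<xi> (Suc k). minor k (block \<Omega>) \<noteq> 0}"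

definition block_inverse :: "('k, 'n) form \<Rightarrow> nat \<Rightarrow> nat \<Rightarrow> 'k" where
  "block_inverse \<Omega> = (SOME N. left_inverse k N (block \<Omega>))"

definition chart :: "('k, 'n) form \<Rightarrow> nat \<Rightarrow> 'n list \<times> 'n + nat \<times> nat \<Rightarrow> 'k" where
  "chart \<Omega> i c = (case c of Inl (u, j) \<Rightarrow> \<Omega> (bword \<xi> o' (word1 o' P u j i)) | Inr (a, b) \<Rightarrow> block_inverse \<Omega> a b)"

abbreviation chart_polys :: "((nat \<Rightarrow> 'n list \<times> 'n + nat \<times> nat \<Rightarrow> 'k) \<Rightarrow> 'k) set" where
  "chart_polys \<equiv> polys {(\<lambda>a. a j c) | j c. c \<in> chart_index k P}"

lemma block_inverse: "\<Omega> \<in> chart_domain \<Longrightarrow> left_inverse k (block_inverse \<Omega>) (block \<Omega>)"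
  unfolding block_inverse_def chart_domain_def by (metis (mono_tags) left_inverse_exists mem_Collect_eq someI_ex)

text \<open>
  Induction on the number of letters other than \<open>o'\<close> behind the first \<open>P\<close> positions. A word with at
  most one such letter is a coordinate of the chart. Otherwise let \<open>s\<close> be the position of one of them and
  flatten along \<open>I\<close> and \<open>s\<close>. The block does not change, as its words have letter \<open>o'\<close> in
  position \<open>s\<close>. Border it by the word \<open>w\<close> as a row and as a column: the corner entry is the value at
  \<open>w\<close>, in the new column position \<open>s\<close> has letter \<open>o'\<close>, and in the new row all positions behind the first \<open>P\<close>
  except \<open>s\<close> have letter \<open>o'\<close>. So the border consists of values at words with fewer such letters.
\<close>

lemma basis_word_in_chart:
  assumes I: "I \<subseteq> {..<P}" and w: "finite {i. w i \<noteq> o'}"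
  shows "\<exists>f\<in>chart_polys. \<forall>\<Omega>\<in>chart_domain. \<Omega> (bword \<xi> o' w) = f (chart \<Omega>)"
  using w
proof (induction "card {i. i \<ge> P \<and> w i \<noteq> o'}" arbitrary: w rule: less_induct)
  case less
  let ?S = "\<lambda>w. {i. i \<ge> P \<and> w i \<noteq> o'}"
  have fin: "finite (?S w)" by (rule finite_subset[OF _ less.prems]) auto
  show ?case
  proof (cases "\<exists>i. \<forall>p\<ge>P. p \<noteq> P + i \<longrightarrow> w p = o'")
    case True
    then obtain i where i: "\<forall>p\<ge>P. p \<noteq> P + i \<longrightarrow> w p = o'" by blast
    let ?c = "Inl (map w [0..<P], w (P + i))"
    have "word1 o' P (map w [0..<P]) (w (P + i)) i = w"
      using i by (auto simp: word1_def fun_eq_iff)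
    then have "\<Omega> (bword \<xi> o' w) = chart \<Omega> i ?c" for \<Omega> by (simp add: chart_def)
    moreover have "?c \<in> chart_index k P" by (auto simp: chart_index_def)
    then have "(\<lambda>a. a i ?c) \<in> chart_polys" by (rule polys_coordinate)
    ultimately show ?thesis by (intro bexI[of _ "\<lambda>a. a i ?c"]) auto
  next
    case False
    obtain s where s: "s \<ge> P" "w s \<noteq> o'" using False by blast
    \<comment> \<open>a second letter, which shows that the words of the new row are simpler than \<open>w\<close>\<close>
    obtain s' where s': "s' \<ge> P" "s' \<noteq> s" "w s' \<noteq> o'" using False s(1) by (metis le_Suc_ex)
    let ?ys = "\<lambda>a. wseq \<xi> o' P (\<rho> ! a)" and ?zs = "\<lambda>b. wseq \<xi> o' P (\<gamma> ! b)" and ?I = "insert s I"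
    \<comment> \<open>the words of the new column and of the new row\<close>
    define w1 where "w1 l p = (if p \<in> I then \<rho> ! l ! p else if p = s then o' else w p)" for l p
    define w2 where "w2 j p = (if p \<in> ?I then w p else if p < P then \<gamma> ! j ! p else o')" for j p
    have mix1: "mix ?I (?ys l) (bword \<xi> o' w) = bword \<xi> o' (w1 l)" for l
      using I s(1) by (auto simp: mix_def wseq_def bword_def w1_def fun_eq_iff)
    have mix2: "mix ?I (bword \<xi> o' w) (?zs j) = bword \<xi> o' (w2 j)" for j
      using I s(1) by (auto simp: mix_def wseq_def bword_def w2_def fun_eq_iff)
    have mix3: "mix ?I (?ys a) (?zs b) = mix I (?ys a) (?zs b)" for a b
      using s(1) by (auto simp: mix_def wseq_def fun_eq_iff)
    have mix4: "mix ?I (bword \<xi> o' w) (bword \<xi> o' w) = bword \<xi> o' w"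
      by (auto simp: mix_def)
    have "?S (w1 l) \<subseteq> ?S w - {s}" for l using I by (auto simp: w1_def)
    then have "card (?S (w1 l)) < card (?S w)" for l
      using s fin by (intro psubset_card_mono) auto
    moreover have "finite {i. w1 l i \<noteq> o'}" for l
      by (rule finite_subset[of _ "{..<P} \<union> {i. w i \<noteq> o'}"]) (use I less.prems in \<open>auto simp: w1_def\<close>)
    ultimately have "\<forall>l. \<exists>f. f \<in> chart_polys \<and> (\<forall>\<Omega>\<in>chart_domain. \<Omega> (bword \<xi> o' (w1 l)) = f (chart \<Omega>))"
      using less.hyps unfolding Bex_def by simp
    from choice[OF this] obtain f1 where f1: "\<forall>l. f1 l \<in> chart_polys \<and> (\<forall>\<Omega>\<in>chart_domain. \<Omega> (bword \<xi> o' (w1 l)) = f1 l (chart \<Omega>))" ..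
    have "?S (w2 j) \<subseteq> ?S w - {s'}" for j using I s' by (auto simp: w2_def split: if_splits)
    then have "card (?S (w2 j)) < card (?S w)" for j
      using s' fin by (intro psubset_card_mono) auto
    moreover have "finite {i. w2 j i \<noteq> o'}" for j
      by (rule finite_subset[of _ "{..<P} \<union> {i. w i \<noteq> o'}"]) (use I less.prems in \<open>auto simp: w2_def\<close>)
    ultimately have "\<forall>j. \<exists>f. f \<in> chart_polys \<and> (\<forall>\<Omega>\<in>chart_domain. \<Omega> (bword \<xi> o' (w2 j)) = f (chart \<Omega>))"
      using less.hyps unfolding Bex_def by simp
    from choice[OF this] obtain f2 where f2: "\<forall>j. f2 j \<in> chart_polys \<and> (\<forall>\<Omega>\<in>chart_domain. \<Omega> (bword \<xi> o' (w2 j)) = f2 j (chart \<Omega>))" ..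
    let ?f = "\<lambda>a. \<Sum>j<k. (\<Sum>l<k. a 0 (Inr (j, l)) * f1 l a) * f2 j a"
    have "(\<lambda>a. a 0 (Inr (j, l))) \<in> chart_polys" if "j \<in> {..<k}" "l \<in> {..<k}" for j l
    proof -
      have "Inr (j, l) \<in> chart_index k P" using that by (auto simp: chart_index_def)
      then show ?thesis by (rule polys_coordinate)
    qed
    then have "?f \<in> chart_polys" using f1 f2 by (intro polys_sum polys.mult) auto
    moreover have "\<Omega> (bword \<xi> o' w) = ?f (chart \<Omega>)" if \<Omega>: "\<Omega> \<in> chart_domain" for \<Omega>
    proof -
      let ?M = "\<lambda>a b. \<Omega> (mix ?I ((?ys(k := bword \<xi> o' w)) a) ((?zs(k := bword \<xi> o' w)) b))"
      have "\<forall>a<Suc k. adm \<xi> ((?ys(k := bword \<xi> o' w)) a)" "\<forall>b<Suc k. adm \<xi> ((?zs(k := bword \<xi> o' w)) b)"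
        using adm_bword[OF less.prems] by simp_all
      then have "minor (Suc k) ?M = 0"
        using \<Omega> unfolding chart_domain_def rank_lt_def flattening_minor_def by blast
      moreover have "left_inverse k (block_inverse \<Omega>) ?M"
        using block_inverse[OF \<Omega>] by (simp add: left_inverse_def block_def mix3)
      ultimately have "?M k k = (\<Sum>j<k. (\<Sum>l<k. block_inverse \<Omega> j l * ?M l k) * ?M k j)"
        by (intro bordered_minor_zero) simp_all
      also have "\<dots> = (\<Sum>j<k. (\<Sum>l<k. block_inverse \<Omega> j l * \<Omega> (bword \<xi> o' (w1 l))) * \<Omega> (bword \<xi> o' (w2 j)))"
        by (simp add: mix1 mix2)
      also have "\<dots> = ?f (chart \<Omega>)" using f1 f2 \<Omega> by (simp add: chart_def)
      finally show ?thesis by (simp add: mix4)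
    qed
    ultimately show ?thesis by (intro bexI[of _ ?f]) auto
  qed
qed

lemma value_in_chart:
  assumes \<xi>: "vec_nth \<xi> o' \<noteq> 0" and I: "I \<subseteq> {..<P}" and y: "adm \<xi> y"
  shows "\<exists>f\<in>chart_polys. \<forall>\<Omega>\<in>chart_domain. \<Omega> y = f (chart \<Omega>)"
proof -
  have *: "\<exists>f\<in>chart_polys. \<forall>\<Omega>\<in>chart_domain. \<Omega> y = f (chart \<Omega>)"
    if "adm \<xi> y" "\<And>i. i \<ge> p \<Longrightarrow> y i \<in> range (bvec \<xi> o')" for p y
    using that
  proof (induction p arbitrary: y)
    case 0
    define w where "w i = (if y i = \<xi> then o' else (SOME j. bvec \<xi> o' j = y i))" for i
    have "bvec \<xi> o' (w i) = y i" for i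
    proof (cases "y i = \<xi>")
      case False
      obtain j where "bvec \<xi> o' j = y i" using 0(2)[of i] by auto
      then have "bvec \<xi> o' (SOME j. bvec \<xi> o' j = y i) = y i" by (rule someI)
      then show ?thesis using False by (simp add: w_def)
    qed (simp add: w_def)
    then have "y = bword \<xi> o' w" by (simp add: bword_def)
    moreover have "finite {i. w i \<noteq> o'}"
      by (rule finite_subset[OF _ 0(1)[unfolded adm_def]]) (auto simp: w_def)
    ultimately show ?case using basis_word_in_chart[OF I] by simp
  next
    case (Suc p)
    obtain c where c: "y p = (\<Sum>j\<in>UNIV. c j *s bvec \<xi> o' j)" using bvec_expand[OF \<xi>] by blast
    have "\<exists>f. f \<in> chart_polys \<and> (\<forall>\<Omega>\<in>chart_domain. \<Omega> (y(p := bvec \<xi> o' j)) = f (chart \<Omega>))" for j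
      unfolding Bex_def[symmetric]
    proof (rule Suc.IH)
      show "adm \<xi> (y(p := bvec \<xi> o' j))" using Suc.prems(1) by (rule adm_upd)
      show "(y(p := bvec \<xi> o' j)) i \<in> range (bvec \<xi> o')" if "i \<ge> p" for i
        using Suc.prems(2)[of i] that by (cases "i = p") auto
    qed
    from choice[OF allI[OF this]] obtain f
      where f: "\<forall>j. f j \<in> chart_polys \<and> (\<forall>\<Omega>\<in>chart_domain. \<Omega> (y(p := bvec \<xi> o' j)) = f j (chart \<Omega>))" ..
    let ?f = "\<lambda>a. \<Sum>j\<in>UNIV. c j * f j a"
    have "?f \<in> chart_polys" using f by (intro polys_sum polys.mult polys.const) auto
    moreover have "\<Omega> y = ?f (chart \<Omega>)" if \<Omega>: "\<Omega> \<in> chart_domain" for \<Omega>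
    proof -
      have ml: "multilin \<xi> \<Omega>" using \<Omega> by (simp add: chart_domain_def rank_lt_def)
      have "y = y(p := \<Sum>j\<in>UNIV. c j *s bvec \<xi> o' j)" unfolding c[symmetric] by simp
      then have "\<Omega> y = \<Omega> (y(p := \<Sum>j\<in>UNIV. c j *s bvec \<xi> o' j))" by (rule arg_cong)
      also have "\<dots> = (\<Sum>j\<in>UNIV. c j * \<Omega> (y(p := bvec \<xi> o' j)))"
        by (rule multilin_sum[OF ml Suc.prems(1)]) simp
      finally show ?thesis using f \<Omega> by simp
    qed
    ultimately show ?case by (intro bexI[of _ ?f]) auto
  qed
  obtain p where p: "{i. y i \<noteq> \<xi>} \<subseteq> {..<p}" using y unfolding adm_def by (auto simp: finite_nat_iff_bounded)
  have "y i \<in> range (bvec \<xi> o')" if "i \<ge> p" for i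
  proof -
    have "y i = bvec \<xi> o' o'" using p that by auto
    then show ?thesis by blast
  qed
  then show ?thesis using *[OF y] by blast
qed

text \<open>
  An increasing map of the rows of the chart can be realized, on finitely many rows, by a permutation
  of positions that fixes the first \<open>P\<close> positions, and hence the block.
\<close>

lemma chart_shift:
  assumes I: "I \<subseteq> {..<P}" and \<pi>: "strict_mono (\<pi> :: nat \<Rightarrow> nat)"
  shows "\<exists>g\<in>carrier (G_inf :: ('k, 'n) gelem monoid). \<forall>\<Omega>. block (\<Omega> \<circ> gact g) = block \<Omega> \<and>
     (\<forall>i<m. chart (\<Omega> \<circ> gact g) i = chart \<Omega> (\<pi> i))"
proof -
  let ?A = "{..<P} \<union> (\<lambda>i. P + \<pi> i) ` {..<m}"
  \<comment> \<open>the substitution \<open>y \<circ> \<sigma>\<close> moves the letter in position \<open>P + i\<close> to position \<open>P + \<pi> i\<close>\<close>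
  define f where "f p = (if p < P then p else P + inv_into UNIV \<pi> (p - P))" for p
  have inj: "inj \<pi>" using \<pi> by (rule strict_mono_imp_inj_on)
  have f\<pi>: "f (P + \<pi> i) = P + i" for i using inj by (simp add: f_def)
  have "inj_on f ?A"
  proof (rule inj_onI)
    fix p q assume p: "p \<in> ?A" and q: "q \<in> ?A" and eq: "f p = f q"
    have lt: "f p = p \<and> p < P \<or> (\<exists>i. p = P + \<pi> i \<and> f p = P + i)" if pA: "p \<in> ?A" for p
    proof (cases "p < P")
      case True
      then show ?thesis by (simp add: f_def)
    next
      case False
      then obtain i where "p = P + \<pi> i" using pA by auto
      then show ?thesis using f\<pi> by blast
    qed
    show "p = q" using lt[OF p] lt[OF q] eq by auto
  qed
  from extend_to_permutation[OF _ this]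
  obtain q \<sigma> where \<sigma>: "\<sigma> permutes {..<q}" and \<sigma>f: "\<forall>p\<in>?A. \<sigma> p = f p" by auto
  have fix1: "\<sigma> p = p" if "p < P" for p using \<sigma>f that by (auto simp: f_def)
  have \<sigma>\<pi>: "\<sigma> (P + \<pi> i) = P + i" if "i < m" for i using \<sigma>f that f\<pi>[of i] by auto
  have inj\<sigma>: "\<sigma> a = \<sigma> b \<longleftrightarrow> a = b" for a b using permutes_inj[OF \<sigma>] by (simp add: inj_eq)
  have ge: "\<sigma> p \<ge> P" if "p \<ge> P" for p
    using fix1[of "\<sigma> p"] inj\<sigma>[of "\<sigma> p" p] that by (cases "\<sigma> p < P") auto
  let ?g = "(\<sigma>, \<lambda>_. Finite_Cartesian_Product.mat 1) :: ('k, 'n) gelem"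
  have "invertible (Finite_Cartesian_Product.mat 1 :: 'k ^ 'n ^ 'n)"
    by (auto simp: invertible_def intro!: exI[of _ "Finite_Cartesian_Product.mat 1"])
  then have g: "?g \<in> carrier G_inf" unfolding G_inf_iff using \<sigma> by auto
  have act: "gact ?g y = (\<lambda>p. y (\<sigma> p))" for y by (simp add: gact_def)
  have b: "block (\<Omega> \<circ> gact ?g) = block \<Omega>" for \<Omega>
  proof -
    have "(\<lambda>p. mix I (wseq \<xi> o' P u) (wseq \<xi> o' P v) (\<sigma> p)) = mix I (wseq \<xi> o' P u) (wseq \<xi> o' P v)" for u v
    proof
      fix p show "mix I (wseq \<xi> o' P u) (wseq \<xi> o' P v) (\<sigma> p) = mix I (wseq \<xi> o' P u) (wseq \<xi> o' P v) p"
        using fix1[of p] ge[of p] I by (cases "p < P") (auto simp: mix_def wseq_def)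
    qed
    then show ?thesis by (simp add: block_def act)
  qed
  have "chart (\<Omega> \<circ> gact ?g) i = chart \<Omega> (\<pi> i)" if i: "i < m" for \<Omega> i
  proof
    fix c
    have "word1 o' P u j i (\<sigma> p) = word1 o' P u j (\<pi> i) p" for u j p
      using fix1[of p] ge[of p] inj\<sigma>[of p "P + \<pi> i"] \<sigma>\<pi>[OF i] by (cases "p < P") (auto simp: word1_def)
    then show "chart (\<Omega> \<circ> gact ?g) i c = chart \<Omega> (\<pi> i) c"
      by (auto simp: chart_def act bword_def block_inverse_def b split: sum.split)
  qed
  then show ?thesis using g b by (intro bexI[of _ ?g]) auto
qed

text \<open>
  Express the elements of \<open>F\<close> as polynomials in the chart, which involve only finitely many rows. By
  \<open>chart_shift\<close> the values of their increasing translates are values of elements of \<open>F\<close> at translates of the form.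
\<close>

lemma chart_noetherian:
  assumes \<xi>: "vec_nth \<xi> o' \<noteq> 0" and I: "I \<subseteq> {..<P}" and F: "F \<subseteq> form_polys \<xi>"
  shows "\<exists>F0\<subseteq>F. finite F0 \<and> (\<forall>\<Omega>\<in>chart_domain.
    (\<forall>f\<in>F0. \<forall>g\<in>carrier G_inf. f (\<Omega> \<circ> gact g) = 0) \<longrightarrow> (\<forall>f\<in>F. f \<Omega> = 0))"
proof -
  have "\<forall>f\<in>F. \<exists>h. h \<in> chart_polys \<and> (\<forall>\<Omega>\<in>chart_domain. f \<Omega> = h (chart \<Omega>))"
  proof
    fix f assume "f \<in> F"
    then have "f \<in> polys {(\<lambda>\<Omega>. \<Omega> y) | y. adm \<xi> y}" using F by (auto simp: form_polys_def)
    then show "\<exists>h. h \<in> chart_polys \<and> (\<forall>\<Omega>\<in>chart_domain. f \<Omega> = h (chart \<Omega>))"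
      unfolding Bex_def[symmetric] by (rule polys_pullback) (use value_in_chart[OF \<xi> I] in blast)
  qed
  from bchoice[OF this] obtain \<phi>
    where \<phi>: "\<forall>f\<in>F. \<phi> f \<in> chart_polys \<and> (\<forall>\<Omega>\<in>chart_domain. f \<Omega> = \<phi> f (chart \<Omega>))" ..
  have ne: "chart_index k P \<noteq> ({} :: ('n list \<times> 'n + nat \<times> nat) set)"
  proof -
    have "Inl (replicate P o', o') \<in> (chart_index k P :: ('n list \<times> 'n + nat \<times> nat) set)" by (auto simp: chart_index_def)
    then show ?thesis by blast
  qed
  have "\<phi> ` F \<subseteq> chart_polys" using \<phi> by blast
  from polys_noetherian[OF finite_chart_index ne this]
  obtain G where G: "G \<subseteq> \<phi> ` F" "finite G"
    and Gz: "\<forall>a. (\<forall>f\<in>G. \<forall>\<pi> :: nat \<Rightarrow> nat. strict_mono \<pi> \<longrightarrow> f (a \<circ> \<pi>) = 0) \<longrightarrow> (\<forall>f\<in>\<phi> ` F. f a = 0)"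
    by (elim exE conjE)
  obtain F0 where F0: "F0 \<subseteq> F" "finite F0" "G = \<phi> ` F0" using finite_subset_image[OF G(2,1)] by blast
  have "\<forall>f\<in>F. f \<Omega> = 0" if \<Omega>: "\<Omega> \<in> chart_domain"
    and z: "\<forall>f\<in>F0. \<forall>g\<in>carrier G_inf. f (\<Omega> \<circ> gact g) = 0" for \<Omega>
  proof -
    have "\<phi> f (chart \<Omega> \<circ> \<pi>) = 0" if f: "f \<in> F0" and \<pi>: "strict_mono \<pi>" for f \<pi>
    proof -
      have fF: "\<phi> f \<in> chart_polys" "\<forall>\<Omega>\<in>chart_domain. f \<Omega> = \<phi> f (chart \<Omega>)" using \<phi> F0(1) f by auto
      obtain m where m: "\<forall>a a'. (\<forall>j<m. a j = a' j) \<longrightarrow> \<phi> f a = \<phi> f a'"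
        using polys_finite_dependence[OF fF(1)] by blast
      obtain g where g: "g \<in> carrier (G_inf :: ('k, 'n) gelem monoid)" "block (\<Omega> \<circ> gact g) = block \<Omega>"
        "\<forall>i<m. chart (\<Omega> \<circ> gact g) i = chart \<Omega> (\<pi> i)" using chart_shift[OF I \<pi>, of m] by blast
      have "\<Omega> \<circ> gact g \<in> chart_domain" using \<Omega> g(2) rank_lt_gact[OF g(1)] by (simp add: chart_domain_def)
      then have "f (\<Omega> \<circ> gact g) = \<phi> f (chart (\<Omega> \<circ> gact g))" using fF(2) by blast
      also have "\<dots> = \<phi> f (chart \<Omega> \<circ> \<pi>)" by (rule m[rule_format]) (use g(3) in simp)
      finally have "f (\<Omega> \<circ> gact g) = \<phi> f (chart \<Omega> \<circ> \<pi>)" .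
      moreover have "f (\<Omega> \<circ> gact g) = 0" using z f g(1) by blast
      ultimately show ?thesis by simp
    qed
    then have "\<forall>f\<in>\<phi> ` F. f (chart \<Omega>) = 0" using Gz unfolding F0(3) by blast
    then show ?thesis using \<phi> \<Omega> by simp
  qed
  then show ?thesis using F0 by blast
qed

end

section \<open>Noetherianity of bounded flattening rank\<close>

lemma gact_inverse:
  assumes "g \<in> carrier G_inf" shows "gact g (gact (inv\<^bsub>G_inf\<^esub> g) y) = y"
proof -
  interpret group "G_inf :: ('a, 'b) gelem monoid" by (rule group_G_inf)
  have "gact g (gact (inv\<^bsub>G_inf\<^esub> g) y) = gact \<one>\<^bsub>G_inf\<^esub> y" using assms by (simp add: gact_comp)
  then show ?thesis by (simp add: gact_def G_inf_def)
qed

text \<open>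
  For the forms of smaller rank the claim holds by induction. A form of flattening rank
  exactly \<open>k\<close> has a translate \<open>\<Omega> \<circ> gact g\<close> in one of finitely many chart domains. There the claim is known,
  but on this translate the vanishing of \<open>f\<close> at \<open>\<Omega>\<close> becomes the vanishing of the translate of
  \<open>f\<close> by the inverse of \<open>g\<close>. This is why charts are used with the set \<open>GF\<close> of all translates of \<open>F\<close>.
\<close>

theorem rank_lt_noetherian:
  fixes \<xi> :: "'k::field ^ 'n::finite"
  assumes inf: "infinite (UNIV :: 'k set)" and \<xi>: "vec_nth \<xi> o' \<noteq> 0" and F: "F \<subseteq> form_polys \<xi>"
  shows "\<exists>F0\<subseteq>F. finite F0 \<and> (\<forall>\<Omega>\<in>rank_lt \<xi> k.
    (\<forall>f\<in>F0. \<forall>g\<in>carrier G_inf. f (\<Omega> \<circ> gact g) = 0) \<longrightarrow> (\<forall>f\<in>F. f \<Omega> = 0))"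
proof (induction k)
  case 0
  have "rank_lt \<xi> 0 = {}" by (auto simp: rank_lt_def flattening_minor_def minor_def)
  then show ?case by (intro exI[of _ "{}"]) simp
next
  case (Suc k)
  then obtain F1 where F1: "F1 \<subseteq> F" "finite F1" and F1z: "\<forall>\<Omega>\<in>rank_lt \<xi> k.
    (\<forall>f\<in>F1. \<forall>g\<in>carrier G_inf. f (\<Omega> \<circ> gact g) = 0) \<longrightarrow> (\<forall>f\<in>F. f \<Omega> = 0)" by (elim exE conjE)
  interpret group "G_inf :: ('k, 'n) gelem monoid" by (rule group_G_inf)
  let ?P = "2 * k"
  let ?tr = "\<lambda>(f :: ('k, 'n) form \<Rightarrow> 'k, g). \<lambda>\<Omega>. f (\<Omega> \<circ> gact g)"
  \<comment> \<open>translates are kept as pairs, to recover the finitely many elements of \<open>F\<close> that they come from\<close>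
  define GF where "GF = ?tr ` (F \<times> carrier G_inf)"
  have GF: "GF \<subseteq> form_polys \<xi>"
  proof
    fix e assume "e \<in> GF"
    then obtain f g where e: "f \<in> F" "g \<in> carrier G_inf" "e = (\<lambda>\<Omega>. f (\<Omega> \<circ> gact g))"
      unfolding GF_def by auto
    then show "e \<in> form_polys \<xi>" using form_polys_gact[OF e(2) subsetD[OF F e(1)]] by simp
  qed
  define D where "D = Pow {..<?P} \<times> (words k ?P :: 'n list list set) \<times> (words k ?P :: 'n list list set)"
  have "finite D" by (simp add: D_def finite_words)
  have "\<forall>d\<in>D. \<exists>E. E \<subseteq> F \<times> carrier G_inf \<and> finite E \<and>
    (\<forall>\<Omega>\<in>chart_domain \<xi> o' k ?P (fst d) (fst (snd d)) (snd (snd d)).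
      (\<forall>f\<in>?tr ` E. \<forall>g\<in>carrier G_inf. f (\<Omega> \<circ> gact g) = 0) \<longrightarrow> (\<forall>f\<in>GF. f \<Omega> = 0))"
  proof
    fix d assume "d \<in> D"
    then have "fst d \<subseteq> {..<?P}" by (auto simp: D_def)
    from chart_noetherian[OF \<xi> this GF, where k = k and \<rho> = "fst (snd d)" and \<gamma> = "snd (snd d)"]
    obtain E' where E': "E' \<subseteq> ?tr ` (F \<times> carrier G_inf)" "finite E'" "\<forall>\<Omega>\<in>chart_domain \<xi> o' k ?P (fst d) (fst (snd d)) (snd (snd d)).
      (\<forall>f\<in>E'. \<forall>g\<in>carrier G_inf. f (\<Omega> \<circ> gact g) = 0) \<longrightarrow> (\<forall>f\<in>GF. f \<Omega> = 0)"
      unfolding GF_def[symmetric] by (elim exE conjE)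
    obtain E where E: "E \<subseteq> F \<times> carrier G_inf" "finite E" "E' = ?tr ` E" using finite_subset_image[OF E'(2,1)] by blast
    show "\<exists>E. E \<subseteq> F \<times> carrier G_inf \<and> finite E \<and>
    (\<forall>\<Omega>\<in>chart_domain \<xi> o' k ?P (fst d) (fst (snd d)) (snd (snd d)).
      (\<forall>f\<in>?tr ` E. \<forall>g\<in>carrier G_inf. f (\<Omega> \<circ> gact g) = 0) \<longrightarrow> (\<forall>f\<in>GF. f \<Omega> = 0))"
      using E E'(3) by (intro exI[of _ E]) simp
  qed
  from bchoice[OF this] obtain E where E: "\<forall>d\<in>D. E d \<subseteq> F \<times> carrier G_inf \<and> finite (E d) \<and>
    (\<forall>\<Omega>\<in>chart_domain \<xi> o' k ?P (fst d) (fst (snd d)) (snd (snd d)).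
      (\<forall>f\<in>?tr ` E d. \<forall>g\<in>carrier G_inf. f (\<Omega> \<circ> gact g) = 0) \<longrightarrow> (\<forall>f\<in>GF. f \<Omega> = 0))" ..
  define F0 where "F0 = F1 \<union> (\<Union>d\<in>D. fst ` E d)"
  have EF: "E d \<subseteq> F \<times> carrier G_inf" "finite (E d)" if "d \<in> D" for d using E that by blast+
  have "fst ` E d \<subseteq> F" if "d \<in> D" for d using EF(1)[OF that] by auto
  then have F0: "F0 \<subseteq> F" "finite F0" using F1 EF(2) \<open>finite D\<close> unfolding F0_def by (blast, simp)
  have "f \<Omega> = 0" if \<Omega>: "\<Omega> \<in> rank_lt \<xi> (Suc k)"
    and z: "\<forall>f\<in>F0. \<forall>g\<in>carrier G_inf. f (\<Omega> \<circ> gact g) = 0" and f: "f \<in> F" for \<Omega> f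
  proof (cases "\<Omega> \<in> rank_lt \<xi> k")
    case True
    then show ?thesis using F1z z f by (simp add: F0_def)
  next
    case False
    have "multilin \<xi> \<Omega>" using \<Omega> by (simp add: rank_lt_def)
    from detect_rank[OF inf \<xi> this False refl]
    obtain g I \<rho> \<gamma> where g: "g \<in> carrier G_inf" and d: "(I, \<rho>, \<gamma>) \<in> D"
      and nz: "flattening_minor (\<Omega> \<circ> gact g) k I (\<lambda>a. wseq \<xi> o' ?P (\<rho> ! a)) (\<lambda>b. wseq \<xi> o' ?P (\<gamma> ! b)) \<noteq> 0"
      unfolding D_def by blast
    have dom: "\<Omega> \<circ> gact g \<in> chart_domain \<xi> o' k ?P I \<rho> \<gamma>"
      using rank_lt_gact[OF g \<Omega>] nz by (simp add: chart_domain_def block_def flattening_minor_def)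
    have "e (\<Omega> \<circ> gact g \<circ> gact h) = 0" if eE: "e \<in> ?tr ` E (I, \<rho>, \<gamma>)" and h: "h \<in> carrier G_inf" for e h
    proof -
      obtain f' g' where e: "(f', g') \<in> E (I, \<rho>, \<gamma>)" "e = (\<lambda>\<Omega>. f' (\<Omega> \<circ> gact g'))" using eE by auto
      have "f' \<in> fst ` E (I, \<rho>, \<gamma>)" by (rule image_eqI[OF _ e(1)]) simp
      then have f': "f' \<in> F0" using d unfolding F0_def by blast
      have g': "g' \<in> carrier G_inf" using e(1) EF(1)[OF d] by auto
      have "\<Omega> \<circ> gact g \<circ> gact h \<circ> gact g' = \<Omega> \<circ> gact (g' \<otimes>\<^bsub>G_inf\<^esub> h \<otimes>\<^bsub>G_inf\<^esub> g)"
        using g g' h by (simp add: fun_eq_iff gact_comp m_assoc)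
      then show ?thesis using z f' g g' h by (simp add: e(2))
    qed
    moreover have "\<forall>\<Omega>\<in>chart_domain \<xi> o' k ?P I \<rho> \<gamma>.
      (\<forall>f\<in>?tr ` E (I, \<rho>, \<gamma>). \<forall>g\<in>carrier G_inf. f (\<Omega> \<circ> gact g) = 0) \<longrightarrow> (\<forall>f\<in>GF. f \<Omega> = 0)"
      using bspec[OF E d] by simp
    ultimately have z1: "\<forall>e\<in>GF. e (\<Omega> \<circ> gact g) = 0" using dom by blast
    have "(\<lambda>\<Omega>. f (\<Omega> \<circ> gact (inv\<^bsub>G_inf\<^esub> g))) \<in> GF" unfolding GF_def
      by (rule image_eqI[of _ _ "(f, inv\<^bsub>G_inf\<^esub> g)"]) (simp_all add: f g)
    from bspec[OF z1 this] have "f (\<Omega> \<circ> gact g \<circ> gact (inv\<^bsub>G_inf\<^esub> g)) = 0" .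
    moreover have "\<Omega> \<circ> gact g \<circ> gact (inv\<^bsub>G_inf\<^esub> g) = \<Omega>" by (rule ext) (simp add: gact_inverse[OF g])
    ultimately show ?thesis by simp
  qed
  then show ?case using F0 by blast
qed

section \<open>Points as multilinear forms\<close>

text \<open>
  The pairing of a tensor with the tensor product of the covectors \<open>y 0, \<dots>, y (p - 1)\<close>.
\<close>

definition ev :: "nat \<Rightarrow> ('k::field, 'n::finite) tensor \<Rightarrow> (nat \<Rightarrow> 'k ^ 'n) \<Rightarrow> 'k" where
  "ev p t y = (\<Sum>l | length l = p. (\<Prod>i<p. vec_nth (y i) (l ! i)) * t l)"

definition covector :: "('k ^ 'n \<Rightarrow> 'k) \<Rightarrow> ('k::field) ^ ('n::finite)" where
  "covector x0 = (\<chi> j. x0 (axis j 1))"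

lemma finite_length_lists: "finite {l :: 'n::finite list. length l = p}"
  using finite_lists_length_eq[of "UNIV :: 'n set" p] by simp

lemma ev_contract:
  assumes "y p = covector x0" shows "ev (Suc p) t y = ev p (contract x0 t) y"
proof -
  have "ev (Suc p) t y = (\<Sum>m | length m = p. \<Sum>j\<in>UNIV.
      (\<Prod>i<Suc p. vec_nth (y i) ((m @ [j]) ! i)) * t (m @ [j]))"
    unfolding ev_def sum_lists_Suc ..
  also have "\<dots> = (\<Sum>m | length m = p. \<Sum>j\<in>UNIV.
      (\<Prod>i<p. vec_nth (y i) (m ! i)) * (x0 (axis j 1) * t (m @ [j])))"
    by (intro sum.cong refl) (auto simp: nth_append assms covector_def mult.assoc)
  also have "\<dots> = ev p (contract x0 t) y"
    by (simp add: ev_def contract_def sum_distrib_left)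
  finally show ?thesis .
qed

lemma ev_linear:
  assumes "i < p"
  shows "ev p t (y(i := c *s u + v)) = c * ev p t (y(i := u)) + ev p t (y(i := v))"
proof -
  have split: "(\<Prod>j<p. vec_nth ((y(i := w)) j) (l ! j)) = vec_nth w (l ! i) * (\<Prod>j\<in>{..<p} - {i}. vec_nth (y j) (l ! j))"
    for w and l :: "'b list"
    using assms by (subst prod.remove[of _ i]) auto
  define R where "R l = (\<Prod>j\<in>{..<p} - {i}. vec_nth (y j) (l ! j))" for l :: "'b list"
  have E: "ev p t (y(i := w)) = (\<Sum>l | length l = p. vec_nth w (l ! i) * R l * t l)" for w
    unfolding ev_def by (intro sum.cong refl) (simp only: split R_def)
  show ?thesis unfolding E sum_distrib_left sum.distrib[symmetric]
    by (intro sum.cong refl) (simp add: algebra_simps)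
qed

lemma ev_perm_act:
  assumes "\<sigma> permutes {..<p}"
  shows "ev p (perm_act p \<sigma> t) y = ev p t (\<lambda>i. y (\<sigma> i))"
proof -
  have \<sigma>p: "\<sigma> i < p \<longleftrightarrow> i < p" for i using permutes_in_image[OF assms, of i] by simp
  have \<sigma>i: "inv_into UNIV \<sigma> i < p \<longleftrightarrow> i < p" for i
    using permutes_in_image[OF permutes_inv[OF assms], of i] by simp
  let ?r = "\<lambda>m. map (\<lambda>i. m ! \<sigma> i) [0..<p]" and ?r' = "\<lambda>m. map (\<lambda>i. m ! inv_into UNIV \<sigma> i) [0..<p]"
  show ?thesis unfolding ev_def
  proof (rule sum.reindex_bij_witness[where i = ?r' and j = ?r])
    fix l :: "'b list" assume l: "l \<in> {l. length l = p}"
    show "?r' (?r l) = l" using l \<sigma>i permutes_inverses[OF assms] by (auto intro!: nth_equalityI)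
    show "?r (?r' l) = l" using l \<sigma>p permutes_inverses[OF assms] by (auto intro!: nth_equalityI)
    have "(\<Prod>i<p. vec_nth (y (\<sigma> i)) (?r l ! i)) = (\<Prod>i<p. vec_nth (y (\<sigma> i)) (l ! \<sigma> i))"
      by (intro prod.cong) auto
    also have "\<dots> = (\<Prod>i<p. vec_nth (y i) (l ! i))"
      using prod.permute[OF assms, of "\<lambda>i. vec_nth (y i) (l ! i)"] by (simp add: o_def)
    finally show "(\<Prod>i<p. vec_nth (y (\<sigma> i)) (?r l ! i)) * t (?r l)
       = (\<Prod>i<p. vec_nth (y i) (l ! i)) * perm_act p \<sigma> t l"
      using l by (simp add: perm_act_def)
  qed auto
qed

lemma ev_gl_act: "ev p (gl_act p h t) y = ev p t (\<lambda>i. y i v* h i)"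
proof -
  let ?L = "{l :: 'b list. length l = p}"
  have "ev p (gl_act p h t) y = (\<Sum>l\<in>?L. \<Sum>m\<in>?L.
      (\<Prod>i<p. vec_nth (y i) (l ! i) * vec_nth (vec_nth (h i) (l ! i)) (m ! i)) * t m)"
    unfolding ev_def by (intro sum.cong refl) (simp add: gl_act_def sum_distrib_left prod.distrib mult.assoc)
  also have "\<dots> = (\<Sum>m\<in>?L. (\<Sum>l\<in>?L.
      \<Prod>i<p. vec_nth (y i) (l ! i) * vec_nth (vec_nth (h i) (l ! i)) (m ! i)) * t m)"
    by (subst sum.swap) (simp add: sum_distrib_right)
  also have "\<dots> = ev p t (\<lambda>i. y i v* h i)"
    unfolding sum_lists_prod[where F = "\<lambda>i j. vec_nth (y i) j * vec_nth (vec_nth (h i) j) (_ ! i)"]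
    by (simp add: ev_def vector_matrix_mult_def)
  finally show ?thesis .
qed

lemma ev_tensor_act:
  assumes "g \<in> carrier (G_fin p)" shows "ev p (tensor_act p g t) y = ev p t (gact g y)"
proof -
  have "fst g permutes {..<p}" using assms by (auto simp: G_fin_def)
  then show ?thesis by (simp add: tensor_act_def ev_perm_act ev_gl_act gact_def)
qed

lemma ev_tprod: "ev p (tprod p v) y = (\<Prod>i<p. \<Sum>j\<in>UNIV. vec_nth (y i) j * vec_nth (v i) j)"
proof -
  have "ev p (tprod p v) y = (\<Sum>l | length l = p. \<Prod>i<p. vec_nth (y i) (l ! i) * vec_nth (v i) (l ! i))"
    unfolding ev_def by (intro sum.cong refl) (simp add: tprod_def prod.distrib)
  then show ?thesis using sum_lists_prod[of "\<lambda>i j. vec_nth (y i) j * vec_nth (v i) j" p] by simp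
qed

lemma ev_sum: "ev p (\<lambda>l. \<Sum>s<k. c s * T s l) y = (\<Sum>s<k. c s * ev p (T s) y)"
proof -
  have "ev p (\<lambda>l. \<Sum>s<k. c s * T s l) y = (\<Sum>l | length l = p. \<Sum>s<k. c s * ((\<Prod>i<p. vec_nth (y i) (l ! i)) * T s l))"
    unfolding ev_def by (intro sum.cong refl) (simp add: sum_distrib_left mult.left_commute)
  also have "\<dots> = (\<Sum>s<k. \<Sum>l | length l = p. c s * ((\<Prod>i<p. vec_nth (y i) (l ! i)) * T s l))"
    by (rule sum.swap)
  finally show ?thesis by (simp add: ev_def sum_distrib_left)
qed

lemma ev_coordinate:
  fixes t :: "('k::field, 'n::finite) tensor"
  assumes "length l = p"
  shows "ev p t (\<lambda>i. if i < p then axis (l ! i) 1 else z i) = t l"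
proof -
  have "ev p t (\<lambda>i. if i < p then axis (l ! i) 1 else z i) = (\<Sum>m | length m = p. if m = l then t m else 0)"
    unfolding ev_def
  proof (intro sum.cong refl)
    fix m :: "'n list" assume "m \<in> {m. length m = p}"
    then have m: "length m = p" by simp
    show "(\<Prod>i<p. vec_nth (if i < p then axis (l ! i) 1 else z i) (m ! i)) * t m = (if m = l then t m else 0)"
    proof (cases "m = l")
      case False
      then obtain i where "i < p" "m ! i \<noteq> l ! i" using m assms by (auto simp: list_eq_iff_nth_eq)
      then have "(\<Prod>i<p. vec_nth (if i < p then axis (l ! i) 1 else z i) (m ! i)) = 0"
        by (intro prod_zero) (auto simp: axis_def intro!: bexI[of _ i])
      then show ?thesis using False by simp
    qed (simp add: axis_def)
  qed
  then show ?thesis using assms by (simp add: sum.delta finite_length_lists)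
qed

definition form_of :: "('k ^ 'n \<Rightarrow> 'k) \<Rightarrow> (nat \<Rightarrow> ('k::field, 'n::finite) tensor) \<Rightarrow> ('k, 'n) form" where
  "form_of x0 \<omega> y = (if adm (covector x0) y
     then let p = (LEAST p. \<forall>i\<ge>p. y i = covector x0) in ev p (\<omega> p) y else 0)"

lemma adm_iff: "adm \<xi> y \<longleftrightarrow> (\<exists>p. \<forall>i\<ge>p. y i = \<xi>)"
proof
  assume "adm \<xi> y"
  then obtain p where "{i. y i \<noteq> \<xi>} \<subseteq> {..<p}" unfolding adm_def by (auto simp: finite_nat_iff_bounded)
  then show "\<exists>p. \<forall>i\<ge>p. y i = \<xi>" by (intro exI[of _ p]) auto
next
  assume "\<exists>p. \<forall>i\<ge>p. y i = \<xi>"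
  then obtain p where "\<forall>i\<ge>p. y i = \<xi>" ..
  then have "i < p" if "y i \<noteq> \<xi>" for i using that by (cases "i < p") auto
  then have "{i. y i \<noteq> \<xi>} \<subseteq> {..<p}" by blast
  then show "adm \<xi> y" unfolding adm_def by (rule finite_subset) simp
qed

lemma ev_stable:
  assumes "\<omega> \<in> A_inf x0" "\<forall>i\<ge>p. y i = covector x0" "p \<le> q"
  shows "ev q (\<omega> q) y = ev p (\<omega> p) y"
  using assms(3)
proof (induction q rule: dec_induct)
  case (step q)
  have "contract x0 (\<omega> (Suc q)) = \<omega> q" using assms(1) by (simp add: A_inf_def)
  then show ?case using ev_contract[of y q x0] assms(2) step by simp
qed simp

text \<open>
  The value does not depend on the number of positions, as contraction with \<open>x0\<close> is pairing with \<open>\<xi>\<close>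
  in the last position.
\<close>

lemma form_of_eq:
  assumes "\<omega> \<in> A_inf x0" "\<forall>i\<ge>p. y i = covector x0"
  shows "form_of x0 \<omega> y = ev p (\<omega> p) y"
proof -
  let ?Q = "\<lambda>p. \<forall>i\<ge>p. y i = covector x0"
  have "adm (covector x0) y" unfolding adm_iff using assms(2) by blast
  moreover have Q: "?Q (Least ?Q)" by (rule LeastI[of ?Q, OF assms(2)])
  have L: "Least ?Q \<le> p" by (rule Least_le[of ?Q, OF assms(2)])
  ultimately show ?thesis by (simp only: form_of_def Let_def if_True ev_stable[OF assms(1) Q L])
qed

lemma multilin_form_of:
  assumes "\<omega> \<in> A_inf x0" shows "multilin (covector x0) (form_of x0 \<omega>)"
  unfolding multilin_def
proof (intro allI impI)
  fix y i u v c assume "adm (covector x0) y"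
  then obtain p where p: "\<forall>i\<ge>p. y i = covector x0" unfolding adm_iff by blast
  let ?q = "max p (Suc i)"
  have "form_of x0 \<omega> (y(i := w)) = ev ?q (\<omega> ?q) (y(i := w))" for w
    by (rule form_of_eq[OF assms]) (use p in auto)
  then show "form_of x0 \<omega> (y(i := c *s u + v)) = c * form_of x0 \<omega> (y(i := u)) + form_of x0 \<omega> (y(i := v))"
    using ev_linear[of i ?q "\<omega> ?q" y c u v] by (simp del: fun_upd_apply)
qed

lemma form_of_act:
  assumes \<omega>: "\<omega> \<in> A_inf x0" and g: "g \<in> carrier G_inf"
  shows "form_of x0 (A_act x0 g \<omega>) = form_of x0 \<omega> \<circ> gact g"
proof
  fix y
  show "form_of x0 (A_act x0 g \<omega>) y = (form_of x0 \<omega> \<circ> gact g) y"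
  proof (cases "adm (covector x0) y")
    case False
    then show ?thesis using adm_gact_iff[OF g] by (simp add: form_of_def)
  next
    case True
    obtain p where p: "\<forall>i\<ge>p. y i = covector x0" using True unfolding adm_iff by blast
    obtain p' where p': "\<forall>i\<ge>p'. gact g y i = covector x0" using True adm_gact_iff[OF g] unfolding adm_iff by metis
    obtain r where r: "g \<in> carrier (G_fin r)" using g by (auto simp: G_inf_def)
    define q where "q = max r (max p p')"
    have q: "r \<le> q" "p \<le> q" "p' \<le> q" by (auto simp: q_def)
    have "form_of x0 (A_act x0 g \<omega>) y = ev q (A_act x0 g \<omega> q) y"
      by (rule form_of_eq[OF A_act_closed[OF \<omega> g]]) (use p q in auto)
    also have "\<dots> = ev q (\<omega> q) (gact g y)"
      using A_act_eq[OF \<omega> r q(1)] ev_tensor_act[OF subsetD[OF G_fin_mono[OF q(1)] r]] by simp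
    also have "\<dots> = form_of x0 \<omega> (gact g y)"
      by (rule form_of_eq[OF \<omega>, symmetric]) (use p' q in auto)
    finally show ?thesis by simp
  qed
qed

section \<open>Polynomials on tensor powers\<close>

abbreviation tensor_polys :: "nat \<Rightarrow> (('k::field, 'n::finite) tensor \<Rightarrow> 'k) set" where
  "tensor_polys p \<equiv> polys {(\<lambda>t. t l) | l. length l = p}"

lemma tensor_coordinate: "length l = p \<Longrightarrow> (\<lambda>t. t l) \<in> tensor_polys p"
  by (rule polys.gen) blast

lemma tpoly_val_polys:
  assumes "f \<in> T_fin p" shows "tpoly_val f \<in> tensor_polys p"
proof -
  have "(\<lambda>t. \<Sum>m\<in>Poly_Mapping.keys f. Poly_Mapping.lookup f m *
     (\<Prod>l\<in>Poly_Mapping.keys m. t l ^ Poly_Mapping.lookup m l)) \<in> tensor_polys p"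
    by (intro polys_sum polys.mult polys.const polys_prod polys_power tensor_coordinate)
       (use assms in \<open>auto simp: T_fin_def\<close>)
  then show ?thesis by (simp add: tpoly_val_def[abs_def])
qed

lemma T_fin_single: "(\<And>l. l \<in> Poly_Mapping.keys m \<Longrightarrow> length l = p) \<Longrightarrow> Poly_Mapping.single m c \<in> T_fin p"
  by (auto simp: T_fin_def split: if_splits)

lemma polys_tpoly_val:
  fixes f :: "('k::field, 'n::finite) tensor \<Rightarrow> 'k"
  assumes "f \<in> tensor_polys p" shows "\<exists>h\<in>T_fin p. \<forall>t. f t = tpoly_val h t"
  using assms
proof (induction f rule: polys.induct)
  case (const c)
  show ?case by (rule bexI[of _ "Poly_Mapping.single 0 c"]) (auto simp: tpoly_val_single intro!: T_fin_single)
next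
  case (gen f)
  then obtain l where l: "f = (\<lambda>t. t l)" "length l = p" by blast
  show ?case by (rule bexI[of _ "Poly_Mapping.single (Poly_Mapping.single l 1) 1"])
    (auto simp: tpoly_val_single l intro!: T_fin_single)
next
  case (add f g)
  then obtain f' g' where "f' \<in> T_fin p" "\<forall>t. f t = tpoly_val f' t" "g' \<in> T_fin p" "\<forall>t. g t = tpoly_val g' t" by blast
  moreover from this have "f' + g' \<in> T_fin p" using keys_add[of f' g'] by (auto simp: T_fin_def)
  ultimately show ?case by (intro bexI[of _ "f' + g'"]) (simp_all add: tpoly_val_add)
next
  case (mult f g)
  then obtain f' g' where "f' \<in> T_fin p" "\<forall>t. f t = tpoly_val f' t" "g' \<in> T_fin p" "\<forall>t. g t = tpoly_val g' t" by blast
  then show ?case by (intro bexI[of _ "f' * g'"]) (simp_all add: tpoly_val_mult T_fin_mult)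
qed

lemma ev_polys: "(\<lambda>t. ev p t y) \<in> tensor_polys p"
  unfolding ev_def by (intro polys_sum polys.mult polys.const tensor_coordinate) simp

lemma minor_polys:
  assumes "\<And>i j. i < r \<Longrightarrow> j < r \<Longrightarrow> (\<lambda>t. M t i j) \<in> polys V"
  shows "(\<lambda>t. minor r (M t)) \<in> polys V"
  unfolding minor_leibniz
proof (intro polys_sum polys.mult polys.const polys_prod)
  fix \<sigma> i assume "\<sigma> \<in> {\<sigma>. \<sigma> permutes {0..<r}}" "i \<in> {0..<r}"
  then have "i < r" "\<sigma> i < r" using permutes_in_image[of \<sigma> "{0..<r}" i] by auto
  then show "(\<lambda>t. M t i (\<sigma> i)) \<in> polys V" by (rule assms)
qed

text \<open>
  The coordinate at multi-index \<open>l\<close> is the value at the sequence of standard covectors spelled by \<open>l\<close>.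
\<close>

lemma tpoly_as_form_poly:
  fixes x0 :: "'k::field ^ 'n::finite \<Rightarrow> 'k"
  assumes h: "h \<in> T_fin p"
  shows "\<exists>f\<in>form_polys (covector x0). \<forall>\<omega>\<in>A_inf x0. tpoly_val h (\<omega> p) = f (form_of x0 \<omega>)"
proof -
  let ?W = "{(\<lambda>\<Omega>. \<Omega> y) | y. adm (covector x0) y} :: (('k, 'n) form \<Rightarrow> 'k) set"
  have "\<exists>f\<in>polys ?W. \<forall>\<omega>\<in>A_inf x0. tpoly_val h (\<omega> p) = f (form_of x0 \<omega>)"
    using tpoly_val_polys[OF h]
  proof (rule polys_pullback)
    fix f :: "('k, 'n) tensor \<Rightarrow> 'k" assume "f \<in> {(\<lambda>t. t l) | l. length l = p}"
    then obtain l where l: "f = (\<lambda>t. t l)" "length l = p" by blast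
    let ?y = "\<lambda>i. if i < p then axis (l ! i) 1 else covector x0"
    have y: "\<forall>i\<ge>p. ?y i = covector x0" by simp
    then have "adm (covector x0) ?y" unfolding adm_iff by blast
    then have "(\<lambda>\<Omega>. \<Omega> ?y) \<in> polys ?W" by (intro polys.gen) blast
    moreover have "form_of x0 \<omega> ?y = \<omega> p l" if "\<omega> \<in> A_inf x0" for \<omega>
      using form_of_eq[OF that y] ev_coordinate[OF l(2), of "\<omega> p" "\<lambda>_. covector x0"] by simp
    ultimately show "\<exists>f'\<in>polys ?W. \<forall>\<omega>\<in>A_inf x0. f (\<omega> p) = f' (form_of x0 \<omega>)"
      by (intro bexI[of _ "\<lambda>\<Omega>. \<Omega> ?y"]) (simp_all add: l(1))
  qed
  then show ?thesis unfolding form_polys_def .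
qed

section \<open>Border rank\<close>

lemma tensor_rank_le_tprod:
  fixes t :: "('k::field, 'n::finite) tensor"
  assumes "t \<in> tensors p"
  shows "tensor_rank p t \<le> k \<longleftrightarrow> (\<exists>c v. t = (\<lambda>l. \<Sum>i<k. c i * tprod p (v i) l))"
  unfolding tensor_rank_le_iff[OF assms]
proof
  assume "\<exists>s. (\<forall>i<k. s i \<in> pure_tensors p) \<and> t = (\<lambda>l. \<Sum>i<k. s i l)"
  then obtain s where s: "\<forall>i<k. s i \<in> pure_tensors p" "t = (\<lambda>l. \<Sum>i<k. s i l)" by (elim exE conjE)
  have "\<forall>i\<in>{..<k}. \<exists>cv. s i = (\<lambda>l. fst cv * tprod p (snd cv) l)"
    using s(1) by (auto simp: pure_tensors_def)
  from bchoice[OF this] obtain cv where cv: "\<forall>i\<in>{..<k}. s i = (\<lambda>l. fst (cv i) * tprod p (snd (cv i)) l)" ..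
  have "t = (\<lambda>l. \<Sum>i<k. fst (cv i) * tprod p (snd (cv i)) l)" unfolding s(2)
    by (intro ext sum.cong) (use cv in auto)
  then show "\<exists>c v. t = (\<lambda>l. \<Sum>i<k. c i * tprod p (v i) l)" by (intro exI[of _ "\<lambda>i. fst (cv i)"] exI[of _ "\<lambda>i. snd (cv i)"])
next
  assume "\<exists>c v. t = (\<lambda>l. \<Sum>i<k. c i * tprod p (v i) l)"
  then obtain c v where "t = (\<lambda>l. \<Sum>i<k. c i * tprod p (v i) l)" by (elim exE)
  then show "\<exists>s. (\<forall>i<k. s i \<in> pure_tensors p) \<and> t = (\<lambda>l. \<Sum>i<k. s i l)"
    by (intro exI[of _ "\<lambda>i l. c i * tprod p (v i) l"]) (auto simp: pure_tensors_def)
qed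

lemma X_fin_polys:
  fixes t :: "('k::field, 'n::finite) tensor"
  shows "t \<in> X_fin k p \<longleftrightarrow> t \<in> tensors p \<and> (\<forall>f\<in>tensor_polys p.
     (\<forall>s\<in>tensors p. tensor_rank p s \<le> k \<longrightarrow> f s = 0) \<longrightarrow> f t = 0)"
proof
  assume t: "t \<in> X_fin k p"
  show "t \<in> tensors p \<and> (\<forall>f\<in>tensor_polys p. (\<forall>s\<in>tensors p. tensor_rank p s \<le> k \<longrightarrow> f s = 0) \<longrightarrow> f t = 0)"
  proof (intro conjI ballI impI)
    show "t \<in> tensors p" using t by (simp add: X_fin_def zariski_closure_def)
    fix f :: "('k, 'n) tensor \<Rightarrow> 'k"
    assume f: "f \<in> tensor_polys p" and z: "\<forall>s\<in>tensors p. tensor_rank p s \<le> k \<longrightarrow> f s = 0"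
    obtain h where "h \<in> T_fin p" "\<forall>t. f t = tpoly_val h t" using polys_tpoly_val[OF f] by blast
    then show "f t = 0" using t z by (simp add: X_fin_def zariski_closure_def)
  qed
next
  assume "t \<in> tensors p \<and> (\<forall>f\<in>tensor_polys p. (\<forall>s\<in>tensors p. tensor_rank p s \<le> k \<longrightarrow> f s = 0) \<longrightarrow> f t = 0)"
  then show "t \<in> X_fin k p" using tpoly_val_polys[of _ p] by (auto simp: X_fin_def zariski_closure_def)
qed

text \<open>
  Polynomials pull back along \<open>L\<close>, and \<open>L\<close> does not increase the rank.
\<close>

lemma X_fin_linear_image:
  fixes L :: "('k::field, 'n::finite) tensor \<Rightarrow> ('k, 'n) tensor"
  assumes poly: "\<And>l. length l = q \<Longrightarrow> (\<lambda>t. L t l) \<in> tensor_polys p"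
    and closed: "\<And>t. t \<in> tensors p \<Longrightarrow> L t \<in> tensors q"
    and sum: "\<And>k c T. L (\<lambda>l. \<Sum>i<k. c i * T i l) = (\<lambda>l. \<Sum>i<(k::nat). c i * L (T i) l)"
    and pure: "\<And>v. \<exists>c w. L (tprod p v) = (\<lambda>l. c * tprod q w l)"
    and t: "t \<in> X_fin k p"
  shows "L t \<in> X_fin k q"
  unfolding X_fin_polys
proof (intro conjI ballI impI)
  show "L t \<in> tensors q" using t closed by (simp add: X_fin_polys)
  fix f :: "('k, 'n) tensor \<Rightarrow> 'k"
  assume f: "f \<in> tensor_polys q" and z: "\<forall>s\<in>tensors q. tensor_rank q s \<le> k \<longrightarrow> f s = 0"
  have "\<exists>h\<in>tensor_polys p. \<forall>s\<in>UNIV. f (L s) = h s"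
    using f
  proof (rule polys_pullback)
    fix v :: "('k, 'n) tensor \<Rightarrow> 'k" assume "v \<in> {(\<lambda>t. t l) | l. length l = q}"
    then obtain l where "v = (\<lambda>t. t l)" "length l = q" by blast
    then show "\<exists>h\<in>tensor_polys p. \<forall>s\<in>UNIV. v (L s) = h s" using poly by (intro bexI[of _ "\<lambda>t. L t l"]) auto
  qed
  then obtain h where h: "h \<in> tensor_polys p" "\<And>s. f (L s) = h s" by blast
  have "h s = 0" if s: "s \<in> tensors p" "tensor_rank p s \<le> k" for s
  proof -
    obtain c v where cv: "s = (\<lambda>l. \<Sum>i<k. c i * tprod p (v i) l)"
      using s(2) unfolding tensor_rank_le_tprod[OF s(1)] by (elim exE)
    have "\<forall>i. \<exists>dw. L (tprod p (v i)) = (\<lambda>l. fst dw * tprod q (snd dw) l)" using pure by simp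
    from choice[OF this] obtain dw where dw: "\<forall>i. L (tprod p (v i)) = (\<lambda>l. fst (dw i) * tprod q (snd (dw i)) l)" ..
    have "L s = (\<lambda>l. \<Sum>i<k. (c i * fst (dw i)) * tprod q (snd (dw i)) l)"
      unfolding cv sum using dw by (simp add: mult.assoc)
    then have "tensor_rank q (L s) \<le> k" unfolding tensor_rank_le_tprod[OF closed[OF s(1)]]
      by (intro exI[of _ "\<lambda>i. c i * fst (dw i)"] exI[of _ "\<lambda>i. snd (dw i)"])
    then show ?thesis using z closed[OF s(1)] h(2)[of s] by simp
  qed
  then have "h t = 0" using t h(1) unfolding X_fin_polys by blast
  then show "f (L t) = 0" by (simp add: h(2))
qed

lemma X_fin_contract:
  fixes x0 :: "'k::field ^ 'n::finite \<Rightarrow> 'k"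
  assumes lin: "Vector_Spaces.linear (*s) (*) x0" and t: "t \<in> X_fin k (Suc p)"
  shows "contract x0 t \<in> X_fin k p"
proof (rule X_fin_linear_image[OF _ _ _ _ t])
  fix l :: "'n list" assume "length l = p"
  then show "(\<lambda>t. contract x0 t l) \<in> tensor_polys (Suc p)"
    unfolding contract_def by (intro polys_sum polys.mult polys.const tensor_coordinate) simp
next
  fix k :: nat and c T
  show "contract x0 (\<lambda>l. \<Sum>i<k. c i * T i l) = (\<lambda>l. \<Sum>i<k. c i * contract x0 (T i) l)"
    by (rule ext, simp add: contract_def sum_distrib_left mult_ac, rule sum.swap)
next
  fix v
  show "\<exists>c w. contract x0 (tprod (Suc p) v) = (\<lambda>l. c * tprod p w l)" using contract_tprod[OF lin] by blast
qed (rule contract_tensors)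

lemma X_fin_tensor_act:
  fixes t :: "('k::field, 'n::finite) tensor"
  assumes g: "g \<in> carrier (G_fin p)" and t: "t \<in> X_fin k p"
  shows "tensor_act p g t \<in> X_fin k p"
proof (rule X_fin_linear_image[OF _ _ _ _ t])
  fix l :: "'n list" assume "length l = p"
  then show "(\<lambda>t. tensor_act p g t l) \<in> tensor_polys p"
    by (simp add: tensor_act_def perm_act_def gl_act_def)
       (intro polys_sum polys.mult polys.const tensor_coordinate, simp)
next
  fix k :: nat and c T
  show "tensor_act p g (\<lambda>l. \<Sum>i<k. c i * T i l) = (\<lambda>l. \<Sum>i<k. c i * tensor_act p g (T i) l)"
  proof
    fix l
    show "tensor_act p g (\<lambda>l. \<Sum>i<k. c i * T i l) l = (\<Sum>i<k. c i * tensor_act p g (T i) l)"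
    proof (cases "length l = p")
      case True
      then show ?thesis
        by (simp add: tensor_act_def perm_act_def gl_act_def sum_distrib_left, subst sum.swap,
            simp add: mult.left_commute)
    qed (simp add: tensor_act_def perm_act_def)
  qed
next
  fix v
  have "fst g permutes {..<p}" using g by (auto simp: G_fin_def)
  then have "tensor_act p g (tprod p v) = (\<lambda>l. 1 * tprod p ((\<lambda>i. snd g i *v v i) \<circ> inv_into UNIV (fst g)) l)"
    by (simp add: tensor_act_def gl_act_tprod perm_act_tprod)
  then show "\<exists>c w. tensor_act p g (tprod p v) = (\<lambda>l. c * tprod p w l)" by blast
qed (rule tensor_act_closed)

text \<open>
  In degrees where the group element acts on the tensor power itself, it preserves bounded border rank;
  the lower degrees follow by contraction.
\<close>

lemma X_inf_act:
  assumes lin: "Vector_Spaces.linear (*s) (*) x0" and g: "g \<in> carrier G_inf" and \<omega>: "\<omega> \<in> X_inf x0 k"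
  shows "A_act x0 g \<omega> \<in> X_inf x0 k"
proof -
  have A: "\<omega> \<in> A_inf x0" "\<And>p. \<omega> p \<in> X_fin k p" using \<omega> by (auto simp: X_inf_def)
  have A': "A_act x0 g \<omega> \<in> A_inf x0" by (rule A_act_closed[OF A(1) g])
  obtain r where r: "g \<in> carrier (G_fin r)" using g by (auto simp: G_inf_def)
  have big: "A_act x0 g \<omega> q \<in> X_fin k q" if "r \<le> q" for q
    using A_act_eq[OF A(1) r that] X_fin_tensor_act[OF _ A(2)[of q], of g] G_fin_mono[OF that] r by auto
  have "A_act x0 g \<omega> q \<in> X_fin k q" for q
  proof (cases "r \<le> q")
    case False
    then have "q \<le> r" by simp
    then show ?thesis
    proof (induction q rule: inc_induct)
      case (step q)
      then have "contract x0 (A_act x0 g \<omega> (Suc q)) \<in> X_fin k q" by (intro X_fin_contract[OF lin])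
      then show ?case using A' by (simp add: A_inf_def)
    qed (rule big, simp)
  qed (rule big)
  then show ?thesis using A' by (simp add: X_inf_def)
qed

text \<open>
  A pure tensor has product form with respect to \<open>I\<close> and its complement, so the flattening of a sum of \<open>k\<close>
  pure tensors factors through dimension \<open>k\<close>.
\<close>

lemma rank_minor_zero:
  assumes s: "s \<in> tensors p" "tensor_rank p s \<le> k"
  shows "minor (Suc k) (\<lambda>a b. ev p s (mix I (ys a) (zs b))) = 0"
proof -
  obtain c v where cv: "s = (\<lambda>l. \<Sum>i<k. c i * tprod p (v i) l)"
    using s(2) unfolding tensor_rank_le_tprod[OF s(1)] by (elim exE)
  let ?d = "\<lambda>y r i. \<Sum>j\<in>UNIV. vec_nth (y i) j * vec_nth (v r i) j"
  have "ev p s (mix I y z) = (\<Sum>r<k. (c r * (\<Prod>i\<in>{..<p} \<inter> I. ?d y r i)) * (\<Prod>i\<in>{..<p} - I. ?d z r i))" for y z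
  proof -
    have "(\<Prod>i<p. ?d (mix I y z) r i) = (\<Prod>i\<in>{..<p} \<inter> I. ?d y r i) * (\<Prod>i\<in>{..<p} - I. ?d z r i)" for r
    proof -
      have "(\<Prod>i<p. ?d (mix I y z) r i)
        = (\<Prod>i\<in>{..<p} \<inter> I. ?d (mix I y z) r i) * (\<Prod>i\<in>{..<p} - I. ?d (mix I y z) r i)"
        by (rule prod.Int_Diff) simp
      moreover have "(\<Prod>i\<in>{..<p} \<inter> I. ?d (mix I y z) r i) = (\<Prod>i\<in>{..<p} \<inter> I. ?d y r i)"
        "(\<Prod>i\<in>{..<p} - I. ?d (mix I y z) r i) = (\<Prod>i\<in>{..<p} - I. ?d z r i)"
        by (intro prod.cong; simp add: mix_def)+
      ultimately show ?thesis by (simp only:)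
    qed
    then show ?thesis unfolding cv ev_sum ev_tprod by (simp add: mult.assoc)
  qed
  then show ?thesis
    by (intro minor_factor_zero[of k _ _ "\<lambda>a r. c r * (\<Prod>i\<in>{..<p} \<inter> I. ?d (ys a) r i)" "\<lambda>r b. \<Prod>i\<in>{..<p} - I. ?d (zs b) r i"]) simp_all
qed

lemma X_inf_rank_lt:
  assumes \<omega>: "\<omega> \<in> X_inf x0 k" shows "form_of x0 \<omega> \<in> rank_lt (covector x0) (Suc k)"
proof -
  have A: "\<omega> \<in> A_inf x0" "\<And>p. \<omega> p \<in> X_fin k p" using \<omega> by (auto simp: X_inf_def)
  have "flattening_minor (form_of x0 \<omega>) (Suc k) I ys zs = 0"
    if ys: "\<forall>a<Suc k. adm (covector x0) (ys a)" and zs: "\<forall>b<Suc k. adm (covector x0) (zs b)" for I ys zs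
  proof -
    have "finite ((\<Union>a\<in>{..<Suc k}. {i. ys a i \<noteq> covector x0}) \<union> (\<Union>b\<in>{..<Suc k}. {i. zs b i \<noteq> covector x0}))"
      using ys zs by (auto simp: adm_def)
    then obtain p where p: "(\<Union>a\<in>{..<Suc k}. {i. ys a i \<noteq> covector x0}) \<union> (\<Union>b\<in>{..<Suc k}. {i. zs b i \<noteq> covector x0}) \<subseteq> {..<p}"
      by (auto simp: finite_nat_iff_bounded)
    have "form_of x0 \<omega> (mix I (ys a) (zs b)) = ev p (\<omega> p) (mix I (ys a) (zs b))" if "a < Suc k" "b < Suc k" for a b
    proof (rule form_of_eq[OF A(1)], intro allI impI)
      fix i assume "p \<le> i"
      then have "ys a i = covector x0" "zs b i = covector x0" using p that by (auto simp: subset_iff)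
      then show "mix I (ys a) (zs b) i = covector x0" by (simp add: mix_def)
    qed
    then have "flattening_minor (form_of x0 \<omega>) (Suc k) I ys zs = minor (Suc k) (\<lambda>a b. ev p (\<omega> p) (mix I (ys a) (zs b)))"
      unfolding flattening_minor_def by (intro minor_cong) auto
    also have "\<dots> = 0"
    proof -
      have poly: "(\<lambda>t. minor (Suc k) (\<lambda>a b. ev p t (mix I (ys a) (zs b)))) \<in> tensor_polys p"
        by (intro minor_polys ev_polys)
      have "\<forall>f\<in>tensor_polys p. (\<forall>s\<in>tensors p. tensor_rank p s \<le> k \<longrightarrow> f s = 0) \<longrightarrow> f (\<omega> p) = 0"
        using A(2)[of p] unfolding X_fin_polys by (rule conjunct2)
      from mp[OF bspec[OF this poly]] show ?thesis by (simp add: rank_minor_zero)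
    qed
    finally show ?thesis .
  qed
  then show ?thesis using multilin_form_of[OF A(1)] by (simp add: rank_lt_def)
qed

section \<open>Equations for bounded border rank\<close>

lemma covector_nonzero:
  assumes "Vector_Spaces.linear (*s) (*) x0" "x0 \<noteq> (\<lambda>_. 0)"
  shows "\<exists>o'. vec_nth (covector x0) o' \<noteq> 0"
proof (rule ccontr)
  assume "\<not> ?thesis"
  then have "x0 v = 0" for v using linear_expand[OF assms(1), of v] by (simp add: covector_def)
  then show False using assms(2) by auto
qed

text \<open>
  The minors used in \<open>detect_rank\<close> are elements of \<open>T_inf\<close>.
\<close>

lemma wseq_minor_tpoly:
  "\<exists>h\<in>T_fin P. \<forall>\<omega>\<in>A_inf x0. flattening_minor (form_of x0 \<omega>) k I (\<lambda>a. wseq (covector x0) o' P (\<rho> ! a))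
     (\<lambda>b. wseq (covector x0) o' P (\<gamma> ! b)) = tpoly_val h (\<omega> P)"
proof -
  let ?y = "\<lambda>a b. mix I (wseq (covector x0) o' P (\<rho> ! a)) (wseq (covector x0) o' P (\<gamma> ! b))"
  have "(\<lambda>t. minor k (\<lambda>a b. ev P t (?y a b))) \<in> tensor_polys P" by (intro minor_polys ev_polys)
  then obtain h where h: "h \<in> T_fin P" "\<forall>t. minor k (\<lambda>a b. ev P t (?y a b)) = tpoly_val h t"
    using polys_tpoly_val by blast
  have "form_of x0 \<omega> (?y a b) = ev P (\<omega> P) (?y a b)" if "\<omega> \<in> A_inf x0" for \<omega> a b
    by (rule form_of_eq[OF that]) (simp add: mix_def wseq_def)
  then show ?thesis using h by (intro bexI[of _ h]) (simp_all add: flattening_minor_def)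
qed

theorem theorem3p1:
  fixes x0 :: "'k::field ^ 'n::finite \<Rightarrow> 'k" and k :: nat
  assumes "infinite (UNIV :: 'k set)"
    and "Vector_Spaces.linear (*s) (*) x0"
    and "x0 \<noteq> (\<lambda>_. 0)"
  shows "\<exists>Orbs. finite Orbs \<and> Orbs \<subseteq> orbits G_inf (T_inf x0) (T_act x0) \<and>
    X_inf x0 k = {\<omega> \<in> A_inf x0. \<forall>f \<in> \<Union>Orbs. f \<omega> = 0}"
proof -
  interpret group "G_inf :: ('k, 'n) gelem monoid" by (rule group_G_inf)
  let ?\<xi> = "covector x0"
  obtain o' where o': "vec_nth ?\<xi> o' \<noteq> 0" using covector_nonzero[OF assms(2,3)] by blast
  define F where "F = {f \<in> T_inf x0. \<forall>\<omega>\<in>X_inf x0 k. f \<omega> = 0}"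
  have "\<forall>f\<in>F. \<exists>f'. f' \<in> form_polys ?\<xi> \<and> (\<forall>\<omega>\<in>A_inf x0. f \<omega> = f' (form_of x0 \<omega>))"
  proof
    fix f assume "f \<in> F"
    then obtain p h where "h \<in> T_fin p" "f = tpoly_fun x0 p h" by (auto simp: F_def T_inf_def)
    moreover from this obtain f' where "f' \<in> form_polys ?\<xi>" "\<forall>\<omega>\<in>A_inf x0. tpoly_val h (\<omega> p) = f' (form_of x0 \<omega>)"
      using tpoly_as_form_poly[of h p x0] by blast
    ultimately show "\<exists>f'. f' \<in> form_polys ?\<xi> \<and> (\<forall>\<omega>\<in>A_inf x0. f \<omega> = f' (form_of x0 \<omega>))"
      by (intro exI[of _ f']) (simp add: tpoly_fun_def)
  qed
  from bchoice[OF this] obtain \<phi>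
    where \<phi>: "\<forall>f\<in>F. \<phi> f \<in> form_polys ?\<xi> \<and> (\<forall>\<omega>\<in>A_inf x0. f \<omega> = \<phi> f (form_of x0 \<omega>))" ..
  have "\<phi> ` F \<subseteq> form_polys ?\<xi>" using \<phi> by blast
  from rank_lt_noetherian[OF assms(1) o' this, of "Suc k"]
  obtain G where G: "G \<subseteq> \<phi> ` F" "finite G" and Gz: "\<forall>\<Omega>\<in>rank_lt ?\<xi> (Suc k).
    (\<forall>f\<in>G. \<forall>g\<in>carrier G_inf. f (\<Omega> \<circ> gact g) = 0) \<longrightarrow> (\<forall>f\<in>\<phi> ` F. f \<Omega> = 0)" by (elim exE conjE)
  obtain F0 where F0: "F0 \<subseteq> F" "finite F0" "G = \<phi> ` F0" using finite_subset_image[OF G(2,1)] by blast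
  let ?P = "2 * Suc k"
  define D where "D = Pow {..<?P} \<times> (words (Suc k) ?P :: 'n list list set) \<times> (words (Suc k) ?P :: 'n list list set)"
  have finD: "finite D" by (simp add: D_def finite_words)
  let ?m = "\<lambda>d \<Omega>. flattening_minor \<Omega> (Suc k) (fst d) (\<lambda>a. wseq ?\<xi> o' ?P (fst (snd d) ! a)) (\<lambda>b. wseq ?\<xi> o' ?P (snd (snd d) ! b))"
  have "\<forall>d. \<exists>h. h \<in> T_fin ?P \<and> (\<forall>\<omega>\<in>A_inf x0. ?m d (form_of x0 \<omega>) = tpoly_val h (\<omega> ?P))"
    using wseq_minor_tpoly[of ?P x0 "Suc k"] unfolding Bex_def by blast
  from choice[OF this] obtain H where H: "\<forall>d. H d \<in> T_fin ?P \<and> (\<forall>\<omega>\<in>A_inf x0. ?m d (form_of x0 \<omega>) = tpoly_val (H d) (\<omega> ?P))" ..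
  define M where "M = (\<lambda>d. tpoly_fun x0 ?P (H d)) ` D"
  have Meq: "tpoly_fun x0 ?P (H d) \<omega> = ?m d (form_of x0 \<omega>)" if "\<omega> \<in> A_inf x0" for d \<omega>
    using H that by (simp add: tpoly_fun_def)
  have XA: "\<omega> \<in> A_inf x0" if "\<omega> \<in> X_inf x0 k" for \<omega> using that by (simp add: X_inf_def)
  have M0: "?m d (form_of x0 \<omega>) = 0" if "\<omega> \<in> X_inf x0 k" for d \<omega>
    using X_inf_rank_lt[OF that] unfolding rank_lt_def by (simp del: mult_Suc_right)
  have MF: "M \<subseteq> F"
  proof
    fix f assume "f \<in> M"
    then obtain d where d: "f = tpoly_fun x0 ?P (H d)" by (auto simp: M_def)
    have "f \<in> T_inf x0" using H unfolding T_inf_def d by blast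
    moreover have "f \<omega> = 0" if "\<omega> \<in> X_inf x0 k" for \<omega> using Meq[OF XA[OF that]] M0[OF that] d by simp
    ultimately show "f \<in> F" by (simp add: F_def)
  qed
  define Orbs where "Orbs = orbit G_inf (T_act x0) ` (F0 \<union> M)"
  have "finite Orbs" using F0(2) finD by (simp add: Orbs_def M_def)
  moreover have "Orbs \<subseteq> orbits G_inf (T_inf x0) (T_act x0)"
    using F0(1) MF by (auto simp: Orbs_def orbits_def F_def)
  moreover have "X_inf x0 k = {\<omega> \<in> A_inf x0. \<forall>f \<in> \<Union>Orbs. f \<omega> = 0}"
  proof (rule Set.set_eqI, rule iffI)
    fix \<omega> assume \<omega>: "\<omega> \<in> X_inf x0 k"
    have "f \<omega> = 0" if fO: "f \<in> \<Union>Orbs" for f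
    proof -
      obtain e g where e: "e \<in> F" "g \<in> carrier G_inf" "f = T_act x0 g e"
        using fO F0(1) MF unfolding Orbs_def orbit_def by blast
      have "e (A_act x0 (inv\<^bsub>G_inf\<^esub> g) \<omega>) = 0"
        using e(1) X_inf_act[OF assms(2) inv_closed[OF e(2)] \<omega>] by (simp add: F_def)
      then show ?thesis using XA[OF \<omega>] by (simp add: e(3) T_act_def)
    qed
    then show "\<omega> \<in> {\<omega> \<in> A_inf x0. \<forall>f \<in> \<Union>Orbs. f \<omega> = 0}" using XA[OF \<omega>] by blast
  next
    fix \<omega> assume "\<omega> \<in> {\<omega> \<in> A_inf x0. \<forall>f \<in> \<Union>Orbs. f \<omega> = 0}"
    then have \<omega>: "\<omega> \<in> A_inf x0" and z: "\<And>f. f \<in> \<Union>Orbs \<Longrightarrow> f \<omega> = 0" by auto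
    have van: "e (A_act x0 g \<omega>) = 0" if e: "e \<in> F0 \<union> M" and g: "g \<in> carrier G_inf" for e g
    proof -
      have "T_act x0 (inv\<^bsub>G_inf\<^esub> g) e \<in> orbit G_inf (T_act x0) e"
        unfolding orbit_def using inv_closed[OF g] by blast
      moreover have "orbit G_inf (T_act x0) e \<in> Orbs" unfolding Orbs_def using e by (rule imageI)
      ultimately have "T_act x0 (inv\<^bsub>G_inf\<^esub> g) e \<in> \<Union>Orbs" by blast
      then have "T_act x0 (inv\<^bsub>G_inf\<^esub> g) e \<omega> = 0" by (rule z)
      then show ?thesis using \<omega> g by (simp add: T_act_def)
    qed
    have rk: "form_of x0 \<omega> \<in> rank_lt ?\<xi> (Suc k)"
    proof (rule ccontr)
      assume "form_of x0 \<omega> \<notin> rank_lt ?\<xi> (Suc k)"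
      from detect_rank[OF assms(1) o' multilin_form_of[OF \<omega>] this refl]
      obtain g I \<rho> \<gamma> where g: "g \<in> carrier G_inf" and d: "(I, \<rho>, \<gamma>) \<in> D"
        and nz: "?m (I, \<rho>, \<gamma>) (form_of x0 \<omega> \<circ> gact g) \<noteq> 0"
        unfolding D_def by (auto simp del: mult_Suc_right)
      have "tpoly_fun x0 ?P (H (I, \<rho>, \<gamma>)) (A_act x0 g \<omega>) = 0" by (rule van[OF _ g]) (use d in \<open>auto simp: M_def\<close>)
      then show False using nz Meq[OF A_act_closed[OF \<omega> g]] form_of_act[OF \<omega> g] by simp
    qed
    have "f (form_of x0 \<omega> \<circ> gact g) = 0" if f: "f \<in> G" and g: "g \<in> carrier G_inf" for f g
    proof -
      obtain e where e: "e \<in> F0" "f = \<phi> e" using f F0(3) by blast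
      have "f (form_of x0 (A_act x0 g \<omega>)) = e (A_act x0 g \<omega>)"
        using \<phi> e F0(1) A_act_closed[OF \<omega> g] by auto
      then show ?thesis using van[of e g] e(1) g form_of_act[OF \<omega> g] by simp
    qed
    then have "\<forall>f\<in>\<phi> ` F. f (form_of x0 \<omega>) = 0" using Gz rk by blast
    then have F\<omega>: "f \<omega> = 0" if "f \<in> F" for f using \<phi> that \<omega> by simp
    have "\<omega> p \<in> X_fin k p" for p
      unfolding X_fin_def zariski_closure_def
    proof (intro CollectI conjI ballI impI)
      show "\<omega> p \<in> tensors p" using \<omega> by (simp add: A_inf_def)
      fix h :: "('k, 'n) tpoly"
      assume h: "h \<in> T_fin p" and hz: "\<forall>s\<in>{t \<in> tensors p. tensor_rank p t \<le> k}. tpoly_val h s = 0"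
      have "tpoly_fun x0 p h \<in> F" unfolding F_def
      proof (intro CollectI conjI ballI)
        show "tpoly_fun x0 p h \<in> T_inf x0" using h by (auto simp: T_inf_def)
        fix \<psi> assume \<psi>: "\<psi> \<in> X_inf x0 k"
        then have "\<psi> p \<in> X_fin k p" by (simp add: X_inf_def)
        then have "tpoly_val h (\<psi> p) = 0" using h hz by (simp add: X_fin_def zariski_closure_def)
        then show "tpoly_fun x0 p h \<psi> = 0" using XA[OF \<psi>] by (simp add: tpoly_fun_def)
      qed
      then show "tpoly_val h (\<omega> p) = 0" using F\<omega>[of "tpoly_fun x0 p h"] \<omega> by (simp add: tpoly_fun_def)
    qed
    then show "\<omega> \<in> X_inf x0 k" using \<omega> by (simp add: X_inf_def)
  qed
  ultimately show ?thesis by blast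
qed

end
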